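(* Let $s\in\widehat{K}$. There exist a subgroup $H\le G$ and a finite subgroup $J\le G(s)\cap H$ such that $G$ is the free product of $G(s)$ and $H$ amalgamated along $J$: $G=G(s)\ast_J H$.
   Context: Let $\mathbb{F}_q$ be a finite field, $K$ an algebraic function field in one variable with constant field $\mathbb{F}_q$, $\infty$ a fixed place of $K$, and $A$ the ring of elements of $K$ integral at every place other than $\infty$. Let $G=GL_2(A)$ act on $\widehat{K}=\mathbb{P}^1(K)=K\cup\{\infty\}$ by Möbius transformations, and let $G(s)$ be the stabilizer of $s\in\widehat{K}$ in $G$. *)

theory Defs
  imports
    "HOL-Analysis.Determinants"
    "HOL-Algebra.Group_Action"
    "HOL-Algebra.Generated_Fields"
    "HOL-Algebra.Finite_Extensions"
    "HOL-Algebra.Algebraic_Closure_Type"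
begin

no_notation fps_nth (infixl \<open>$\<close> 75)

section \<open>Algebraic function fields in one variable and their places\<close>

text \<open>
  The function field is the whole type \<open>'k\<close>; the constant field is a subset \<open>F\<close>.  The notions of
  \<open>HOL-Algebra\<close> are applied to \<open>'k\<close> through \<^const>\<open>ring_of_type_algebra\<close>.
  The last clause says that \<open>F\<close> is the full constant field.
\<close>

definition function_field :: "'k::field set \<Rightarrow> bool" where
  "function_field F \<longleftrightarrow>
     subfield F (ring_of_type_algebra :: 'k ring) \<and>
     (\<exists>x. ring.transcendental ring_of_type_algebra F x \<and>
          ring.finite_dimension ring_of_type_algebra
            (generate_field ring_of_type_algebra (insert x F)) (UNIV :: 'k set)) \<and>
     (\<forall>x. \<not> ring.transcendental ring_of_type_algebra F x \<longrightarrow> x \<in> F)"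

definition valuation_ring :: "'k::field set \<Rightarrow> 'k set \<Rightarrow> bool" where
  "valuation_ring F V \<longleftrightarrow>
     subring V (ring_of_type_algebra :: 'k ring) \<and> F \<subset> V \<and> V \<subset> UNIV \<and>
     (\<forall>z. z \<in> V \<or> inverse z \<in> V)"

text \<open>
  A place is the maximal ideal of a valuation ring of the function field.  That valuation ring is
  unique (lemma \<open>valuation_ring_of_place_unique\<close>), and its elements are those integral at the place.
\<close>

definition valuation_ring_at :: "'k::field set \<Rightarrow> 'k set \<Rightarrow> 'k set \<Rightarrow> bool" where
  "valuation_ring_at F P V \<longleftrightarrow>
     valuation_ring F V \<and> maximalideal P ((ring_of_type_algebra :: 'k ring)\<lparr>carrier := V\<rparr>)"

definition place :: "'k::field set \<Rightarrow> 'k set \<Rightarrow> bool" where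
  "place F P \<longleftrightarrow> (\<exists>V. valuation_ring_at F P V)"

definition integral_at :: "'k::field set \<Rightarrow> 'k set \<Rightarrow> 'k \<Rightarrow> bool" where
  "integral_at F P z \<longleftrightarrow> (\<exists>V. valuation_ring_at F P V \<and> z \<in> V)"

definition integral_away :: "'k::field set \<Rightarrow> 'k set \<Rightarrow> 'k set" where
  "integral_away F Pinf = {z. \<forall>P. place F P \<and> P \<noteq> Pinf \<longrightarrow> integral_at F P z}"

lemma ring_of_type_algebra_simps:
  "carrier (ring_of_type_algebra :: 'k::field ring) = UNIV"
  "x \<otimes>\<^bsub>ring_of_type_algebra\<^esub> y = x * (y :: 'k)"
  "x \<oplus>\<^bsub>ring_of_type_algebra\<^esub> y = x + (y :: 'k)"
  "\<one>\<^bsub>ring_of_type_algebra\<^esub> = (1 :: 'k)"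
  "\<zero>\<^bsub>ring_of_type_algebra\<^esub> = (0 :: 'k)"
  unfolding ring_of_type_algebra_def by simp_all

lemma ring_of_type_algebra_uminus:
  "\<ominus>\<^bsub>ring_of_type_algebra\<^esub> x = - (x :: 'k::field)"
proof -
  have "abelian_group (ring_of_type_algebra :: 'k ring)"
    using ring_from_type_algebra by (rule ring.is_abelian_group)
  then show ?thesis
    by (rule abelian_group.minus_equality)
      (simp_all only: ring_of_type_algebra_simps add.left_inverse UNIV_I)
qed

lemma subring_iff:
  "subring V (ring_of_type_algebra :: 'k::field ring) \<longleftrightarrow>
     1 \<in> V \<and> (\<forall>x\<in>V. - x \<in> V) \<and> (\<forall>x\<in>V. \<forall>y\<in>V. x + y \<in> V \<and> x * y \<in> V)"
proof -
  interpret ring "ring_of_type_algebra :: 'k ring" by (rule ring_from_type_algebra)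
  show ?thesis
  proof
    assume "subring V (ring_of_type_algebra :: 'k ring)"
    from subringE[OF this] show "1 \<in> V \<and> (\<forall>x\<in>V. - x \<in> V) \<and> (\<forall>x\<in>V. \<forall>y\<in>V. x + y \<in> V \<and> x * y \<in> V)"
      by (simp add: ring_of_type_algebra_simps ring_of_type_algebra_uminus)
  next
    assume "1 \<in> V \<and> (\<forall>x\<in>V. - x \<in> V) \<and> (\<forall>x\<in>V. \<forall>y\<in>V. x + y \<in> V \<and> x * y \<in> V)"
    then show "subring V (ring_of_type_algebra :: 'k ring)"
      by (intro subringI) (simp_all add: ring_of_type_algebra_simps ring_of_type_algebra_uminus)
  qed
qed

lemma valuation_ring_at_eq:
  fixes V :: "'k::field set"
  assumes "valuation_ring_at F P V"
  shows "V = {z. z = 0 \<or> inverse z \<notin> P}"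
proof -
  let ?R = "ring_of_type_algebra :: 'k ring"
  let ?S = "?R\<lparr>carrier := V\<rparr>"
  have vr: "valuation_ring F V" and mx: "maximalideal P ?S"
    using assms by (auto simp: valuation_ring_at_def)
  have sub: "subring V ?R" and inv: "z \<in> V \<or> inverse z \<in> V" for z
    using vr by (auto simp: valuation_ring_def)
  have V: "1 \<in> V" "x \<in> V \<Longrightarrow> - x \<in> V" "x \<in> V \<Longrightarrow> y \<in> V \<Longrightarrow> x + y \<in> V"
    "x \<in> V \<Longrightarrow> y \<in> V \<Longrightarrow> x * y \<in> V" for x y
    using sub by (auto simp: subring_iff)
  have V0: "0 \<in> V" using V(1) V(2)[of 1] V(3)[of 1 "- 1"] by simp
  interpret R: ring ?R by (rule ring_from_type_algebra)
  interpret S: ring ?S by (rule R.subring_is_ring[OF sub])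
  interpret P: maximalideal P ?S by (rule mx)
  define M where "M = {z \<in> V. z = 0 \<or> inverse z \<notin> V}"
  have PV: "P \<subseteq> V" using P.a_subset by simp
  have Pmul: "x * y \<in> P" if "x \<in> V" "y \<in> P" for x y
    using P.I_l_closed[of y x] that by (simp add: ring_of_type_algebra_simps)
  have "1 \<notin> P"
  proof
    assume "1 \<in> P"
    then have "V \<subseteq> P" using Pmul[of _ 1] by auto
    then show False using P.I_notcarr PV by auto
  qed
  have PM: "P \<subseteq> M"
  proof
    fix p assume p: "p \<in> P"
    have "p = 0" if "inverse p \<in> V"
      using Pmul[OF that p] \<open>1 \<notin> P\<close> by (cases "p = 0") simp_all
    then show "p \<in> M" using p PV by (auto simp: M_def)
  qed
  have Mmul: "x * y \<in> M" if "x \<in> V" "y \<in> M" for x y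
  proof (cases "x * y = 0")
    case False
    have "inverse (x * y) \<notin> V"
    proof
      assume "inverse (x * y) \<in> V"
      then have "x * inverse (x * y) \<in> V" using that V(4) by blast
      then show False using that False by (simp add: M_def field_simps)
    qed
    then show ?thesis using that V(4) by (auto simp: M_def)
  qed (use V0 in \<open>auto simp: M_def\<close>)
  have Madd1: "x + y \<in> M" if "x \<in> M" "y \<in> M" "x / y \<in> V" "y \<noteq> 0" for x y
  proof -
    have "x + y = (x / y + 1) * y" using that by (simp add: field_simps)
    then show ?thesis using Mmul V(1,3) that by metis
  qed
  have Madd: "x + y \<in> M" if "x \<in> M" "y \<in> M" for x y
  proof (cases "x = 0 \<or> y = 0")
    case False
    then show ?thesis using Madd1[of x y] Madd1[of y x] inv[of "x / y"] that
      by (auto simp: add.commute)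
  qed (use that in auto)
  have "ideal M ?S"
  proof (rule idealI)
    show "subgroup M (add_monoid ?S)"
    proof (rule S.add.subgroupI)
      show "\<ominus>\<^bsub>?S\<^esub> x \<in> M" if "x \<in> M" for x
      proof -
        have "(- x) \<oplus>\<^bsub>?S\<^esub> x = \<zero>\<^bsub>?S\<^esub>" by (simp add: ring_of_type_algebra_simps)
        then have "\<ominus>\<^bsub>?S\<^esub> x = - x"
          using that V(2) by (intro S.minus_equality) 
             (auto simp: M_def ring_of_type_algebra_simps)
        then show ?thesis using Mmul[of "- 1" x] V that by simp
      qed
    qed (use V0 Madd in \<open>auto simp: M_def ring_of_type_algebra_simps\<close>)
    show "ring ?S" by (rule S.ring_axioms)
    fix a x assume "a \<in> M" "x \<in> carrier ?S"
    then have "x * a \<in> M" using Mmul by simp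
    then show "x \<otimes>\<^bsub>?S\<^esub> a \<in> M" "a \<otimes>\<^bsub>?S\<^esub> x \<in> M"
      by (simp_all add: ring_of_type_algebra_simps mult.commute)
  qed
  then have "M = P \<or> M = V"
    using P.I_maximal[of M] PM by (auto simp: M_def)
  moreover have "1 \<notin> M" by (simp add: M_def V(1))
  ultimately have "M = P" using V(1) by blast
  then show ?thesis
    using inv V0 inverse_inverse_eq unfolding M_def by fastforce
qed

lemma valuation_ring_of_place_unique:
  "valuation_ring_at F P V \<Longrightarrow> valuation_ring_at F P W \<Longrightarrow> V = W"
  using valuation_ring_at_eq by blast

lemma subring_integral_away: "subring (integral_away F Pinf) (ring_of_type_algebra :: 'k::field ring)"
proof -
  have "integral_away F Pinf = \<Inter> {V. \<exists>P. valuation_ring_at F P V \<and> P \<noteq> Pinf}"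
    unfolding integral_away_def place_def integral_at_def
    using valuation_ring_of_place_unique by blast
  moreover have "subring V ring_of_type_algebra" if "valuation_ring_at F P V" for P V
    using that by (simp add: valuation_ring_at_def valuation_ring_def)
  ultimately show ?thesis unfolding subring_iff by blast
qed



section \<open>The group of invertible matrices and its action on the projective line\<close>

definition mat2_monoid :: "'k::field set \<Rightarrow> ('k^2^2) monoid" where
  "mat2_monoid A = \<lparr>carrier = {M. \<forall>i j. M $ i $ j \<in> A}, monoid.mult = (**), one = mat 1\<rparr>"

definition GL2 :: "'k::field set \<Rightarrow> ('k^2^2) monoid" where
  "GL2 A = units_of (mat2_monoid A)"

text \<open>The projective line is \<open>'k option\<close>, with \<^const>\<open>None\<close> the point at infinity.\<close>

definition moebius :: "'k::field^2^2 \<Rightarrow> 'k option \<Rightarrow> 'k option" where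
  "moebius M s = (case s of
      None \<Rightarrow> if M$2$1 = 0 then None else Some (M$1$1 / M$2$1)
    | Some z \<Rightarrow> if M$2$1 * z + M$2$2 = 0 then None
                else Some ((M$1$1 * z + M$1$2) / (M$2$1 * z + M$2$2)))"

lemma group_GL2:
  assumes "subring A (ring_of_type_algebra :: 'k::field ring)"
  shows "group (GL2 A)"
proof -
  have A: "1 \<in> A" "x \<in> A \<Longrightarrow> - x \<in> A" "x \<in> A \<Longrightarrow> y \<in> A \<Longrightarrow> x + y \<in> A"
    "x \<in> A \<Longrightarrow> y \<in> A \<Longrightarrow> x * y \<in> A" for x y
    using assms by (auto simp: subring_iff)
  have "0 \<in> A" using A(1) A(2)[of 1] A(3)[of 1 "- 1"] by simp
  moreover have "(M ** N) $ i $ j \<in> A" if "\<forall>i j. M $ i $ j \<in> A" "\<forall>i j. N $ i $ j \<in> A" for M N :: "'k^2^2" and i j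
    using that A by (simp add: matrix_matrix_mult_def sum_2)
  ultimately have "Group.monoid (mat2_monoid A)"
    using A(1) by unfold_locales (auto simp: mat2_monoid_def matrix_mul_assoc, auto simp: mat_def)
  then show ?thesis unfolding GL2_def by (rule Group.monoid.units_group)
qed

lemma GL2_D:
  assumes "M \<in> carrier (GL2 A)"
  obtains N where "N \<in> carrier (GL2 A)" "M ** N = mat 1" "N ** M = mat 1"
  using assms unfolding GL2_def units_of_def Units_def mat2_monoid_def by auto

lemma moebius_one: "moebius (mat 1 :: 'k::field^2^2) s = s"
  by (cases s) (simp_all add: moebius_def mat_def)

lemma moebius_mult:
  fixes M N :: "'k::field^2^2"
  assumes "det M \<noteq> 0" "det N \<noteq> 0"
  shows "moebius (M ** N) s = moebius M (moebius N s)"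
proof -
  have M: "M$1$1 * M$2$2 \<noteq> M$1$2 * M$2$1" and N: "N$1$1 * N$2$2 \<noteq> N$1$2 * N$2$1"
    using assms by (auto simp: det_2)
  have e: "(M ** N) $ i $ j = M$i$1 * N$1$j + M$i$2 * N$2$j" for i j
    by (simp add: matrix_matrix_mult_def sum_2)
  define a b c d where "a = M$1$1" and "b = M$1$2" and "c = M$2$1" and "d = M$2$2"
  note abcd = a_def[symmetric] b_def[symmetric] c_def[symmetric] d_def[symmetric]
  note M = M[unfolded abcd]
  have key: "(case (if y = 0 then None else Some (x / y)) of
      None \<Rightarrow> if c = 0 then None else Some (a / c)
    | Some z \<Rightarrow> if c * z + d = 0 then None else Some ((a * z + b) / (c * z + d)))
    = (if c * x + d * y = 0 then None else Some ((a * x + b * y) / (c * x + d * y)))"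
    if "x \<noteq> 0 \<or> y \<noteq> 0" for x y
  proof (cases "y = 0")
    case False
    have "c * (x / y) + d = (c * x + d * y) / y" "a * (x / y) + b = (a * x + b * y) / y"
      using False by (simp_all add: field_simps)
    then show ?thesis using False by simp
  qed (use that in simp)
  show ?thesis
  proof (cases s)
    case None
    have "N$1$1 \<noteq> 0 \<or> N$2$1 \<noteq> 0" using N by auto
    from key[OF this] show ?thesis
      by (simp only: None moebius_def option.case e abcd)
  next
    case (Some z)
    have "N$1$1 * z + N$1$2 \<noteq> 0 \<or> N$2$1 * z + N$2$2 \<noteq> 0"
    proof (rule ccontr)
      assume "\<not> ?thesis"
      then have "N$1$2 = - (N$1$1 * z)" "N$2$2 = - (N$2$1 * z)"
        by (auto simp: add_eq_0_iff)
      then show False using N by (simp add: mult_ac)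
    qed
    moreover have "p * (x * z + y) + q * (v * z + w) = (p * x + q * v) * z + (p * y + q * w)"
      for p q x y v w :: 'k by (simp add: algebra_simps)
    ultimately show ?thesis
      by (simp only: Some moebius_def option.case e abcd key)
  qed
qed

lemma group_action_moebius:
  assumes "subring A (ring_of_type_algebra :: 'k::field ring)"
  shows "group_action (GL2 A) UNIV moebius"
proof -
  interpret group "GL2 A" by (rule group_GL2) fact
  have d: "det M \<noteq> 0" if "M \<in> carrier (GL2 A)" for M
    using that by (metis GL2_D det_I det_mul mult_zero_left zero_neq_one)
  have m: "M \<otimes>\<^bsub>GL2 A\<^esub> N = M ** N" for M N
    by (simp add: GL2_def units_of_def mat2_monoid_def)
  have b: "bij (moebius M)" if M: "M \<in> carrier (GL2 A)" for M
  proof -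
    obtain N where N: "N \<in> carrier (GL2 A)" "M ** N = mat 1" "N ** M = mat 1"
      using GL2_D[OF M] by blast
    show ?thesis
      using moebius_mult[OF d[OF M] d[OF N(1)]] moebius_mult[OF d[OF N(1)] d[OF M]]
      unfolding N moebius_one by (metis bijI')
  qed
  have "group (BijGroup (UNIV :: 'k option set))" by (rule group_BijGroup)
  then show ?thesis
    unfolding group_action_def group_hom_def group_hom_axioms_def hom_def
    using b d group_axioms by (auto simp: BijGroup_def Bij_def m moebius_mult compose_def)
qed


section \<open>Free products with amalgamation\<close>

text \<open>
  The amalgamated product of groups \<open>P\<close> and \<open>Q\<close> along homomorphisms \<open>f : J \<rightarrow> P\<close> and \<open>g : J \<rightarrow> Q\<close>
  is the set of words in the disjoint union of \<open>P\<close> and \<open>Q\<close>, under concatenation, modulo the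
  congruence generated by the multiplication tables of \<open>P\<close> and \<open>Q\<close> and by \<open>f j = g j\<close>.
\<close>

definition amalg_words :: "('a, 'm) monoid_scheme \<Rightarrow> ('b, 'n) monoid_scheme \<Rightarrow> ('a + 'b) list set" where
  "amalg_words P Q = lists (carrier P <+> carrier Q)"

inductive_set amalg_rel ::
  "('a, 'm) monoid_scheme \<Rightarrow> ('b, 'n) monoid_scheme \<Rightarrow> 'c set \<Rightarrow> ('c \<Rightarrow> 'a) \<Rightarrow> ('c \<Rightarrow> 'b)
     \<Rightarrow> (('a + 'b) list \<times> ('a + 'b) list) set"
  for P Q J f g where
    refl: "w \<in> amalg_words P Q \<Longrightarrow> (w, w) \<in> amalg_rel P Q J f g"
  | sym: "(u, v) \<in> amalg_rel P Q J f g \<Longrightarrow> (v, u) \<in> amalg_rel P Q J f g"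
  | trans: "(u, v) \<in> amalg_rel P Q J f g \<Longrightarrow> (v, w) \<in> amalg_rel P Q J f g
      \<Longrightarrow> (u, w) \<in> amalg_rel P Q J f g"
  | append: "(u, v) \<in> amalg_rel P Q J f g \<Longrightarrow> (u', v') \<in> amalg_rel P Q J f g
      \<Longrightarrow> (u @ u', v @ v') \<in> amalg_rel P Q J f g"
  | one_left: "([Inl \<one>\<^bsub>P\<^esub>], []) \<in> amalg_rel P Q J f g"
  | one_right: "([Inr \<one>\<^bsub>Q\<^esub>], []) \<in> amalg_rel P Q J f g"
  | mult_left: "x \<in> carrier P \<Longrightarrow> y \<in> carrier P
      \<Longrightarrow> ([Inl x, Inl y], [Inl (x \<otimes>\<^bsub>P\<^esub> y)]) \<in> amalg_rel P Q J f g"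
  | mult_right: "x \<in> carrier Q \<Longrightarrow> y \<in> carrier Q
      \<Longrightarrow> ([Inr x, Inr y], [Inr (x \<otimes>\<^bsub>Q\<^esub> y)]) \<in> amalg_rel P Q J f g"
  | amalgamate: "j \<in> J \<Longrightarrow> ([Inl (f j)], [Inr (g j)]) \<in> amalg_rel P Q J f g"

definition amalg_product ::
  "('a, 'm) monoid_scheme \<Rightarrow> ('b, 'n) monoid_scheme \<Rightarrow> 'c set \<Rightarrow> ('c \<Rightarrow> 'a) \<Rightarrow> ('c \<Rightarrow> 'b)
     \<Rightarrow> ('a + 'b) list set monoid" where
  "amalg_product P Q J f g =
     \<lparr>carrier = amalg_words P Q // amalg_rel P Q J f g,
      monoid.mult = (\<lambda>S T. \<Union>x\<in>S. \<Union>y\<in>T. amalg_rel P Q J f g `` {x @ y}),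
      one = amalg_rel P Q J f g `` {[]}\<rparr>"

definition word_value ::
  "('d, 'm) monoid_scheme \<Rightarrow> ('a \<Rightarrow> 'd) \<Rightarrow> ('b \<Rightarrow> 'd) \<Rightarrow> ('a + 'b) list \<Rightarrow> 'd" where
  "word_value G h k w = foldr (\<lambda>l y. case_sum h k l \<otimes>\<^bsub>G\<^esub> y) w \<one>\<^bsub>G\<^esub>"

definition amalg_lift ::
  "('d, 'm) monoid_scheme \<Rightarrow> ('a \<Rightarrow> 'd) \<Rightarrow> ('b \<Rightarrow> 'd) \<Rightarrow> ('a + 'b) list set \<Rightarrow> 'd" where
  "amalg_lift G h k S = the_elem (word_value G h k ` S)"

lemma amalg_rel_words:
  assumes "group P" "group Q" "f ` J \<subseteq> carrier P" "g ` J \<subseteq> carrier Q"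
    and "(u, v) \<in> amalg_rel P Q J f g"
  shows "u \<in> amalg_words P Q \<and> v \<in> amalg_words P Q"
  using assms(5)
proof induction
  case one_left
  show ?case using assms(1) by (auto simp: amalg_words_def group.is_monoid monoid.one_closed)
next
  case one_right
  show ?case using assms(2) by (auto simp: amalg_words_def group.is_monoid monoid.one_closed)
next
  case (mult_left x y)
  then show ?case using assms(1) by (auto simp: amalg_words_def group.is_monoid monoid.m_closed)
next
  case (mult_right x y)
  then show ?case using assms(2) by (auto simp: amalg_words_def group.is_monoid monoid.m_closed)
qed (use assms(3,4) in \<open>auto simp: amalg_words_def\<close>)

lemma equiv_amalg_rel:
  assumes "group P" "group Q" "f ` J \<subseteq> carrier P" "g ` J \<subseteq> carrier Q"
  shows "equiv (amalg_words P Q) (amalg_rel P Q J f g)"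
  using amalg_rel_words[OF assms]
  by (intro equivI refl_onI symI transI subsetI) (auto intro: amalg_rel.intros)

lemma amalg_mult_class:
  assumes "group P" "group Q" "f ` J \<subseteq> carrier P" "g ` J \<subseteq> carrier Q"
    and "u \<in> amalg_words P Q" "v \<in> amalg_words P Q"
  shows "amalg_rel P Q J f g `` {u} \<otimes>\<^bsub>amalg_product P Q J f g\<^esub> amalg_rel P Q J f g `` {v}
    = amalg_rel P Q J f g `` {u @ v}"
  using assms(5,6) unfolding amalg_product_def
  by (auto intro: amalg_rel.intros) 

lemma group_amalg_product:
  assumes "group P" "group Q" "f ` J \<subseteq> carrier P" "g ` J \<subseteq> carrier Q"
  shows "group (amalg_product P Q J f g)"
proof -
  interpret P: group P by fact
  interpret Q: group Q by fact
  let ?W = "amalg_words P Q" and ?r = "amalg_rel P Q J f g" and ?A = "amalg_product P Q J f g"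
  note eq = equiv_amalg_rel[OF assms] and mc = amalg_mult_class[OF assms]
  have C: "carrier ?A = ?W // ?r" and one: "\<one>\<^bsub>?A\<^esub> = ?r `` {[]}"
    by (simp_all add: amalg_product_def)
  have W: "[] \<in> ?W" "u \<in> ?W \<Longrightarrow> v \<in> ?W \<Longrightarrow> u @ v \<in> ?W" for u v
    by (auto simp: amalg_words_def)
  have inv: "\<exists>v \<in> ?W. (v @ w, []) \<in> ?r" if "w \<in> ?W" for w
    using that
  proof (induction w)
    case Nil
    then show ?case using W by (auto intro: amalg_rel.intros)
  next
    case (Cons l w)
    then have w: "w \<in> ?W" and "l \<in> carrier P <+> carrier Q" by (auto simp: amalg_words_def)
    then obtain v where v: "v \<in> ?W" "(v @ w, []) \<in> ?r" using Cons.IH by auto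
    obtain l' where l': "[l'] \<in> ?W" "([l', l], []) \<in> ?r"
    proof (cases l)
      case (Inl x)
      with \<open>l \<in> _\<close> have x: "x \<in> carrier P" by auto
      have "([Inl (inv\<^bsub>P\<^esub> x), Inl x], []) \<in> ?r"
        using amalg_rel.mult_left[of "inv\<^bsub>P\<^esub> x" P x Q J f g] x
        by (auto intro: amalg_rel.trans amalg_rel.one_left)
      then show ?thesis using that[of "Inl (inv\<^bsub>P\<^esub> x)"] x Inl by (auto simp: amalg_words_def)
    next
      case (Inr x)
      with \<open>l \<in> _\<close> have x: "x \<in> carrier Q" by auto
      have "([Inr (inv\<^bsub>Q\<^esub> x), Inr x], []) \<in> ?r"
        using amalg_rel.mult_right[of "inv\<^bsub>Q\<^esub> x" Q x P J f g] x
        by (auto intro: amalg_rel.trans amalg_rel.one_right)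
      then show ?thesis using that[of "Inr (inv\<^bsub>Q\<^esub> x)"] x Inr by (auto simp: amalg_words_def)
    qed
    have "(v @ [l', l] @ w, v @ [] @ w) \<in> ?r"
      using v w l' by (intro amalg_rel.append amalg_rel.refl) auto
    then have "((v @ [l']) @ l # w, []) \<in> ?r" using v(2) by (auto intro: amalg_rel.trans)
    then show ?case using W v l' by blast
  qed
  show ?thesis
  proof (rule groupI)
    fix x y z assume "x \<in> carrier ?A" "y \<in> carrier ?A" "z \<in> carrier ?A"
    then obtain u v w where "u \<in> ?W" "v \<in> ?W" "w \<in> ?W" "x = ?r `` {u}" "y = ?r `` {v}" "z = ?r `` {w}"
      unfolding C by (auto elim!: quotientE)
    then show "(x \<otimes>\<^bsub>?A\<^esub> y) \<otimes>\<^bsub>?A\<^esub> z = x \<otimes>\<^bsub>?A\<^esub> (y \<otimes>\<^bsub>?A\<^esub> z)" by (simp add: mc W)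
  next
    fix x y assume "x \<in> carrier ?A" "y \<in> carrier ?A"
    then obtain u v where "u \<in> ?W" "v \<in> ?W" "x = ?r `` {u}" "y = ?r `` {v}"
      unfolding C by (auto elim!: quotientE)
    then show "x \<otimes>\<^bsub>?A\<^esub> y \<in> carrier ?A" unfolding C by (simp add: mc W quotientI)
  next
    show "\<one>\<^bsub>?A\<^esub> \<in> carrier ?A" unfolding C one by (simp add: W quotientI)
  next
    fix x assume "x \<in> carrier ?A"
    then obtain u where u: "u \<in> ?W" "x = ?r `` {u}" unfolding C by (auto elim!: quotientE)
    then show "\<one>\<^bsub>?A\<^esub> \<otimes>\<^bsub>?A\<^esub> x = x" unfolding one by (simp add: mc W)
    obtain v where "v \<in> ?W" "(v @ u, []) \<in> ?r" using inv[OF u(1)] by auto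
    then show "\<exists>y\<in>carrier ?A. y \<otimes>\<^bsub>?A\<^esub> x = \<one>\<^bsub>?A\<^esub>"
      using u eq unfolding C one
      by (intro bexI[of _ "?r `` {v}"]) (simp_all add: mc quotientI equiv_class_eq)
  qed
qed

text \<open>The lemmas \<open>amalg_lift_hom\<close>, \<open>amalg_lift_class\<close> and \<open>amalg_lift_unique\<close> give the universal property.\<close>

lemma word_value_closed:
  assumes "group G" "h \<in> hom P G" "k \<in> hom Q G" "w \<in> amalg_words P Q"
  shows "word_value G h k w \<in> carrier G"
proof -
  interpret group G by fact
  show ?thesis using assms(4)
    by (induction w) (use assms(2,3) in \<open>auto simp: word_value_def amalg_words_def hom_def split: sum.split\<close>)
qed

lemma word_value_append:
  assumes "group G" "h \<in> hom P G" "k \<in> hom Q G" "u \<in> amalg_words P Q" "v \<in> amalg_words P Q"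
  shows "word_value G h k (u @ v) = word_value G h k u \<otimes>\<^bsub>G\<^esub> word_value G h k v"
  using assms(4)
proof (induction u)
  interpret group G by fact
  case Nil
  then show ?case using word_value_closed[OF assms(1-3,5)] by (simp add: word_value_def)
next
  interpret group G by fact
  case (Cons l u)
  then have "u \<in> amalg_words P Q" "case_sum h k l \<in> carrier G"
    using assms(2,3) by (auto simp: amalg_words_def hom_def)
  then show ?case
    using Cons word_value_closed[OF assms(1-3)] assms(5)
    by (simp add: m_assoc word_value_def)
qed

lemma word_value_rel:
  assumes "group P" "group Q" "f ` J \<subseteq> carrier P" "g ` J \<subseteq> carrier Q"
    and "group G" "h \<in> hom P G" "k \<in> hom Q G" "\<And>j. j \<in> J \<Longrightarrow> h (f j) = k (g j)"
    and "(u, v) \<in> amalg_rel P Q J f g"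
  shows "word_value G h k u = word_value G h k v"
proof -
  interpret P: group P by fact
  interpret Q: group Q by fact
  interpret G: group G by fact
  interpret h: group_hom P G h by unfold_locales fact
  interpret k: group_hom Q G k by unfold_locales fact
  note words = amalg_rel_words[OF assms(1-4)]
  show ?thesis using assms(9)
  proof induction
    case (append u v u' v')
    then show ?case using words[OF append(1)] words[OF append(2)]
      by (simp add: word_value_append[OF assms(5-7)])
  qed (use assms(8) in \<open>auto simp: word_value_def\<close>)
qed

lemma amalg_lift_class:
  assumes "group P" "group Q" "f ` J \<subseteq> carrier P" "g ` J \<subseteq> carrier Q"
    and "group G" "h \<in> hom P G" "k \<in> hom Q G" "\<And>j. j \<in> J \<Longrightarrow> h (f j) = k (g j)"
    and "w \<in> amalg_words P Q"
  shows "amalg_lift G h k (amalg_rel P Q J f g `` {w}) = word_value G h k w"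
proof -
  have "word_value G h k ` (amalg_rel P Q J f g `` {w}) = {word_value G h k w}"
    using word_value_rel[OF assms(1-7), of w] assms(8) amalg_rel.refl[OF assms(9)]
    by (force intro!: image_eqI)
  then show ?thesis by (simp add: amalg_lift_def)
qed

lemma amalg_lift_hom:
  assumes "group P" "group Q" "f ` J \<subseteq> carrier P" "g ` J \<subseteq> carrier Q"
    and "group G" "h \<in> hom P G" "k \<in> hom Q G" "\<And>j. j \<in> J \<Longrightarrow> h (f j) = k (g j)"
  shows "amalg_lift G h k \<in> hom (amalg_product P Q J f g) G"
proof (rule homI)
  let ?W = "amalg_words P Q" and ?r = "amalg_rel P Q J f g" and ?A = "amalg_product P Q J f g"
  have C: "carrier ?A = ?W // ?r" by (simp add: amalg_product_def)
  note lc = amalg_lift_class[OF assms]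
  { fix x assume "x \<in> carrier ?A"
    then obtain u where "u \<in> ?W" "x = ?r `` {u}" unfolding C by (auto elim!: quotientE)
    then show "amalg_lift G h k x \<in> carrier G"
      using word_value_closed[OF assms(5-7)] by (simp add: lc) }
  fix x y assume "x \<in> carrier ?A" "y \<in> carrier ?A"
  then obtain u v where *: "u \<in> ?W" "v \<in> ?W" "x = ?r `` {u}" "y = ?r `` {v}"
    unfolding C by (auto elim!: quotientE)
  moreover have "u @ v \<in> ?W" using * by (simp add: amalg_words_def)
  ultimately show "amalg_lift G h k (x \<otimes>\<^bsub>?A\<^esub> y) = amalg_lift G h k x \<otimes>\<^bsub>G\<^esub> amalg_lift G h k y"
    by (simp add: lc amalg_mult_class[OF assms(1-4)] word_value_append[OF assms(5-7)])
qed

lemma amalg_lift_unique: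
  assumes "group P" "group Q" "f ` J \<subseteq> carrier P" "g ` J \<subseteq> carrier Q"
    and "group G" "h \<in> hom P G" "k \<in> hom Q G" "\<And>j. j \<in> J \<Longrightarrow> h (f j) = k (g j)"
    and "F \<in> hom (amalg_product P Q J f g) G"
    and "\<And>x. x \<in> carrier P \<Longrightarrow> F (amalg_rel P Q J f g `` {[Inl x]}) = h x"
    and "\<And>y. y \<in> carrier Q \<Longrightarrow> F (amalg_rel P Q J f g `` {[Inr y]}) = k y"
    and "c \<in> carrier (amalg_product P Q J f g)"
  shows "F c = amalg_lift G h k c"
proof -
  let ?W = "amalg_words P Q" and ?r = "amalg_rel P Q J f g" and ?A = "amalg_product P Q J f g"
  interpret A: group ?A by (rule group_amalg_product) fact+
  interpret G: group G by fact
  interpret F: group_hom ?A G F by unfold_locales fact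
  have one: "\<one>\<^bsub>?A\<^esub> = ?r `` {[]}" by (simp add: amalg_product_def)
  have "F (?r `` {w}) = word_value G h k w" if "w \<in> ?W" for w
    using that
  proof (induction w)
    case Nil
    then show ?case using F.hom_one by (simp add: one word_value_def)
  next
    case (Cons l w)
    then have w: "w \<in> ?W" "[l] \<in> ?W" by (auto simp: amalg_words_def)
    then have cl: "?r `` {[l]} \<in> carrier ?A" "?r `` {w} \<in> carrier ?A"
      by (simp_all add: amalg_product_def quotientI)
    have "?r `` {l # w} = ?r `` {[l]} \<otimes>\<^bsub>?A\<^esub> ?r `` {w}"
      using amalg_mult_class[OF assms(1-4) w(2,1)] by simp
    moreover have "F (?r `` {[l]}) = case_sum h k l"
      using assms(10,11) w(2) by (cases l) (auto simp: amalg_words_def)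
    ultimately show ?case using Cons w cl by (simp add: word_value_def)
  qed
  moreover obtain w where "w \<in> ?W" "c = ?r `` {w}"
    using assms(12) by (auto simp: amalg_product_def elim!: quotientE)
  ultimately show ?thesis by (simp add: amalg_lift_class[OF assms(1-8)])
qed

text \<open>
  \<open>G\<close> is the internal free product of its subgroups \<open>P\<close> and \<open>Q\<close> amalgamated along \<open>J\<close> if the
  homomorphism from the amalgamated product induced by the inclusions is an isomorphism.
\<close>

definition is_amalgamated_product ::
  "('a, 'm) monoid_scheme \<Rightarrow> 'a set \<Rightarrow> 'a set \<Rightarrow> 'a set \<Rightarrow> bool" where
  "is_amalgamated_product G P Q J \<longleftrightarrow>
     subgroup P G \<and> subgroup Q G \<and> subgroup J G \<and> J \<subseteq> P \<inter> Q \<and>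
     amalg_lift G id id
       \<in> iso (amalg_product (G\<lparr>carrier := P\<rparr>) (G\<lparr>carrier := Q\<rparr>) J id id) G"

end

theory Submission
  imports Defs
begin

text \<open>
  Choose a coordinate in which \<open>s\<close> is the point at infinity, and let \<open>D\<close> be a disc, with respect to
  the valuation at the given place, whose complement is a small neighbourhood of \<open>s\<close>.  Its translates
  under \<open>G\<close> correspond to the edges in the orbit of an edge of the Bruhat-Tits tree far out towards
  the cusp \<open>s\<close>; as balls or complements of balls they form a nested family, and this replaces the
  tree.  For \<open>H\<close> take the elements that preserve the set of those translates that contain \<open>D\<close> or its
  complement: it is the stabiliser of the component adjacent to the edge \<open>D\<close> that remains on the side
  of \<open>D\<close> when the whole orbit of edges is removed.  Ping-pong with \<open>D\<close> and its complement shows that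
  \<open>G(s)\<close> and \<open>H\<close> generate their amalgam along the stabiliser of \<open>D\<close>.  They generate \<open>G\<close> by descent
  on the valuation of the lower left matrix entry.

  The arithmetic input is that nonzero elements of \<open>A\<close> have valuation at most 0, that balls contain
  finitely many elements of \<open>A\<close>, and that every element of \<open>K\<close> is at bounded distance from \<open>A\<close>.  If
  \<open>A\<close> is just the field of constants, then \<open>G\<close> is finite and \<open>H = G\<close> will do.
\<close>

section \<open>Recognising amalgamated products\<close>

text \<open>One orbit of edges suffices because of where \<open>disc\<close> lies. Its index
  \<open>n\<close> is so low that every nonzero lower left entry \<open>c\<close> satisfies
  \<open>v c \<le> - n\<close>, while translations fixing the cusp reach every coset of
  \<open>disc\<close>. A translate of \<open>disc\<close> by an element that moves the cusp is then
  a ball of index above \<open>n\<close> or the complement of one, hence never \<open>disc\<close>;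
  translates by elements fixing the cusp are equal to \<open>disc\<close> or disjoint from it. The
  same bound stops the descent: \<open>v c\<close> is an integer that cannot exceed
  \<open>- n\<close>, and removing a suitable factor from \<open>H\<close> strictly raises it. The
  obstacle is that \<open>s\<close> need not lie in the orbit of infinity under \<open>G\<close>,
  since ideals of \<open>A\<close> need not be principal. The coordinate change is therefore a
  matrix over \<open>K\<close>, and conjugated matrices leave \<open>A\<close>. Enough survives:
  determinant and trace are unchanged, and the lower left entry returns to \<open>A\<close> after
  multiplication by \<open>f\<^sup>2\<close>, where \<open>f\<close> is a denominator of
  \<open>s\<close>. Hence the shift by \<open>2 * v f\<close> in \<open>n\<close>.\<close>

inductive alternating :: "'a set \<Rightarrow> 'a set \<Rightarrow> 'a set \<Rightarrow> bool \<Rightarrow> ('a + 'a) list \<Rightarrow> bool"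
  for P Q J where
    single_left: "x \<in> P - J \<Longrightarrow> alternating P Q J True [Inl x]"
  | single_right: "x \<in> Q - J \<Longrightarrow> alternating P Q J False [Inr x]"
  | Cons_left: "x \<in> P - J \<Longrightarrow> alternating P Q J False w \<Longrightarrow> alternating P Q J True (Inl x # w)"
  | Cons_right: "x \<in> Q - J \<Longrightarrow> alternating P Q J True w \<Longrightarrow> alternating P Q J False (Inr x # w)"


locale subgroup_pair = group G for G (structure) +
  fixes P Q
  assumes subP: "subgroup P G" and subQ: "subgroup Q G"
begin

abbreviation "J \<equiv> P \<inter> Q"
abbreviation "GP \<equiv> G\<lparr>carrier := P\<rparr>"
abbreviation "GQ \<equiv> G\<lparr>carrier := Q\<rparr>"
abbreviation wequiv (infix \<open>\<approx>\<close> 50) where "u \<approx> v \<equiv> (u, v) \<in> amalg_rel GP GQ J id id"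
abbreviation "val \<equiv> word_value G id id"

lemma inclusions:
  "group GP" "group GQ" "id ` J \<subseteq> carrier GP" "id ` J \<subseteq> carrier GQ" "group G"
  "id \<in> hom GP G" "id \<in> hom GQ G"
  using subgroup_imp_group[OF subP] subgroup_imp_group[OF subQ] group_axioms
    subgroup.subset[OF subP] subgroup.subset[OF subQ]
  by (auto simp: hom_def)

lemma subJ: "subgroup J G"
  using subgroups_Inter_pair[OF subP subQ] .

lemmas J_closed = subgroup.m_closed[OF subJ] subgroup.m_inv_closed[OF subJ] subgroup.one_closed[OF subJ]
lemmas P_closed = subgroup.m_closed[OF subP] subgroup.m_inv_closed[OF subP] subgroup.one_closed[OF subP]
lemmas Q_closed = subgroup.m_closed[OF subQ] subgroup.m_inv_closed[OF subQ] subgroup.one_closed[OF subQ]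

lemma in_G: "x \<in> P \<Longrightarrow> x \<in> carrier G" "x \<in> Q \<Longrightarrow> x \<in> carrier G"
  using subgroup.subset[OF subP] subgroup.subset[OF subQ] by auto

lemma J_mult_iff:
  assumes "j \<in> J" "x \<in> carrier G"
  shows "j \<otimes> x \<in> J \<longleftrightarrow> x \<in> J"
proof
  assume "j \<otimes> x \<in> J"
  then have "inv j \<otimes> (j \<otimes> x) \<in> J" using assms(1) J_closed by blast
  then show "x \<in> J" using assms in_G by (metis IntD1 inv_closed l_inv l_one m_assoc)
qed (use assms J_closed in blast)

lemma rel_Cons: "u \<approx> v \<Longrightarrow> l \<in> P <+> Q \<Longrightarrow> l # u \<approx> l # v"
  using amalg_rel.append[of "[l]" "[l]" GP GQ J id id u v] amalg_rel.refl[of "[l]" GP GQ J id id]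
  by (auto simp: amalg_words_def)

lemma rel_append_left:
  assumes "u \<approx> v" "w \<in> lists (P <+> Q)"
  shows "u @ w \<approx> v @ w"
  using assms by (intro amalg_rel.append amalg_rel.refl) (auto simp: amalg_words_def)

lemma rel_mult:
  assumes "w \<in> lists (P <+> Q)"
  shows "x \<in> P \<Longrightarrow> y \<in> P \<Longrightarrow> Inl x # Inl y # w \<approx> Inl (x \<otimes> y) # w"
    and "x \<in> Q \<Longrightarrow> y \<in> Q \<Longrightarrow> Inr x # Inr y # w \<approx> Inr (x \<otimes> y) # w"
    and "x \<in> J \<Longrightarrow> Inl x # w \<approx> Inr x # w"
    and "x \<in> J \<Longrightarrow> Inr x # w \<approx> Inl x # w"
proof -
  show "Inl x # Inl y # w \<approx> Inl (x \<otimes> y) # w" if "x \<in> P" "y \<in> P"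
    using rel_append_left[OF amalg_rel.mult_left[of x GP y GQ] assms] that by simp
  show "Inr x # Inr y # w \<approx> Inr (x \<otimes> y) # w" if "x \<in> Q" "y \<in> Q"
    using rel_append_left[OF amalg_rel.mult_right[of x GQ y GP] assms] that by simp
  show *: "Inl x # w \<approx> Inr x # w" if "x \<in> J"
  proof -
    have "[Inl (id x)] \<approx> [Inr (id x)]" using that by (rule amalg_rel.amalgamate)
    from rel_append_left[OF this assms] show ?thesis by simp
  qed
  show "Inr x # w \<approx> Inl x # w" if "x \<in> J"
    by (rule amalg_rel.sym[OF *[OF that]])
qed

section \<open>Reduction of words to normal form\<close>

lemma alternating_word: "alternating P Q J s w \<Longrightarrow> w \<in> lists (P <+> Q)"
  by (induction rule: alternating.induct) auto

text \<open>A letter from \<open>J\<close> fuses with the first letter, after crossing to the right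
  factor by \<open>amalgamate\<close> if necessary. Multiplication by \<open>J\<close> keeps a
  letter outside \<open>J\<close>, so the shape of the word is unchanged.\<close>

lemma absorb_J:
  assumes "alternating P Q J s w" "j \<in> J"
  shows "\<exists>w'. Inl j # w \<approx> w' \<and> alternating P Q J s w'"
proof -
  have mem: "j \<otimes> x \<in> P - J" if "x \<in> P - J" for x
    using that assms(2) J_mult_iff[OF assms(2), of x] in_G P_closed(1)[of j x] by auto
  have mem': "j \<otimes> x \<in> Q - J" if "x \<in> Q - J" for x
    using that assms(2) J_mult_iff[OF assms(2), of x] in_G Q_closed(1)[of j x] by auto
  show ?thesis
    using assms(1)
  proof (cases rule: alternating.cases)
    case (single_left x)
    then show ?thesis
      using rel_mult(1)[of "[]" j x] assms(2) mem[of x] alternating.single_left[of "j \<otimes> x" P J Q] by auto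
  next
    case (single_right x)
    have "Inl j # [Inr x] \<approx> Inr j # [Inr x]"
      using assms(2) single_right by (intro rel_mult) auto
    moreover have "Inr j # [Inr x] \<approx> [Inr (j \<otimes> x)]"
      using assms(2) single_right by (intro rel_mult) auto
    ultimately show ?thesis
      using single_right mem'[of x] alternating.single_right[of "j \<otimes> x" Q J P]
      by (blast intro: amalg_rel.trans)
  next
    case (Cons_left x u)
    then show ?thesis
      using rel_mult(1)[OF alternating_word[of False u], of j x] assms(2) mem[of x]
        alternating.Cons_left[of "j \<otimes> x" P J Q u] by auto
  next
    case (Cons_right x u)
    note u = alternating_word[OF Cons_right(4)]
    have "Inl j # Inr x # u \<approx> Inr j # Inr x # u"
      using assms(2) Cons_right u by (intro rel_mult) auto
    moreover have "Inr j # Inr x # u \<approx> Inr (j \<otimes> x) # u"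
      using assms(2) Cons_right u by (intro rel_mult) auto
    ultimately show ?thesis
      using Cons_right mem'[of x] alternating.Cons_right[of "j \<otimes> x" Q J P u]
      by (blast intro: amalg_rel.trans)
  qed
qed

text \<open>No coset representatives are chosen, so a normal form need not be unique; it only has to
  decide whether a word lies in the kernel. Words that collapse into \<open>J\<close>, the identity
  included, are stored as a single left letter.\<close>

definition normal :: "('a + 'a) list \<Rightarrow> bool" where
  "normal w \<longleftrightarrow> (\<exists>j\<in>J. w = [Inl j]) \<or> (\<exists>s. alternating P Q J s w)"

lemma normalised: "alternating P Q J s w \<Longrightarrow> \<exists>w'. w \<approx> w' \<and> normal w'"
  using amalg_rel.refl[of w GP GQ J id id] alternating_word
  unfolding normal_def amalg_words_def by auto

lemma normalise_Inl:
  assumes "x \<in> P" "normal w"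
  shows "\<exists>w'. Inl x # w \<approx> w' \<and> normal w'"
  using assms(2) unfolding normal_def
proof (elim disjE bexE exE)
  fix j assume "j \<in> J" "w = [Inl j]"
  then have "Inl x # w \<approx> [Inl (x \<otimes> j)]" "x \<otimes> j \<in> P"
    using rel_mult(1)[of "[]" x j] assms(1) P_closed(1) by auto
  then show "\<exists>w'. Inl x # w \<approx> w' \<and> ((\<exists>j\<in>J. w' = [Inl j]) \<or> (\<exists>s. alternating P Q J s w'))"
    using alternating.single_left[of "x \<otimes> j" P J Q] by blast
next
  fix s assume w: "alternating P Q J s w"
  \<comment> \<open>Two adjacent letters of \<open>P\<close> fuse either into a letter outside
    \<open>J\<close>, which continues the alternation, or into an element of \<open>J\<close>, which
    the rest of the word absorbs.\<close>
  have merge: "\<exists>w'. Inl x # Inl y # u \<approx> w' \<and> ((\<exists>j\<in>J. w' = [Inl j]) \<or> (\<exists>s. alternating P Q J s w'))"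
    if y: "y \<in> P" and u: "u = [] \<or> alternating P Q J False u" for y u
  proof -
    have uw: "u \<in> lists (P <+> Q)" using u alternating_word by auto
    have 1: "Inl x # Inl y # u \<approx> Inl (x \<otimes> y) # u"
      using assms(1) y uw by (rule rel_mult(1)[rotated])
    have xy: "x \<otimes> y \<in> P" using assms(1) y P_closed by blast
    show ?thesis
    proof (cases "x \<otimes> y \<in> J")
      case False
      then show ?thesis using 1 u xy
        by (metis DiffI alternating.single_left alternating.Cons_left)
    next
      case True
      then show ?thesis using 1 u absorb_J[of False u "x \<otimes> y"]
        by (metis amalg_rel.trans)
    qed
  qed
  show "\<exists>w'. Inl x # w \<approx> w' \<and> ((\<exists>j\<in>J. w' = [Inl j]) \<or> (\<exists>s. alternating P Q J s w'))"
    using w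
  proof (cases rule: alternating.cases)
    case (single_left y) then show ?thesis using merge[of y "[]"] by auto
  next
    case (Cons_left y u) then show ?thesis using merge[of y u] by auto
  next
    case (single_right y)
    show ?thesis
    proof (cases "x \<in> J")
      case True then show ?thesis using absorb_J[OF w, of x] by blast
    next
      case False
      then have "alternating P Q J True (Inl x # w)" using assms(1) w single_right(1)
        by (auto intro: alternating.Cons_left)
      then show ?thesis using normalised unfolding normal_def by blast
    qed
  next
    case (Cons_right y u)
    show ?thesis
    proof (cases "x \<in> J")
      case True then show ?thesis using absorb_J[OF w, of x] by blast
    next
      case False
      then have "alternating P Q J True (Inl x # w)" using assms(1) w Cons_right(1)
        by (auto intro: alternating.Cons_left)
      then show ?thesis using normalised unfolding normal_def by blast
    qed
  qed
qed

lemma normalise_Inr: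
  assumes "x \<in> Q" "normal w"
  shows "\<exists>w'. Inr x # w \<approx> w' \<and> normal w'"
proof (cases "x \<in> J")
  case True
  have "w \<in> lists (P <+> Q)" using assms(2) alternating_word unfolding normal_def by auto
  then have "Inr x # w \<approx> Inl x # w" using True by (intro rel_mult)
  then show ?thesis using normalise_Inl[of x w] True assms(2) by (blast intro: amalg_rel.trans)
next
  case False
  have merge: "\<exists>w'. Inr x # Inr y # u \<approx> w' \<and> normal w'"
    if y: "y \<in> Q" and u: "u = [] \<or> alternating P Q J True u" for y u
  proof -
    have uw: "u \<in> lists (P <+> Q)" using u alternating_word by auto
    have 1: "Inr x # Inr y # u \<approx> Inr (x \<otimes> y) # u"
      using assms(1) y uw by (rule rel_mult(2)[rotated])
    have xy: "x \<otimes> y \<in> Q" using assms(1) y Q_closed by blast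
    show ?thesis
    proof (cases "x \<otimes> y \<in> J")
      case F: False
      then show ?thesis using 1 u xy unfolding normal_def
        by (metis DiffI alternating.single_right alternating.Cons_right)
    next
      case T: True
      have 2: "Inr (x \<otimes> y) # u \<approx> Inl (x \<otimes> y) # u" using T uw by (intro rel_mult)
      show ?thesis using 1 2 u absorb_J[of True u "x \<otimes> y"] T unfolding normal_def
        by (metis amalg_rel.trans)
    qed
  qed
  consider (J) j where "j \<in> J" "w = [Inl j]" | (alt) s where "alternating P Q J s w"
    using assms(2) unfolding normal_def by blast
  then show ?thesis
  proof cases
    \<comment> \<open>As \<open>normal\<close> stores elements of \<open>J\<close> on the left,
      \<open>j\<close> has to cross over before it can be multiplied with \<open>x\<close>.\<close>
    case J
    then have "Inr x # [Inl j] \<approx> Inr x # [Inr j]"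
      using assms(1) rel_mult(3)[of "[]" j] by (intro rel_Cons) auto
    moreover obtain w' where "Inr x # [Inr j] \<approx> w'" "normal w'" using merge[of j "[]"] J by auto
    ultimately show ?thesis using J by (blast intro: amalg_rel.trans)
  next
    case alt
    have pre: "\<exists>w'. Inr x # w \<approx> w' \<and> normal w'" if "s = True"
    proof -
      have "alternating P Q J False (Inr x # w)" using assms(1) alt that False
        by (auto intro: alternating.Cons_right)
      then show ?thesis by (rule normalised)
    qed
    show ?thesis
      using alt
    proof (cases rule: alternating.cases)
      case (single_right y) then show ?thesis using merge[of y "[]"] by auto
    next
      case (Cons_right y u) then show ?thesis using merge[of y u] by auto
    qed (use pre in auto)
  qed
qed

lemma normalise:
  assumes "w \<in> lists (P <+> Q)"
  shows "\<exists>w'. w \<approx> w' \<and> normal w'"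
  using assms
proof (induction w)
  case Nil
  have "[] \<approx> [Inl \<one>]" using amalg_rel.one_left[of GP GQ J id id] by (simp add: amalg_rel.sym)
  then show ?case using J_closed unfolding normal_def by blast
next
  case (Cons l w)
  then obtain w' where w': "w \<approx> w'" "normal w'" by blast
  have "l # w \<approx> l # w'" using w' Cons.hyps by (intro rel_Cons) auto
  moreover have "\<exists>w''. l # w' \<approx> w'' \<and> normal w''"
    using normalise_Inl normalise_Inr w'(2) Cons.hyps by blast
  ultimately show ?case by (blast intro: amalg_rel.trans)
qed

text \<open>The kernel is trivial because a normal word of value one cannot be alternating, so it is
  \<open>[Inl \<one>]\<close>, which represents the identity class. Surjectivity follows from
  \<open>gen\<close>, the image being a subgroup that contains \<open>P\<close> and
  \<open>Q\<close>.\<close>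

theorem is_amalgamated_productI:
  assumes gen: "carrier G \<subseteq> generate G (P \<union> Q)"
    and red: "\<And>s w. alternating P Q J s w \<Longrightarrow> val w \<noteq> \<one>"
  shows "is_amalgamated_product G P Q J"
proof -
  let ?A = "amalg_product GP GQ J id id" and ?F = "amalg_lift G id id"
  let ?cls = "\<lambda>w. amalg_rel GP GQ J id id `` {w}"
  interpret A: group ?A by (rule group_amalg_product[OF inclusions(1-4)])
  have hom: "?F \<in> hom ?A G" by (rule amalg_lift_hom[OF inclusions]) simp
  interpret F: group_hom ?A G ?F by unfold_locales (rule hom)
  have lift: "?F (?cls w) = val w" if "w \<in> lists (P <+> Q)" for w
    using that by (intro amalg_lift_class[OF inclusions]) (simp_all add: amalg_words_def)
  have inj: "inj_on ?F (carrier ?A)"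
    unfolding F.inj_on_one_iff
  proof (intro allI impI)
    fix c assume c: "c \<in> carrier ?A" "?F c = \<one>"
    then obtain w where w: "w \<in> lists (P <+> Q)" "c = ?cls w"
      by (auto simp: amalg_product_def amalg_words_def elim!: quotientE)
    obtain w' where w': "w \<approx> w'" "normal w'" using normalise[OF w(1)] by blast
    have "val w = val w'"
      using w'(1) by (intro word_value_rel[OF inclusions]) simp_all
    then have "val w' = \<one>" using c(2) w lift by simp
    then have "w' = [Inl \<one>]"
      using w'(2) red unfolding normal_def by (auto simp: word_value_def in_G)
    then have "w \<approx> []" using w'(1) amalg_rel.one_left[of GP GQ J id id]
      by (auto intro: amalg_rel.trans)
    then show "c = \<one>\<^bsub>?A\<^esub>"
      using equiv_class_eq[OF equiv_amalg_rel[OF inclusions(1-4)]] w(2) by (simp add: amalg_product_def)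
  qed
  have "P \<union> Q \<subseteq> ?F ` carrier ?A"
  proof
    fix x assume "x \<in> P \<union> Q"
    then obtain l where l: "l \<in> P <+> Q" "val [l] = x"
    proof (cases "x \<in> P")
      case True then show ?thesis using in_G by (intro that[of "Inl x"]) (auto simp: word_value_def)
    next
      case False then show ?thesis using in_G \<open>x \<in> P \<union> Q\<close>
        by (intro that[of "Inr x"]) (auto simp: word_value_def)
    qed
    then have "?F (?cls [l]) = x" using lift[of "[l]"] by simp
    moreover have "?cls [l] \<in> carrier ?A"
      using l by (auto simp: amalg_product_def amalg_words_def intro: quotientI)
    ultimately show "x \<in> ?F ` carrier ?A" by blast
  qed
  then have "carrier G \<subseteq> ?F ` carrier ?A"
    using gen generate_subgroup_incl[OF _ F.img_is_subgroup] by blast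
  then have "?F ` carrier ?A = carrier G" by auto
  then have "?F \<in> iso ?A G" using inj hom by (simp add: iso_def bij_betw_def)
  then show ?thesis
    unfolding is_amalgamated_product_def using subP subQ subJ by auto
qed

text \<open>The fixed point \<open>pt\<close> of \<open>P\<close> makes the usual condition on the indices of \<open>J\<close> unnecessary.\<close>

theorem ping_pong:
  assumes gen: "carrier G \<subseteq> generate G (P \<union> Q)"
    and act: "\<And>g h x. g \<in> carrier G \<Longrightarrow> h \<in> carrier G \<Longrightarrow> \<phi> (g \<otimes> h) x = \<phi> g (\<phi> h x)"
    and act_one: "\<And>x. \<phi> \<one> x = x"
    and pt: "pt \<in> Y" "\<And>p. p \<in> P \<Longrightarrow> \<phi> p pt = pt"
    and disj: "Y \<inter> Z = {}"
    and YP: "\<And>p z. p \<in> P - J \<Longrightarrow> z \<in> Z \<Longrightarrow> \<phi> p z \<in> Y"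
    and ZQ: "\<And>q y. q \<in> Q - J \<Longrightarrow> y \<in> Y \<Longrightarrow> \<phi> q y \<in> Z"
  shows "is_amalgamated_product G P Q J"
proof (rule is_amalgamated_productI[OF gen])
  have val: "val (l # w) = case_sum id id l \<otimes> val w" "val w \<in> carrier G"
    if "w \<in> lists (P <+> Q)" for l w
    using that word_value_closed[OF inclusions(5-7), of w] by (auto simp: word_value_def amalg_words_def)
  \<comment> \<open>Excluding \<open>pt\<close> itself in the left case is what distinguishes words
    such as \<open>[Inl p, Inr q]\<close> from the identity, which also keeps \<open>pt\<close> in
    \<open>Y\<close>. A single left letter fixes \<open>pt\<close> and is treated apart: it is not
    one because \<open>\<one> \<in> J\<close>.\<close>
  have claim: "if s then (\<exists>p\<in>P - J. w = [Inl p]) \<or> \<phi> (val w) pt \<in> Y - {pt} else \<phi> (val w) pt \<in> Z"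
    if "alternating P Q J s w" for s w
    using that
  proof induction
    case (single_right q)
    then show ?case using ZQ[OF single_right(1) pt(1)] in_G by (auto simp: word_value_def)
  next
    case (Cons_left p w)
    note w = alternating_word[OF Cons_left(2)]
    have z: "\<phi> (val w) pt \<in> Z" using Cons_left.IH by simp
    have pG: "p \<in> carrier G" "inv p \<in> P" using Cons_left(1) in_G P_closed by auto
    have eq: "\<phi> (val (Inl p # w)) pt = \<phi> p (\<phi> (val w) pt)" using val[OF w] pG act by simp
    have "\<phi> p (\<phi> (val w) pt) \<noteq> pt"
    proof
      assume "\<phi> p (\<phi> (val w) pt) = pt"
      then have "\<phi> (inv p) (\<phi> p (\<phi> (val w) pt)) = pt" using pt(2) pG by simp
      then have "\<phi> (val w) pt = pt" using pG by (metis act act_one inv_closed l_inv)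
      then show False using z pt disj by auto
    qed
    then show ?case using YP[OF Cons_left(1) z] eq by simp
  next
    case (Cons_right q w)
    note w = alternating_word[OF Cons_right(2)]
    have "\<phi> (val w) pt \<in> Y"
      using Cons_right.IH pt in_G by (auto simp: word_value_def)
    then show ?case using ZQ[OF Cons_right(1)] val[OF w] Cons_right(1) in_G act by simp
  qed auto
  fix s w assume "alternating P Q J s w"
  from claim[OF this] show "val w \<noteq> \<one>"
    using pt disj act_one J_closed in_G by (cases s) (auto simp: word_value_def)
qed

end

section \<open>Integer valuations and balls in the projective line\<close>

locale int_valuation =
  fixes v :: "'k::field \<Rightarrow> int"
  assumes v_mult: "x \<noteq> 0 \<Longrightarrow> y \<noteq> 0 \<Longrightarrow> v (x * y) = v x + v y"
    and v_add: "x \<noteq> 0 \<Longrightarrow> y \<noteq> 0 \<Longrightarrow> x + y \<noteq> 0 \<Longrightarrow> min (v x) (v y) \<le> v (x + y)"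
    and v_uniformizer: "\<exists>t. t \<noteq> 0 \<and> v t = 1"
begin

lemma v_one: "v 1 = 0"
  using v_mult[of 1 1] by simp

lemma v_minus: "v (- x) = v x"
proof -
  have "v (- 1) = 0" using v_mult[of "- 1" "- 1"] v_one by simp
  then show ?thesis using v_mult[of "- 1" x] by (cases "x = 0") auto
qed

lemma v_inverse: "x \<noteq> 0 \<Longrightarrow> v (inverse x) = - v x"
  using v_mult[of x "inverse x"] v_one by simp

lemma v_divide: "x \<noteq> 0 \<Longrightarrow> y \<noteq> 0 \<Longrightarrow> v (x / y) = v x - v y"
  using v_mult[of x "inverse y"] v_inverse[of y] by (simp add: divide_inverse)

lemma v_power: "x \<noteq> 0 \<Longrightarrow> v (x ^ k) = int k * v x"
  by (induction k) (auto simp: v_one v_mult algebra_simps)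

lemma v_surj: obtains x where "x \<noteq> 0" "v x = m"
proof -
  obtain t where t: "t \<noteq> 0" "v t = 1" using v_uniformizer by auto
  show ?thesis
  proof (cases "m \<ge> 0")
    case True
    then show ?thesis using that[of "t ^ nat m"] t v_power[of t "nat m"] by simp
  next
    case False
    then show ?thesis using that[of "inverse (t ^ nat (- m))"] t v_power[of t "nat (- m)"]
      by (simp add: v_inverse)
  qed
qed

text \<open>The value \<open>v 0\<close> is an arbitrary integer; this predicate restores the
  convention that zero has infinite valuation.\<close>

definition vge :: "'k \<Rightarrow> int \<Rightarrow> bool" where
  "vge x m \<longleftrightarrow> x = 0 \<or> m \<le> v x"

lemma vge_0 [simp]: "vge 0 m"
  by (simp add: vge_def)

lemma vge_mono: "vge x m \<Longrightarrow> m' \<le> m \<Longrightarrow> vge x m'"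
  by (auto simp: vge_def)

lemma vge_add: "vge x m \<Longrightarrow> vge y m \<Longrightarrow> vge (x + y) m"
  using v_add[of x y] unfolding vge_def by (cases "x = 0"; cases "y = 0"; cases "x + y = 0") auto

lemma vge_minus [simp]: "vge (- x) m \<longleftrightarrow> vge x m"
  by (simp add: vge_def v_minus)

lemma vge_diff: "vge x m \<Longrightarrow> vge y m \<Longrightarrow> vge (x - y) m"
  using vge_add[of x m "- y"] by simp

lemma vge_mult: "vge x m \<Longrightarrow> vge y m' \<Longrightarrow> vge (x * y) (m + m')"
  unfolding vge_def using v_mult[of x y] by (cases "x = 0"; cases "y = 0") auto

lemma vge_sum: "(\<And>i. i \<in> I \<Longrightarrow> vge (f i) m) \<Longrightarrow> vge (\<Sum>i\<in>I. f i) m"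
  by (induction I rule: infinite_finite_induct) (auto intro: vge_add)

text \<open>The strict case of the ultrametric inequality: applied to
  \<open>x = (x + y) + (- y)\<close>, the inequality also bounds \<open>v (x + y)\<close> from
  above.\<close>

lemma v_add_dominant:
  assumes "x \<noteq> 0" "vge y (v x + 1)"
  shows "x + y \<noteq> 0" "v (x + y) = v x"
proof -
  have "x + y \<noteq> 0 \<and> v (x + y) = v x"
  proof (cases "y = 0")
    case False
    then have y: "v x < v y" using assms by (simp add: vge_def)
    have "x + y \<noteq> 0"
    proof
      assume "x + y = 0"
      then have "y = - x" by (simp add: add_eq_0_iff)
      then show False using y v_minus by simp
    qed
    moreover have "v x \<le> v (x + y)" using v_add[of x y] assms y False calculation by auto
    moreover have "min (v (x + y)) (v (- y)) \<le> v (x + y + - y)"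
      using calculation assms False by (intro v_add) auto
    ultimately show ?thesis using y v_minus by auto
  qed (use assms in auto)
  then show "x + y \<noteq> 0" "v (x + y) = v x" by auto
qed

definition ball :: "'k \<Rightarrow> int \<Rightarrow> 'k option set" where
  "ball x m = {Some z | z. vge (z - x) m}"

lemma Some_in_ball [simp]: "Some z \<in> ball x m \<longleftrightarrow> vge (z - x) m"
  and None_notin_ball [simp]: "None \<notin> ball x m"
  by (auto simp: ball_def)

lemma centre_in_ball: "Some x \<in> ball x m"
  by simp

lemma ball_recentre:
  assumes "Some y \<in> ball x m"
  shows "ball y m = ball x m"
proof -
  have "vge (z - y) m \<longleftrightarrow> vge (z - x) m" for z
    using assms vge_add[of "z - y" m "y - x"] vge_diff[of "z - x" m "y - x"] by auto
  then show ?thesis by (auto simp: ball_def)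
qed

lemma ball_mono: "m' \<le> m \<Longrightarrow> ball x m \<subseteq> ball x m'"
  by (auto simp: ball_def intro: vge_mono)

text \<open>Every point of an ultrametric ball is a centre, so a common point serves as centre of
  both. A larger index means a smaller ball.\<close>

lemma ball_subsetI:
  assumes "ball x m \<inter> ball y m' \<noteq> {}" "m' \<le> m"
  shows "ball x m \<subseteq> ball y m'"
proof -
  obtain z where "Some z \<in> ball x m" "Some z \<in> ball y m'"
    using assms(1) by (auto simp: ball_def)
  then show ?thesis using ball_recentre ball_mono[OF assms(2), of z] by metis
qed

lemma ball_disjoint_or_nested:
  "ball x m \<inter> ball y m' = {} \<or> ball x m \<subseteq> ball y m' \<or> ball y m' \<subseteq> ball x m"
  using ball_subsetI[of x m y m'] ball_subsetI[of y m' x m] by (cases "m' \<le> m") auto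

text \<open>Surjectivity of \<open>v\<close> enters here: \<open>ball x m\<close> contains two
  points whose difference has valuation exactly \<open>m\<close>, and no ball of larger index
  contains both.\<close>

lemma ball_radius_less:
  assumes "m < m'"
  shows "ball x m \<noteq> ball y m'"
proof
  assume eq: "ball x m = ball y m'"
  obtain t where t: "t \<noteq> 0" "v t = m" using v_surj by blast
  have "Some x \<in> ball y m'" "Some (x + t) \<in> ball y m'"
    unfolding eq[symmetric] using t by (auto simp: vge_def)
  then have "vge ((x + t - y) - (x - y)) m'" by (simp only: Some_in_ball vge_diff)
  then show False using t assms by (simp add: vge_def)
qed

end

section \<open>Splitting off the stabiliser of a cusp\<close>

text \<open>\<open>\<rho>\<close> is meant to be the conjugate of the given matrix group that moves
  the cusp to infinity; an abstract \<open>G\<close> lets one argument serve every cusp. In terms of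
  the tree, \<open>v_lower\<close> keeps horoballs at different cusps of the orbit apart, and
  \<open>translation\<close> says that the translates of \<open>disc\<close> by unipotent elements
  fixing infinity cover the affine line.\<close>

locale cusp_action = int_valuation v + group G
  for v :: "'k::field \<Rightarrow> int" and G :: "('g, 'm) monoid_scheme" (structure) +
  fixes \<rho> :: "'g \<Rightarrow> 'k^2^2" and n :: int
  assumes rho_mult: "g \<in> carrier G \<Longrightarrow> h \<in> carrier G \<Longrightarrow> \<rho> (g \<otimes> h) = \<rho> g ** \<rho> h"
    and rho_one: "\<rho> \<one> = mat 1"
    and det_nonzero: "g \<in> carrier G \<Longrightarrow> det (\<rho> g) \<noteq> 0"
    and v_det: "g \<in> carrier G \<Longrightarrow> v (det (\<rho> g)) = 0"
    and v_lower: "g \<in> carrier G \<Longrightarrow> \<rho> g $ 2 $ 1 \<noteq> 0 \<Longrightarrow> v (\<rho> g $ 2 $ 1) \<le> - n"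
    and v_upper: "g \<in> carrier G \<Longrightarrow> \<rho> g $ 2 $ 1 = 0 \<Longrightarrow>
      v (\<rho> g $ 1 $ 1) = 0 \<and> v (\<rho> g $ 2 $ 2) = 0"
    and translation: "\<exists>g\<in>carrier G. \<rho> g $ 1 $ 1 = 1 \<and> \<rho> g $ 2 $ 1 = 0 \<and> \<rho> g $ 2 $ 2 = 1
      \<and> vge (z - \<rho> g $ 1 $ 2) n"
begin

abbreviation "a g \<equiv> \<rho> g $ 1 $ 1"
abbreviation "b g \<equiv> \<rho> g $ 1 $ 2"
abbreviation "c g \<equiv> \<rho> g $ 2 $ 1"
abbreviation "d g \<equiv> \<rho> g $ 2 $ 2"
abbreviation "\<delta> g \<equiv> det (\<rho> g)"
abbreviation "act g \<equiv> moebius (\<rho> g)"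

section \<open>Matrix entries and the action on the projective line\<close>

lemma entries_mult:
  assumes "g \<in> carrier G" "h \<in> carrier G"
  shows "a (g \<otimes> h) = a g * a h + b g * c h" "b (g \<otimes> h) = a g * b h + b g * d h"
    "c (g \<otimes> h) = c g * a h + d g * c h" "d (g \<otimes> h) = c g * b h + d g * d h"
  by (simp_all add: rho_mult[OF assms] matrix_matrix_mult_def sum_2)

lemma entries_one: "a \<one> = 1" "b \<one> = 0" "c \<one> = 0" "d \<one> = 1"
  by (simp_all add: rho_one mat_def)

lemma entries_inv:
  assumes "g \<in> carrier G"
  shows "a (inv g) = d g / \<delta> g" "b (inv g) = - b g / \<delta> g"
    "c (inv g) = - c g / \<delta> g" "d (inv g) = a g / \<delta> g"
proof -
  have gi: "inv g \<in> carrier G" "g \<otimes> inv g = \<one>" using assms by auto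
  have e: "a g * a (inv g) + b g * c (inv g) = 1" "a g * b (inv g) + b g * d (inv g) = 0"
    "c g * a (inv g) + d g * c (inv g) = 0" "c g * b (inv g) + d g * d (inv g) = 1"
    using entries_mult[OF assms gi(1)] entries_one by (simp_all add: gi(2))
  have \<delta>: "\<delta> g = a g * d g - b g * c g" by (simp add: det_2)
  have "\<delta> g * a (inv g) = d g * (a g * a (inv g) + b g * c (inv g)) - b g * (c g * a (inv g) + d g * c (inv g))"
    "\<delta> g * b (inv g) = d g * (a g * b (inv g) + b g * d (inv g)) - b g * (c g * b (inv g) + d g * d (inv g))"
    "\<delta> g * c (inv g) = a g * (c g * a (inv g) + d g * c (inv g)) - c g * (a g * a (inv g) + b g * c (inv g))"
    "\<delta> g * d (inv g) = a g * (c g * b (inv g) + d g * d (inv g)) - c g * (a g * b (inv g) + b g * d (inv g))"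
    unfolding \<delta> by (simp_all add: algebra_simps)
  then have "\<delta> g * a (inv g) = d g" "\<delta> g * b (inv g) = - b g"
    "\<delta> g * c (inv g) = - c g" "\<delta> g * d (inv g) = a g"
    unfolding e by simp_all
  then show "a (inv g) = d g / \<delta> g" "b (inv g) = - b g / \<delta> g"
    "c (inv g) = - c g / \<delta> g" "d (inv g) = a g / \<delta> g"
    using det_nonzero[OF assms] by (metis nonzero_mult_div_cancel_left)+
qed

lemma act_mult: "g \<in> carrier G \<Longrightarrow> h \<in> carrier G \<Longrightarrow> act (g \<otimes> h) x = act g (act h x)"
  using moebius_mult det_nonzero rho_mult by metis

lemma act_one: "act \<one> x = x"
  by (simp add: rho_one moebius_one)

lemma act_inv: "g \<in> carrier G \<Longrightarrow> act (inv g) (act g x) = x" "g \<in> carrier G \<Longrightarrow> act g (act (inv g) x) = x"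
  using act_mult[of "inv g" g] act_mult[of g "inv g"] by (simp_all add: act_one)

lemma act_inv_None: "g \<in> carrier G \<Longrightarrow> act (inv g) None = (if c g = 0 then None else Some (- d g / c g))"
  using det_nonzero[of g] by (simp add: moebius_def entries_inv)

lemma act_inv_Some:
  assumes "g \<in> carrier G"
  shows "act (inv g) (Some u) =
    (if a g - c g * u = 0 then None else Some ((d g * u - b g) / (a g - c g * u)))"
proof -
  have \<delta>: "\<delta> g \<noteq> 0" using det_nonzero[OF assms] .
  have "c (inv g) * u + d (inv g) = (a g - c g * u) / \<delta> g"
    "a (inv g) * u + b (inv g) = (d g * u - b g) / \<delta> g"
    using \<delta> by (simp_all add: entries_inv[OF assms] field_simps)
  then show ?thesis using \<delta> by (simp add: moebius_def)
qed

section \<open>Translates of the disc as balls and complements of balls\<close>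

definition disc :: "'k option set" where "disc = ball 0 n"

definition half :: "'g \<Rightarrow> 'k option set" where "half g = {x. act (inv g) x \<in> disc}"

lemma Some_in_disc [simp]: "Some z \<in> disc \<longleftrightarrow> vge z n"
  and None_notin_disc [simp]: "None \<notin> disc"
  by (auto simp: disc_def)

lemma half_one: "half \<one> = disc"
  by (simp add: half_def act_one)

lemma half_mult:
  assumes "g \<in> carrier G" "h \<in> carrier G"
  shows "half (g \<otimes> h) = act g ` half h"
proof -
  have "x \<in> half (g \<otimes> h) \<longleftrightarrow> act (inv g) x \<in> half h" for x
    using assms by (simp add: half_def inv_mult_group act_mult)
  moreover have "x \<in> act g ` half h \<longleftrightarrow> act (inv g) x \<in> half h" for x
    using act_inv[OF assms(1)] by (metis imageE imageI)
  ultimately show ?thesis by blast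
qed

lemma bij_act: "g \<in> carrier G \<Longrightarrow> bij (act g)"
  using act_inv by (metis bijI')

lemma half_mult_subset:
  assumes "g \<in> carrier G" "h \<in> carrier G" "w \<in> carrier G"
  shows "half (g \<otimes> h) \<subseteq> half (g \<otimes> w) \<longleftrightarrow> half h \<subseteq> half w"
    and "- half (g \<otimes> h) \<subseteq> half (g \<otimes> w) \<longleftrightarrow> - half h \<subseteq> half w"
proof -
  have inj: "inj (act g)" and compl: "- act g ` S = act g ` (- S)" for S
    using bij_act[OF assms(1)] by (auto simp: bij_is_inj bij_image_Compl_eq)
  show "half (g \<otimes> h) \<subseteq> half (g \<otimes> w) \<longleftrightarrow> half h \<subseteq> half w"
    "- half (g \<otimes> h) \<subseteq> half (g \<otimes> w) \<longleftrightarrow> - half h \<subseteq> half w"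
    using assms inj by (simp_all only: half_mult compl inj_image_subset_iff)
qed

lemma half_upper:
  assumes g: "g \<in> carrier G" and c: "c g = 0"
  shows "half g = ball (b g / d g) n"
proof (rule Set.set_eqI)
  fix x
  have ad: "a g \<noteq> 0" "d g \<noteq> 0" "v (a g) = 0" "v (d g) = 0"
    using det_nonzero[OF g] c v_upper[OF g c] by (auto simp: det_2)
  show "x \<in> half g \<longleftrightarrow> x \<in> ball (b g / d g) n"
  proof (cases x)
    case None
    then show ?thesis using act_inv_None[OF g] c by (simp add: half_def)
  next
    case (Some u)
    have eq: "(d g * u - b g) / a g = (u - b g / d g) * (d g / a g)"
      using ad by (simp add: field_simps)
    have "vge ((d g * u - b g) / a g) n \<longleftrightarrow> vge (u - b g / d g) n"
      using ad unfolding eq by (cases "u = b g / d g") (auto simp: vge_def v_mult v_divide)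
    then show ?thesis using Some act_inv_Some[OF g, of u] c ad by (simp add: half_def)
  qed
qed

text \<open>The preimage \<open>- d / c\<close> of infinity lies in \<open>disc\<close>, so
  \<open>half g\<close> contains infinity and its complement is a ball around the image
  \<open>a / c\<close> of infinity. At \<open>u = a / c + e\<close> the inverse map has the value
  \<open>- d / c - \<delta> / (c\<^sup>2 e)\<close>. The 1 in the index comes from negating
  \<open>n \<le> - 2 v c - v e\<close>.\<close>

lemma half_near:
  assumes g: "g \<in> carrier G" and c: "c g \<noteq> 0" and near: "vge (d g / c g) n"
  shows "- half g = ball (a g / c g) (1 - n - 2 * v (c g))"
proof (rule Set.set_eqI)
  fix x
  have \<delta>: "\<delta> g \<noteq> 0" "v (\<delta> g) = 0" using det_nonzero[OF g] v_det[OF g] .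
  show "x \<in> - half g \<longleftrightarrow> x \<in> ball (a g / c g) (1 - n - 2 * v (c g))"
  proof (cases x)
    case None
    then show ?thesis using act_inv_None[OF g] c near by (simp add: half_def)
  next
    case (Some u)
    show ?thesis
    proof (cases "u = a g / c g")
      case True
      then show ?thesis using Some act_inv_Some[OF g, of u] c by (simp add: half_def)
    next
      case False
      define e where "e = u - a g / c g"
      have e: "e \<noteq> 0" "a g - c g * u = - c g * e" using False c by (auto simp: e_def field_simps)
      have "(d g * u - b g) / (a g - c g * u) = - (d g / c g) - \<delta> g / (c g * c g * e)"
        unfolding e(2) using c e(1) by (simp add: e_def det_2 field_simps)
      moreover have "vge (- (d g / c g) - \<delta> g / (c g * c g * e)) n \<longleftrightarrow> vge (\<delta> g / (c g * c g * e)) n"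
        using near vge_diff[of "- (d g / c g)" n "- (d g / c g) - \<delta> g / (c g * c g * e)"]
          vge_diff[of "- (d g / c g)" n "\<delta> g / (c g * c g * e)"] by auto
      moreover have "vge (\<delta> g / (c g * c g * e)) n \<longleftrightarrow> \<not> vge e (1 - n - 2 * v (c g))"
        using \<delta> c e(1) by (auto simp: vge_def v_divide v_mult)
      ultimately have "x \<in> half g \<longleftrightarrow> \<not> vge e (1 - n - 2 * v (c g))"
        using Some act_inv_Some[OF g, of u] e c by (simp add: half_def)
      then show ?thesis using Some by (simp add: e_def)
    qed
  qed
qed

text \<open>The preimage of infinity lies outside \<open>disc\<close>, so \<open>half g\<close> is a
  ball around the image \<open>b / d\<close> of zero, on which the inverse map scales by
  \<open>d\<^sup>2 / \<delta>\<close>.\<close>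

lemma half_far:
  assumes g: "g \<in> carrier G" and c: "c g \<noteq> 0" and far: "\<not> vge (d g / c g) n"
  shows "d g \<noteq> 0" "v (d g) < n + v (c g)" "half g = ball (b g / d g) (n - 2 * v (d g))"
proof -
  have \<delta>: "\<delta> g \<noteq> 0" "v (\<delta> g) = 0" using det_nonzero[OF g] v_det[OF g] .
  show d: "d g \<noteq> 0" using far by auto
  show vd: "v (d g) < n + v (c g)" using far c d by (simp add: vge_def v_divide)
  show "half g = ball (b g / d g) (n - 2 * v (d g))"
  proof (rule Set.set_eqI)
    fix x
    show "x \<in> half g \<longleftrightarrow> x \<in> ball (b g / d g) (n - 2 * v (d g))"
    proof (cases x)
      case None
      then show ?thesis using act_inv_None[OF g] c far by (simp add: half_def)
    next
      case (Some u)
      define e where "e = u - b g / d g"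
      define r where "r = a g - c g * u"
      have r: "r = \<delta> g / d g + - (c g * e)" and de: "d g * u - b g = d g * e"
        using d by (simp_all add: r_def e_def det_2 field_simps)
      have vr: "v (\<delta> g / d g) = - v (d g)" "\<delta> g / d g \<noteq> 0" using \<delta> d by (simp_all add: v_divide)
      have iff: "x \<in> half g \<longleftrightarrow> r \<noteq> 0 \<and> vge (d g * e / r) n"
        using Some act_inv_Some[OF g, of u] by (simp add: half_def r_def[symmetric] de)
      \<comment> \<open>If \<open>c * e\<close> is small, \<open>\<delta> / d\<close> dominates the
        denominator \<open>r\<close> and the scaling is exact. For larger \<open>e\<close> neither
        side of the equivalence holds.\<close>
      show ?thesis
      proof (cases "vge (c g * e) (1 - v (d g))")
        case True
        then have "r \<noteq> 0" "v r = - v (d g)"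
          using v_add_dominant[of "\<delta> g / d g" "- (c g * e)"] vr unfolding r by (simp_all add: algebra_simps)
        then have "x \<in> half g \<longleftrightarrow> vge e (n - 2 * v (d g))"
          using iff d by (cases "e = 0") (auto simp: vge_def v_divide v_mult)
        then show ?thesis using Some by (simp add: e_def)
      next
        case False
        then have e: "e \<noteq> 0" "v (c g) + v e \<le> - v (d g)" using c by (auto simp: vge_def v_mult)
        then have ve: "\<not> vge e (n - 2 * v (d g))" using vd by (simp add: vge_def)
        have "\<not> vge (d g * e / r) n" if "r \<noteq> 0"
        proof -
          have "vge (\<delta> g / d g) (v (c g) + v e)" "vge (- (c g * e)) (v (c g) + v e)"
            using vr e c by (auto simp: vge_def v_mult v_minus)
          then have "vge r (v (c g) + v e)" unfolding r by (rule vge_add)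
          then show ?thesis using that d e vd by (simp add: vge_def v_divide v_mult)
        qed
        then show ?thesis using iff ve Some by (auto simp: e_def)
      qed
    qed
  qed
qed

text \<open>The two points are the images of zero and of infinity under \<open>g\<close>. Their
  distance decides whether a ball around one of them contains the other.\<close>

lemma v_far_centre:
  assumes g: "g \<in> carrier G" and c: "c g \<noteq> 0" and d: "d g \<noteq> 0"
  shows "b g / d g - a g / c g \<noteq> 0" "v (b g / d g - a g / c g) = - v (c g) - v (d g)"
proof -
  have \<delta>: "\<delta> g \<noteq> 0" "v (\<delta> g) = 0" using det_nonzero[OF g] v_det[OF g] .
  have eq: "b g / d g - a g / c g = - (\<delta> g / (c g * d g))"
    using c d by (simp add: det_2 field_simps)
  show "b g / d g - a g / c g \<noteq> 0" "v (b g / d g - a g / c g) = - v (c g) - v (d g)"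
    unfolding eq using \<delta> c d by (simp_all add: v_minus v_divide v_mult)
qed

lemma half_cases:
  assumes "g \<in> carrier G"
  obtains (ball) x m where "half g = ball x m" | (coball) x m where "- half g = ball x m"
  using assms half_upper half_near half_far by metis

section \<open>The two factors and their intersection\<close>

definition stab :: "'g set" where "stab = {g \<in> carrier G. c g = 0}"

text \<open>
  In the Bruhat-Tits tree, \<open>sees w\<close> says that the half-tree \<open>half w\<close> contains the vertex on the side
  of \<open>disc\<close> of the base edge, whose two half-trees are \<open>disc\<close> and its complement.
\<close>

definition sees :: "'g \<Rightarrow> bool" where "sees w \<longleftrightarrow> disc \<subseteq> half w \<or> - disc \<subseteq> half w"

definition compl_grp :: "'g set" where
  "compl_grp = {h \<in> carrier G. \<forall>w\<in>carrier G. sees w \<longleftrightarrow> sees (inv h \<otimes> w)}"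

text \<open>This turns the condition defining \<open>compl_grp\<close> into a comparison between the
  base edge and its image under \<open>h\<close>: both must be seen by the same half-trees.\<close>

lemma sees_shift:
  assumes "h \<in> carrier G" "w \<in> carrier G"
  shows "sees (inv h \<otimes> w) \<longleftrightarrow> half h \<subseteq> half w \<or> - half h \<subseteq> half w"
  using half_mult_subset[of "inv h" h w] assms by (simp add: sees_def half_one)

lemma subgroup_stab: "subgroup stab G"
  by (rule subgroupI) (auto simp: stab_def entries_mult entries_inv entries_one intro!: exI[of _ \<one>])

lemma subgroup_compl_grp: "subgroup compl_grp G"
proof (rule subgroupI)
  show "compl_grp \<noteq> {}" by (auto simp: compl_grp_def intro!: exI[of _ \<one>])
  fix h assume h: "h \<in> compl_grp"
  then have hG: "h \<in> carrier G" by (simp add: compl_grp_def)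
  have "sees w \<longleftrightarrow> sees (inv (inv h) \<otimes> w)" if "w \<in> carrier G" for w
  proof -
    have "sees (h \<otimes> w) \<longleftrightarrow> sees (inv h \<otimes> (h \<otimes> w))"
      using h hG that unfolding compl_grp_def by blast
    then show ?thesis using hG that by (simp add: m_assoc[symmetric])
  qed
  then show "inv h \<in> compl_grp" using hG by (simp add: compl_grp_def)
  fix h' assume h': "h' \<in> compl_grp"
  then have h'G: "h' \<in> carrier G" by (simp add: compl_grp_def)
  have "sees w \<longleftrightarrow> sees (inv (h \<otimes> h') \<otimes> w)" if w: "w \<in> carrier G" for w
  proof -
    have "sees w \<longleftrightarrow> sees (inv h \<otimes> w)" using h w unfolding compl_grp_def by blast
    also have "\<dots> \<longleftrightarrow> sees (inv h' \<otimes> (inv h \<otimes> w))" using h' hG w unfolding compl_grp_def by blast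
    finally show ?thesis using hG h'G w by (simp add: inv_mult_group m_assoc)
  qed
  then show "h \<otimes> h' \<in> compl_grp" using hG h'G by (simp add: compl_grp_def)
qed (auto simp: compl_grp_def)

text \<open>If \<open>g\<close> moved infinity and \<open>half g\<close> were \<open>disc\<close>,
  the image \<open>a / c\<close> of infinity would be close enough to \<open>b / d\<close> to lie in
  \<open>disc = half g\<close> by \<open>v_lower\<close>. But infinity is not in
  \<open>disc\<close>, so its image is not in \<open>half g\<close>.\<close>

lemma half_eq_disc_imp_stab:
  assumes g: "g \<in> carrier G" and eq: "half g = disc"
  shows "g \<in> stab"
proof (rule ccontr)
  assume "g \<notin> stab"
  then have c: "c g \<noteq> 0" using g by (simp add: stab_def)
  show False
  proof (cases "vge (d g / c g) n")
    case True
    from half_near[OF g c this] show False using eq None_notin_ball None_notin_disc by blast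
  next
    case False
    note far = half_far[OF g c False]
    have "Some (b g / d g) \<in> half g" unfolding far(3) by simp
    then have bd: "vge (b g / d g) n" using eq by simp
    have "vge (b g / d g - a g / c g) n"
      using v_far_centre[OF g c far(1)] v_lower[OF g c] far(2) by (simp add: vge_def)
    from vge_diff[OF bd this] have "Some (a g / c g) \<in> half g" using eq by simp
    then show False using act_inv_Some[OF g, of "a g / c g"] c by (simp add: half_def)
  qed
qed

text \<open>For the converse direction, \<open>sees g\<close> leaves only
  \<open>disc \<subseteq> half g\<close>, because the ball \<open>half g\<close> omits infinity; and
  two balls of equal index that meet coincide.\<close>

lemma half_eq_disc_iff:
  assumes g: "g \<in> carrier G"
  shows "half g = disc \<longleftrightarrow> g \<in> stab \<inter> compl_grp"
proof
  assume eq: "half g = disc"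
  then show "g \<in> stab \<inter> compl_grp"
    using half_eq_disc_imp_stab[OF g] sees_shift[OF g] g by (simp add: compl_grp_def sees_def)
next
  assume "g \<in> stab \<inter> compl_grp"
  then have c: "c g = 0" and H: "sees g \<longleftrightarrow> sees \<one>"
    using g by (auto simp: stab_def compl_grp_def)
  have "disc \<subseteq> half g \<or> - disc \<subseteq> half g" using H by (simp add: sees_def half_one)
  then have "disc \<subseteq> ball (b g / d g) n"
    unfolding half_upper[OF g c] using None_notin_ball None_notin_disc by blast
  moreover have "Some 0 \<in> disc" by simp
  ultimately show "half g = disc"
    unfolding half_upper[OF g c] disc_def using ball_recentre by blast
qed

lemma stab_moves_disc:
  assumes p: "p \<in> stab - stab \<inter> compl_grp"
  shows "half p \<inter> disc = {}"
proof (rule ccontr)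
  have pG: "p \<in> carrier G" "c p = 0" using p by (auto simp: stab_def)
  assume "half p \<inter> disc \<noteq> {}"
  then have "half p = disc"
    using ball_subsetI[of "b p / d p" n 0 n] ball_subsetI[of 0 n "b p / d p" n]
    unfolding half_upper[OF pG] disc_def by auto
  then show False using half_eq_disc_iff[OF pG(1)] p by blast
qed

text \<open>Invariance is tested at \<open>w = \<one>\<close> and at \<open>w = h\<close>. The
  resulting inclusions leave either \<open>half h = disc\<close>, which is excluded, or the
  conclusion.\<close>

lemma compl_grp_moves_codisc:
  assumes h: "h \<in> compl_grp - stab \<inter> compl_grp"
  shows "- half h \<subseteq> disc"
proof -
  have hG: "h \<in> carrier G" and H: "\<And>w. w \<in> carrier G \<Longrightarrow> sees w \<longleftrightarrow> sees (inv h \<otimes> w)"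
    using h unfolding compl_grp_def by blast+
  have ne: "half h \<noteq> disc" using half_eq_disc_iff[OF hG] h by blast
  have "sees \<one>" by (simp add: sees_def half_one)
  then have 1: "half h \<subseteq> disc \<or> - half h \<subseteq> disc"
    using H[of \<one>] sees_shift[OF hG, of \<one>] by (simp add: half_one)
  have "sees h \<longleftrightarrow> sees \<one>" using H[OF hG] hG by simp
  then have "disc \<subseteq> half h \<or> - disc \<subseteq> half h" using \<open>sees \<one>\<close> by (simp add: sees_def)
  then show ?thesis using 1 ne None_notin_disc by blast
qed

text \<open>In the tree, \<open>k\<close> corresponds to an edge adjacent to the component stabilised by \<open>compl_grp\<close>.\<close>

lemma maximal_in_compl_grp:
  assumes k: "k \<in> carrier G" and sub: "- half k \<subseteq> disc"
    and max: "\<And>w. w \<in> carrier G \<Longrightarrow> - half k \<subseteq> - half w \<Longrightarrow> - half w \<subseteq> disc \<Longrightarrow> v (c w) \<le> v (c k)"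
  shows "k \<in> compl_grp"
proof -
  have "act (inv k) None \<in> disc" using sub by (auto simp: half_def)
  then have ck: "c k \<noteq> 0" and near: "vge (d k / c k) n"
    using act_inv_None[OF k] by (auto split: if_splits)
  define m where "m = 1 - n - 2 * v (c k)"
  have hk: "- half k = ball (a k / c k) m" using half_near[OF k ck near] by (simp add: m_def)
  have "n < m" using v_lower[OF k ck] by (simp add: m_def)
  then have ne: "- half k \<noteq> disc" unfolding hk disc_def using ball_radius_less by metis
  have nonempty: "- half k \<noteq> {}" unfolding hk using centre_in_ball by blast
  \<comment> \<open>The two conditions could differ only through an edge of the orbit strictly
    between those of \<open>k\<close> and \<open>disc\<close>. The cases are its two orientations:
    \<open>coball\<close> is excluded by \<open>max\<close> directly, \<open>ball\<close> by
    constructing from it an edge of the other orientation.\<close>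
  have "sees w \<longleftrightarrow> half k \<subseteq> half w \<or> - half k \<subseteq> half w" if w: "w \<in> carrier G" for w
    using w
  proof (cases rule: half_cases)
    case (coball x r)
    then have Nw: "None \<in> half w" using None_notin_ball by blast
    have nest: "- half w \<inter> - half k = {} \<or> - half w \<subseteq> - half k \<or> - half k \<subseteq> - half w"
      unfolding coball hk by (rule ball_disjoint_or_nested)
    have nest': "- half w \<inter> disc = {} \<or> - half w \<subseteq> disc \<or> disc \<subseteq> - half w"
      unfolding coball disc_def by (rule ball_disjoint_or_nested)
    show ?thesis
    proof
      assume "sees w"
      then have disj: "disc \<subseteq> half w \<or> - half w \<subseteq> disc" by (auto simp: sees_def)
      have "- half w \<subseteq> - half k" if kw: "- half k \<subseteq> - half w"
      proof -
        have wd: "- half w \<subseteq> disc" using disj kw sub nonempty by blast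
        have "act (inv w) None \<in> disc" using wd by (auto simp: half_def)
        then have cw: "c w \<noteq> 0" and nw: "vge (d w / c w) n"
          using act_inv_None[OF w] by (auto split: if_splits)
        have "v (c w) \<le> v (c k)" using max[OF w kw wd] .
        then show ?thesis
          using kw nonempty unfolding half_near[OF w cw nw] hk m_def by (intro ball_subsetI) auto
      qed
      then show "half k \<subseteq> half w \<or> - half k \<subseteq> half w" using nest by blast
    next
      assume "half k \<subseteq> half w \<or> - half k \<subseteq> half w"
      then show "sees w" using nest' sub ne nonempty Nw unfolding sees_def by blast
    qed
  next
    case (ball x r)
    then have Nw: "None \<notin> half w" using None_notin_ball by blast
    have Nk: "None \<in> half k" using sub by auto
    have nest: "half w \<inter> disc = {} \<or> half w \<subseteq> disc \<or> disc \<subseteq> half w"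
      unfolding ball disc_def by (rule ball_disjoint_or_nested)
    show ?thesis
    proof
      assume "sees w"
      then have "disc \<subseteq> half w" using Nw None_notin_disc unfolding sees_def by blast
      then show "half k \<subseteq> half w \<or> - half k \<subseteq> half w" using sub by blast
    next
      assume "half k \<subseteq> half w \<or> - half k \<subseteq> half w"
      then have kw: "- half k \<subseteq> half w" using Nw Nk by blast
      have False if wd: "half w \<subseteq> disc" and nd: "\<not> disc \<subseteq> half w"
      proof (cases "c w = 0")
        case True
        have "disc \<inter> half w \<noteq> {}" using kw sub nonempty by blast
        then have "disc \<subseteq> half w"
          unfolding half_upper[OF w True] disc_def by (intro ball_subsetI) auto
        then show False using nd by simp
      next
        case cw: False
        have fw: "\<not> vge (d w / c w) n"
        proof
          assume "vge (d w / c w) n"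
          from half_near[OF w cw this] show False using Nw None_notin_ball by blast
        qed
        note far = half_far[OF w cw fw]
        \<comment> \<open>Multiplying \<open>w\<close> by \<open>p\<close> on the right keeps the
          image \<open>a w / c w\<close> of infinity and brings the preimage of infinity into
          \<open>disc\<close>. The complement of the new half-tree is then a ball around
          \<open>a w / c w\<close>; it contains \<open>half w\<close>, and its centre is not in
          \<open>half w\<close>.\<close>
        obtain p where p: "p \<in> carrier G" "a p = 1" "c p = 0" "d p = 1" "vge (- (d w / c w) - b p) n"
          using translation by blast
        define u where "u = w \<otimes> p"
        have u: "u \<in> carrier G" "c u = c w" "a u = a w" "d u / c u = d w / c w + b p"
          using w p cw by (simp_all add: u_def entries_mult field_simps)
        have nu: "vge (d u / c u) n"
          using p(5) vge_minus[of "- (d w / c w) - b p" n] u(4) by (simp add: add.commute)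
        have hu: "- half u = ball (a w / c w) (1 - n - 2 * v (c w))"
          using half_near[OF u(1) _ nu] u cw by simp
        note vc = v_far_centre[OF w cw far(1)]
        have "half w \<inter> - half u \<noteq> {}"
        proof -
          have "Some (b w / d w) \<in> half w" unfolding far(3) by simp
          moreover have "Some (b w / d w) \<in> - half u" unfolding hu using vc far(2) by (simp add: vge_def)
          ultimately show ?thesis by blast
        qed
        then have wu: "half w \<subseteq> - half u"
          unfolding far(3) hu using far(2) by (intro ball_subsetI) auto
        have ud: "- half u \<subseteq> disc"
          unfolding hu disc_def
        proof (rule ball_subsetI)
          have "half w \<subseteq> ball (a w / c w) (1 - n - 2 * v (c w))" using wu hu by simp
          then show "ball (a w / c w) (1 - n - 2 * v (c w)) \<inter> ball 0 n \<noteq> {}"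
            using wd far(3) centre_in_ball unfolding disc_def by blast
          show "n \<le> 1 - n - 2 * v (c w)" using v_lower[OF w cw] by simp
        qed
        have "v (c w) \<le> v (c k)" using max[OF u(1) _ ud] kw wu u(2) by auto
        then have "- half u \<subseteq> - half k"
          using kw wu nonempty unfolding hu hk m_def by (intro ball_subsetI) auto
        then have "- half u \<subseteq> half w" using kw by blast
        moreover have "Some (a w / c w) \<in> - half u" unfolding hu by simp
        ultimately have "Some (a w / c w) \<in> half w" by blast
        then show False using act_inv_Some[OF w, of "a w / c w"] cw by (simp add: half_def)
      qed
      then have "disc \<subseteq> half w" using nest kw sub nonempty by blast
      then show "sees w" by (simp add: sees_def)
    qed
  qed
  then show ?thesis using k sees_shift[OF k] by (simp add: compl_grp_def)
qed

text \<open>Translations on both sides make \<open>- half h\<close> a ball inside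
  \<open>disc\<close>. A largest orbit ball \<open>- half k\<close> between the two has
  \<open>k\<close> in \<open>compl_grp\<close>. The lower left entry of
  \<open>inv k \<otimes> h\<close> measures the distance between the images of infinity under
  \<open>h\<close> and \<open>k\<close>; both lie in \<open>- half k\<close>, so its valuation
  exceeds that of \<open>c h\<close>.\<close>

lemma generate_pair: "g \<in> carrier G \<Longrightarrow> g \<in> generate G (stab \<union> compl_grp)"
proof (induction "nat (- n - v (c g))" arbitrary: g rule: less_induct)
  case less
  let ?Q = "generate G (stab \<union> compl_grp)"
  note g = less.prems
  have Q: "subgroup ?Q G"
    by (rule generate_is_subgroup) (auto simp: stab_def compl_grp_def)
  have QP: "p \<in> ?Q" if "p \<in> stab" for p using that by (auto intro: generate.incl)
  show ?case
  proof (cases "c g = 0")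
    case True
    then show ?thesis using g by (intro QP) (simp add: stab_def)
  next
    case cg: False
    obtain p where p: "p \<in> carrier G" "a p = 1" "c p = 0" "d p = 1" "vge (- (a g / c g) - b p) n"
      using translation by blast
    obtain q where q: "q \<in> carrier G" "a q = 1" "c q = 0" "d q = 1" "vge (- (d g / c g) - b q) n"
      using translation by blast
    define h where "h = p \<otimes> g \<otimes> q"
    have h: "h \<in> carrier G" "c h = c g" "a h / c h = a g / c g + b p" "d h / c h = d g / c g + b q"
      using g p q cg by (simp_all add: h_def entries_mult field_simps)
    have nh: "vge (d h / c h) n" "vge (a h / c h) n"
      using p(5) q(5) vge_minus[of "- (d g / c g) - b q" n] vge_minus[of "- (a g / c g) - b p" n] h
      by (simp_all add: add.commute)
    have ch: "c h \<noteq> 0" using h cg by simp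
    have hh: "- half h = ball (a h / c h) (1 - n - 2 * v (c h))" by (rule half_near[OF h(1) ch nh(1)])
    define S where "S = {k \<in> carrier G. - half h \<subseteq> - half k \<and> - half k \<subseteq> disc}"
    have "- half h \<subseteq> disc"
      unfolding hh disc_def
    proof (rule ball_subsetI)
      have "Some (a h / c h) \<in> ball (a h / c h) (1 - n - 2 * v (c h)) \<inter> ball 0 n" using nh by simp
      then show "ball (a h / c h) (1 - n - 2 * v (c h)) \<inter> ball 0 n \<noteq> {}" by blast
      show "n \<le> 1 - n - 2 * v (c h)" using v_lower[OF h(1) ch] by simp
    qed
    then have hS: "h \<in> S" using h by (simp add: S_def)
    have Sc: "c k \<noteq> 0" "vge (d k / c k) n" if "k \<in> S" for k
    proof -
      have k: "k \<in> carrier G" using that by (simp add: S_def)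
      have "act (inv k) None \<in> disc" using that by (auto simp: half_def S_def)
      then show "c k \<noteq> 0" "vge (d k / c k) n"
        using act_inv_None[OF k] by (auto split: if_splits)
    qed
    \<comment> \<open>The index of \<open>- half k\<close> is \<open>1 - n - 2 * v (c k)\<close>, so
      the least value gives the largest ball. On \<open>S\<close> the conversion to a natural number
      loses nothing, by \<open>v_lower\<close>.\<close>
    define k where "k = arg_min (\<lambda>k. nat (- n - v (c k))) (\<lambda>k. k \<in> S)"
    have kS: "k \<in> S" and kmin: "\<And>w. w \<in> S \<Longrightarrow> nat (- n - v (c k)) \<le> nat (- n - v (c w))"
      using arg_min_nat_lemma[of "\<lambda>k. k \<in> S" h "\<lambda>k. nat (- n - v (c k))"] hS
      unfolding k_def by auto
    have k: "k \<in> carrier G" "- half h \<subseteq> - half k" "- half k \<subseteq> disc" using kS by (auto simp: S_def)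
    note ck = Sc[OF kS]
    have kH: "k \<in> compl_grp"
    proof (rule maximal_in_compl_grp[OF k(1,3)])
      fix w assume "w \<in> carrier G" "- half k \<subseteq> - half w" "- half w \<subseteq> disc"
      then have wS: "w \<in> S" using k by (auto simp: S_def)
      show "v (c w) \<le> v (c k)"
        using kmin[OF wS] v_lower[of w] v_lower[of k] Sc wS kS by (auto simp: S_def)
    qed
    have "Some (a h / c h) \<in> - half h" unfolding hh by simp
    then have "Some (a h / c h) \<in> - half k" using k(2) by blast
    then have near: "vge (a h / c h - a k / c k) (1 - n - 2 * v (c k))"
      unfolding half_near[OF k(1) ck] by simp
    define g' where "g' = inv k \<otimes> h"
    have g': "g' \<in> carrier G" using k h by (simp add: g'_def)
    have cg': "c g' = - (c h * c k * (a h / c h - a k / c k)) / \<delta> k"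
    proof -
      have "c g' = (a k * c h - c k * a h) / \<delta> k"
        using k(1) h(1) by (simp add: g'_def entries_mult entries_inv diff_divide_distrib)
      moreover have "a k * c h - c k * a h = - (c h * c k * (a h / c h - a k / c k))"
        using ch ck(1) by (simp add: field_simps)
      ultimately show ?thesis by simp
    qed
    have "g' \<in> ?Q"
    proof (cases "c g' = 0")
      case True
      then show ?thesis using g' by (intro QP) (simp add: stab_def)
    next
      case False
      then have "v (c g') = v (c h) + v (c k) + v (a h / c h - a k / c k)"
        unfolding cg' using det_nonzero[OF k(1)] v_det[OF k(1)]
        by (simp add: v_divide v_mult v_minus)
      moreover have "1 - n - 2 * v (c k) \<le> v (a h / c h - a k / c k)"
        using near False unfolding cg' vge_def by auto
      \<comment> \<open>The two facts add up to
        \<open>v (c g') \<ge> v (c h) + 1 - n - v (c k)\<close>, and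
        \<open>v (c k) \<le> - n\<close>.\<close>
      ultimately have "v (c g) < v (c g')" using v_lower[OF k(1) ck(1)] h(2) by simp
      then show ?thesis using less.hyps[OF _ g'] v_lower[OF g' False] by simp
    qed
    then have "k \<otimes> g' \<in> ?Q"
      using subgroup.m_closed[OF Q] kH by (auto intro: generate.incl)
    then have hQ: "h \<in> ?Q" using k h by (simp add: g'_def m_assoc[symmetric])
    have "inv p \<in> ?Q" "inv q \<in> ?Q"
      using QP p q subgroup.m_inv_closed[OF Q] by (simp_all add: stab_def)
    then have "inv p \<otimes> h \<otimes> inv q \<in> ?Q" using hQ subgroup.m_closed[OF Q] by blast
    moreover have "inv p \<otimes> h \<otimes> inv q = g" using p q g by (simp add: h_def m_assoc[symmetric] inv_solve_right')
    ultimately show ?thesis by simp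
  qed
qed

theorem stab_amalgam: "is_amalgamated_product G stab compl_grp (stab \<inter> compl_grp)"
proof -
  interpret subgroup_pair G stab compl_grp
    by (intro subgroup_pair.intro subgroup_pair_axioms.intro group_axioms subgroup_stab subgroup_compl_grp)
  show ?thesis
  proof (rule ping_pong[where \<phi> = act and pt = None and Y = "- disc" and Z = disc])
    show "carrier G \<subseteq> generate G (stab \<union> compl_grp)" using generate_pair by blast
    show "act (g \<otimes> h) x = act g (act h x)" if "g \<in> carrier G" "h \<in> carrier G" for g h x
      using act_mult[OF that] .
    show "act p None = None" if "p \<in> stab" for p
      using that by (simp add: stab_def moebius_def)
    have half: "act g x \<in> half g \<longleftrightarrow> x \<in> disc" if "g \<in> carrier G" for g x
      using act_inv[OF that] by (simp add: half_def)
    show "act p z \<in> - disc" if "p \<in> stab - stab \<inter> compl_grp" "z \<in> disc" for p z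
      using stab_moves_disc[OF that(1)] half[of p z] that by (auto simp: stab_def)
    show "act q y \<in> disc" if "q \<in> compl_grp - stab \<inter> compl_grp" "y \<in> - disc" for q y
      using compl_grp_moves_codisc[OF that(1)] half[of q y] that by (auto simp: compl_grp_def)
  qed (auto simp: act_one)
qed

text \<open>An element preserving \<open>disc\<close> sends its centre zero to \<open>b / d\<close>
  in \<open>disc\<close>. This form reduces finiteness of the intersection to a count of matrix
  entries.\<close>

lemma amalgamated_subset:
  "stab \<inter> compl_grp \<subseteq> {g \<in> carrier G. c g = 0 \<and> vge (b g / d g) n}"
proof
  fix g assume *: "g \<in> stab \<inter> compl_grp"
  then have g: "g \<in> carrier G" "c g = 0" by (auto simp: stab_def)
  have "Some (b g / d g) \<in> half g" unfolding half_upper[OF g] by simp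
  then show "g \<in> {g \<in> carrier G. c g = 0 \<and> vge (b g / d g) n}"
    using half_eq_disc_iff[OF g(1)] * g by auto
qed

end

section \<open>Polynomials with coefficients in a subring\<close>

text \<open>The polynomials have coefficients in the whole type and membership in \<open>S\<close>
  is a side condition, so that they can be evaluated at any element of the field.\<close>

definition poly_over :: "'k::field set \<Rightarrow> 'k poly set" where
  "poly_over S = {p. \<forall>i. Polynomial.coeff p i \<in> S}"

locale field_subring =
  fixes S :: "'k::field set"
  assumes one_mem: "1 \<in> S" and minus_mem: "x \<in> S \<Longrightarrow> - x \<in> S"
    and add_mem: "x \<in> S \<Longrightarrow> y \<in> S \<Longrightarrow> x + y \<in> S"
    and mult_mem: "x \<in> S \<Longrightarrow> y \<in> S \<Longrightarrow> x * y \<in> S"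
begin

lemma zero_mem: "0 \<in> S"
  using add_mem[of 1 "- 1"] one_mem minus_mem[of 1] by simp

lemma diff_mem: "x \<in> S \<Longrightarrow> y \<in> S \<Longrightarrow> x - y \<in> S"
  using add_mem[of x "- y"] minus_mem[of y] by simp

lemma sum_mem: "(\<And>i. i \<in> I \<Longrightarrow> f i \<in> S) \<Longrightarrow> sum f I \<in> S"
  by (induction I rule: infinite_finite_induct) (auto intro: zero_mem add_mem)

lemma power_mem: "x \<in> S \<Longrightarrow> x ^ k \<in> S"
  by (induction k) (auto intro: one_mem mult_mem)

lemma poly_over_0: "0 \<in> poly_over S"
  by (simp add: poly_over_def zero_mem)

lemma poly_over_pCons: "pCons x p \<in> poly_over S \<longleftrightarrow> x \<in> S \<and> p \<in> poly_over S"
proof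
  assume *: "pCons x p \<in> poly_over S"
  have "Polynomial.coeff (pCons x p) i \<in> S" for i using * by (simp add: poly_over_def)
  from this[of 0] this[of "Suc _"] show "x \<in> S \<and> p \<in> poly_over S" by (simp add: poly_over_def)
qed (auto simp: poly_over_def coeff_pCons split: nat.split)

lemma poly_over_1: "1 \<in> poly_over S"
  by (simp add: one_pCons poly_over_pCons one_mem poly_over_0)

lemma poly_over_add: "p \<in> poly_over S \<Longrightarrow> q \<in> poly_over S \<Longrightarrow> p + q \<in> poly_over S"
  and poly_over_minus: "p \<in> poly_over S \<Longrightarrow> - p \<in> poly_over S"
  and poly_over_diff: "p \<in> poly_over S \<Longrightarrow> q \<in> poly_over S \<Longrightarrow> p - q \<in> poly_over S"
  and poly_over_smult: "x \<in> S \<Longrightarrow> p \<in> poly_over S \<Longrightarrow> smult x p \<in> poly_over S"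
  by (simp_all add: poly_over_def add_mem minus_mem diff_mem mult_mem)

lemma poly_over_mult: "p \<in> poly_over S \<Longrightarrow> q \<in> poly_over S \<Longrightarrow> p * q \<in> poly_over S"
  by (auto simp: poly_over_def coeff_mult intro: sum_mem mult_mem)

lemma poly_over_monom: "x \<in> S \<Longrightarrow> Polynomial.monom x m \<in> poly_over S"
  by (simp add: poly_over_def zero_mem)

lemma poly_over_prod: "(\<And>i. i \<in> I \<Longrightarrow> f i \<in> poly_over S) \<Longrightarrow> prod f I \<in> poly_over S"
  by (induction I rule: infinite_finite_induct) (auto intro: poly_over_1 poly_over_mult)

lemma poly_over_sum: "(\<And>i. i \<in> I \<Longrightarrow> f i \<in> poly_over S) \<Longrightarrow> sum f I \<in> poly_over S"
  by (induction I rule: infinite_finite_induct) (auto intro: poly_over_0 poly_over_add)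

lemma poly_mem:
  assumes "field_subring T" "S \<subseteq> T" "p \<in> poly_over S" "x \<in> T"
  shows "poly p x \<in> T"
proof -
  interpret T: field_subring T by fact
  show ?thesis
    unfolding poly_altdef using assms by (intro T.sum_mem T.mult_mem T.power_mem) (auto simp: poly_over_def)
qed

end

lemma field_subring_iff: "subring S (ring_of_type_algebra :: 'k::field ring) \<longleftrightarrow> field_subring S"
  by (auto simp: subring_iff field_subring_def)

locale coeff_field = field_subring F for F :: "'k::field set" +
  assumes inverse_mem: "x \<in> F \<Longrightarrow> inverse x \<in> F"
begin

text \<open>Eliminating leading terms uses only the coefficients of \<open>p\<close> and
  \<open>q\<close> and the inverse of the leading coefficient of \<open>q\<close>, so quotient and
  remainder stay over \<open>F\<close>.\<close>

lemma poly_over_divide: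
  assumes "p \<in> poly_over F" "q \<in> poly_over F" "q \<noteq> 0"
  shows "\<exists>s\<in>poly_over F. \<exists>r\<in>poly_over F. p = q * s + r \<and> (r = 0 \<or> Polynomial.degree r < Polynomial.degree q)"
  using assms(1)
proof (induction "Polynomial.degree p" arbitrary: p rule: less_induct)
  case less
  show ?case
  proof (cases "p = 0 \<or> Polynomial.degree p < Polynomial.degree q")
    case True
    then show ?thesis using less.prems poly_over_0 by force
  next
    case False
    define t where "t = Polynomial.monom (lead_coeff p * inverse (lead_coeff q)) (Polynomial.degree p - Polynomial.degree q)"
    have tF: "t \<in> poly_over F"
      unfolding t_def using less.prems assms(2)
      by (intro poly_over_monom mult_mem inverse_mem) (auto simp: poly_over_def)
    have nz: "lead_coeff p * inverse (lead_coeff q) \<noteq> 0" using False assms(3) by simp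
    have deg: "Polynomial.degree (q * t) = Polynomial.degree p"
      using False assms(3) nz by (simp add: t_def degree_mult_eq monom_eq_0_iff degree_monom_eq)
    have lc: "lead_coeff (q * t) = lead_coeff p"
      using assms(3) nz by (simp add: t_def lead_coeff_mult degree_monom_eq)
    define p' where "p' = p - q * t"
    have p'F: "p' \<in> poly_over F"
      unfolding p'_def using less.prems assms(2) tF by (intro poly_over_diff poly_over_mult)
    have small: "p' = 0 \<or> Polynomial.degree p' < Polynomial.degree p"
    proof -
      have "Polynomial.coeff p' (Polynomial.degree p) = 0" using deg lc by (simp add: p'_def)
      moreover have "Polynomial.degree p' \<le> Polynomial.degree p"
        unfolding p'_def using deg by (metis degree_diff_le order_refl)
      ultimately show ?thesis by (metis le_neq_implies_less leading_coeff_0_iff)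
    qed
    have "\<exists>s\<in>poly_over F. \<exists>r\<in>poly_over F. p' = q * s + r \<and> (r = 0 \<or> Polynomial.degree r < Polynomial.degree q)"
    proof (cases "p' = 0")
      case True
      then show ?thesis using poly_over_0 by force
    next
      case False
      then show ?thesis using small less.hyps[OF _ p'F] by blast
    qed
    then obtain s r where sr: "s \<in> poly_over F" "r \<in> poly_over F" "p' = q * s + r"
      "r = 0 \<or> Polynomial.degree r < Polynomial.degree q" by blast
    then have "p = q * (s + t) + r" by (simp add: p'_def algebra_simps)
    then show ?thesis using sr tF poly_over_add by blast
  qed
qed

lemma poly_over_shift:
  assumes p: "p \<in> poly_over F" and low: "\<And>j. j < t \<Longrightarrow> Polynomial.coeff p j = 0"
  obtains r where "r \<in> poly_over F" "p = Polynomial.monom 1 t * r" "Polynomial.coeff r 0 = Polynomial.coeff p t"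
proof -
  have "Polynomial.monom 1 t dvd p" using low by (simp add: monom_1_dvd_iff')
  then obtain r where r: "p = Polynomial.monom 1 t * r" by (rule dvdE)
  have *: "Polynomial.coeff r k = Polynomial.coeff p (k + t)" for k
    unfolding r by (simp add: coeff_monom_mult)
  have "r \<in> poly_over F" using p by (simp add: poly_over_def *)
  then show ?thesis using that r *[of 0] by simp
qed

text \<open>The degree bound is put on coefficients so that zero is included and the count
  \<open>card F ^ d\<close> is exact, also for \<open>d = 0\<close>.\<close>

definition polys :: "nat \<Rightarrow> 'k poly set" where
  "polys d = {p \<in> poly_over F. \<forall>i\<ge>d. Polynomial.coeff p i = 0}"

lemma polys_Suc: "polys (Suc d) = (\<lambda>(x, p). pCons x p) ` (F \<times> polys d)"
proof (intro equalityI subsetI)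
  fix p assume p: "p \<in> polys (Suc d)"
  obtain x q where q: "p = pCons x q" by (cases p)
  have "Polynomial.coeff q i = 0" if "i \<ge> d" for i
    using p that unfolding polys_def q by (auto dest: spec[of _ "Suc i"])
  then have "(x, q) \<in> F \<times> polys d"
    using p by (simp add: polys_def q poly_over_pCons)
  then show "p \<in> (\<lambda>(x, p). pCons x p) ` (F \<times> polys d)" using q by force
qed (auto simp: polys_def poly_over_pCons coeff_pCons split: nat.split)

lemma card_polys:
  assumes "finite F"
  shows "finite (polys d)" "card (polys d) = card F ^ d"
proof -
  have "finite (polys d) \<and> card (polys d) = card F ^ d"
  proof (induction d)
    case 0
    have "polys 0 = {0}" by (auto simp: polys_def poly_over_0 intro: poly_eqI)
    then show ?case by simp
  next
    case (Suc d)
    have "inj_on (\<lambda>(x, p). pCons x p) (F \<times> polys d)" by (auto simp: inj_on_def)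
    then show ?case using Suc assms by (simp add: polys_Suc card_image card_cartesian_product)
  qed
  then show "finite (polys d)" "card (polys d) = card F ^ d" by auto
qed

lemma polys_mult:
  assumes "p \<in> polys d" "q \<in> polys d'"
  shows "p * q \<in> polys (d + d')"
proof -
  have "Polynomial.coeff (p * q) i = 0" if "i \<ge> d + d'" for i
  proof -
    have z: "Polynomial.coeff p j * Polynomial.coeff q (i - j) = 0" for j
      using assms that by (cases "j \<ge> d") (auto simp: polys_def)
    show ?thesis unfolding coeff_mult using z by (intro sum.neutral) blast
  qed
  then show ?thesis using assms poly_over_mult by (simp add: polys_def)
qed

lemma polys_add: "p \<in> polys d \<Longrightarrow> q \<in> polys d \<Longrightarrow> p + q \<in> polys d"
  by (simp add: polys_def poly_over_add)

lemma polys_smult: "x \<in> F \<Longrightarrow> p \<in> polys d \<Longrightarrow> smult x p \<in> polys d"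
  by (simp add: polys_def poly_over_smult)

lemma polys_0: "0 \<in> polys d"
  by (simp add: polys_def poly_over_0)

lemma polys_mono: "d \<le> d' \<Longrightarrow> polys d \<subseteq> polys d'"
  by (auto simp: polys_def)

lemma polys_degree: "p \<in> poly_over F \<Longrightarrow> p \<in> polys (Suc (Polynomial.degree p))"
  by (auto simp: polys_def intro: coeff_eq_0)

lemma polys_common:
  assumes "finite I" "\<And>i. i \<in> I \<Longrightarrow> f i \<in> poly_over F"
  shows "\<exists>d. \<forall>i\<in>I. f i \<in> polys d"
proof (intro exI ballI)
  fix i assume i: "i \<in> I"
  have "Suc (Polynomial.degree (f i)) \<le> (\<Sum>i\<in>I. Suc (Polynomial.degree (f i)))"
    using assms(1) i by (intro member_le_sum) auto
  then show "f i \<in> polys (\<Sum>i\<in>I. Suc (Polynomial.degree (f i)))"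
    using polys_degree[OF assms(2)[OF i]] polys_mono by blast
qed

end

section \<open>Algebraic function fields of one variable\<close>

lemma coeff_field_subfield:
  assumes "subfield F (ring_of_type_algebra :: 'k::field ring)"
  shows "coeff_field F"
proof -
  let ?R = "ring_of_type_algebra :: 'k ring"
  interpret R: field ?R by (rule field_from_type_algebra)
  have S: "field_subring F"
    using subfieldE(1)[OF assms] by (simp add: field_subring_iff)
  interpret field_subring F by fact
  have "inverse x \<in> F" if "x \<in> F" for x
  proof (cases "x = 0")
    case False
    have "inv\<^bsub>?R\<^esub> x \<in> F" "x \<otimes>\<^bsub>?R\<^esub> inv\<^bsub>?R\<^esub> x = \<one>\<^bsub>?R\<^esub>"
      using R.subfield_m_inv[OF assms] that False by (auto simp: ring_of_type_algebra_simps)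
    then show ?thesis by (metis inverse_unique ring_of_type_algebra_simps(2,4))
  qed (simp add: zero_mem)
  then show ?thesis using S by (simp add: coeff_field_def coeff_field_axioms_def)
qed

lemma inv_ring_of_type_algebra:
  "x \<noteq> 0 \<Longrightarrow> inv\<^bsub>ring_of_type_algebra\<^esub> x = inverse (x :: 'k::field)"
proof -
  assume x: "x \<noteq> 0"
  interpret R: field "ring_of_type_algebra :: 'k ring" by (rule field_from_type_algebra)
  have "inverse x = inv\<^bsub>ring_of_type_algebra\<^esub> x"
    using x by (intro R.inv_unique') (simp_all add: ring_of_type_algebra_simps)
  then show ?thesis by simp
qed

lemma (in coeff_field) generate_field_fractions:
  assumes "u \<in> generate_field ring_of_type_algebra (insert x F)"
  shows "\<exists>p\<in>poly_over F. \<exists>q\<in>poly_over F. poly q x \<noteq> 0 \<and> u = poly p x / poly q x"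
  using assms
proof induction
  case one
  show ?case
    by (rule bexI[of _ 1], rule bexI[of _ 1]) (simp_all add: poly_over_1 ring_of_type_algebra_simps)
next
  case (incl h)
  have "\<exists>p\<in>poly_over F. poly p x = h"
  proof (cases "h = x")
    case True
    then show ?thesis
      by (intro bexI[of _ "[:0, 1:]"]) (auto simp: poly_over_pCons zero_mem one_mem poly_over_0)
  next
    case False
    then show ?thesis using incl
      by (intro bexI[of _ "[:h:]"]) (auto simp: poly_over_pCons poly_over_0)
  qed
  then obtain p where "p \<in> poly_over F" "poly p x = h" by blast
  then show ?case using poly_over_1 by (intro bexI[of _ p] bexI[of _ 1]) auto
next
  case (a_inv h)
  then obtain p q where "p \<in> poly_over F" "q \<in> poly_over F" "poly q x \<noteq> 0" "h = poly p x / poly q x" by blast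
  then show ?case
    by (intro bexI[of _ "- p"] bexI[of _ q]) (auto simp: ring_of_type_algebra_uminus poly_over_minus)
next
  case (m_inv h)
  then obtain p q where *: "p \<in> poly_over F" "q \<in> poly_over F" "poly q x \<noteq> 0" "h = poly p x / poly q x" by blast
  have "h \<noteq> 0" using m_inv by (simp add: ring_of_type_algebra_simps)
  then show ?case using *
    by (intro bexI[of _ q] bexI[of _ p]) (auto simp: inv_ring_of_type_algebra)
next
  case (eng_add h k)
  then obtain p q p' q' where *: "p \<in> poly_over F" "q \<in> poly_over F" "poly q x \<noteq> 0" "h = poly p x / poly q x"
    "p' \<in> poly_over F" "q' \<in> poly_over F" "poly q' x \<noteq> 0" "k = poly p' x / poly q' x" by blast
  then show ?case
    by (intro bexI[of _ "p * q' + p' * q"] bexI[of _ "q * q'"])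
      (auto simp: ring_of_type_algebra_simps poly_over_mult poly_over_add add_frac_eq)
next
  case (eng_mult h k)
  then obtain p q p' q' where *: "p \<in> poly_over F" "q \<in> poly_over F" "poly q x \<noteq> 0" "h = poly p x / poly q x"
    "p' \<in> poly_over F" "q' \<in> poly_over F" "poly q' x \<noteq> 0" "k = poly p' x / poly q' x" by blast
  then show ?case
    by (intro bexI[of _ "p * p'"] bexI[of _ "q * q'"])
      (auto simp: ring_of_type_algebra_simps poly_over_mult)
qed

text \<open>\<open>dimension\<close> adjoins one vector at a time and \<open>e\<close> collects
  these vectors. Each step multiplies the old denominator by that of the new coefficient. Spanning
  with cleared denominators is the form in which \<open>dependent\<close> counts.\<close>

lemma (in coeff_field) dimension_fractions:
  assumes "ring.dimension ring_of_type_algebra N (generate_field ring_of_type_algebra (insert x F)) E"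
  shows "\<exists>e. \<forall>u\<in>E. \<exists>q p. q \<in> poly_over F \<and> poly q x \<noteq> 0 \<and> (\<forall>i<N. p i \<in> poly_over F) \<and>
    poly q x * u = (\<Sum>i<N. poly (p i) x * e i)"
  using assms
proof (induction N "generate_field ring_of_type_algebra (insert x F)" E
    rule: ring.dimension.induct[OF ring_from_type_algebra, consumes 1])
  case 1
  show ?case
    using poly_over_1 by (auto simp: ring_of_type_algebra_simps intro!: exI[of _ 1])
next
  case (2 w E n)
  interpret R: ring "ring_of_type_algebra :: 'k ring" by (rule ring_from_type_algebra)
  obtain e where e: "\<And>u. u \<in> E \<Longrightarrow> \<exists>q p. q \<in> poly_over F \<and> poly q x \<noteq> 0 \<and> (\<forall>i<n. p i \<in> poly_over F) \<and>
    poly q x * u = (\<Sum>i<n. poly (p i) x * e i)"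
    using 2 by blast
  show ?case
  proof (intro exI[of _ "e(n := w)"] ballI)
    fix u assume "u \<in> R.line_extension (generate_field ring_of_type_algebra (insert x F)) w E"
    then obtain k u' where k: "k \<in> generate_field ring_of_type_algebra (insert x F)" "u' \<in> E" "u = k * w + u'"
      by (auto simp: R.line_extension_def set_add_def' r_coset_def ring_of_type_algebra_simps)
    obtain s t where st: "s \<in> poly_over F" "t \<in> poly_over F" "poly t x \<noteq> 0" "k = poly s x / poly t x"
      using generate_field_fractions[OF k(1)] by blast
    obtain q p where qp: "q \<in> poly_over F" "poly q x \<noteq> 0" "\<And>i. i < n \<Longrightarrow> p i \<in> poly_over F"
      "poly q x * u' = (\<Sum>i<n. poly (p i) x * e i)"
      using e[OF k(2)] by blast
    define p' where "p' i = (if i = n then q * s else t * p i)" for i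
    have "poly (q * t) x * u = poly q x * poly s x * w + poly t x * (poly q x * u')"
      using st(3) by (simp add: k(3) st(4) field_simps)
    also have "\<dots> = (\<Sum>i<Suc n. poly (p' i) x * (e(n := w)) i)"
      unfolding qp(4) by (simp add: p'_def sum_distrib_left mult.assoc)
    finally have "poly (q * t) x * u = (\<Sum>i<Suc n. poly (p' i) x * (e(n := w)) i)" .
    moreover have "\<forall>i<Suc n. p' i \<in> poly_over F"
      using st qp by (auto simp: p'_def less_Suc_eq intro: poly_over_mult)
    ultimately show "\<exists>q p. q \<in> poly_over F \<and> poly q x \<noteq> 0 \<and> (\<forall>i<Suc n. p i \<in> poly_over F) \<and>
        poly q x * u = (\<Sum>i<Suc n. poly (p i) x * (e(n := w)) i)"
      using st qp poly_over_mult by (intro exI[of _ "q * t"] exI[of _ p']) auto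
  qed
qed

text \<open>The algebraic polynomials are coefficient lists with the leading coefficient first,
  hence \<open>rev\<close>.\<close>

lemma eval_ring_of_type_algebra:
  "ring.eval ring_of_type_algebra l x = poly (Poly (rev l)) (x :: 'k::field)"
proof -
  interpret R: ring "ring_of_type_algebra :: 'k ring" by (rule ring_from_type_algebra)
  have pow: "x [^]\<^bsub>ring_of_type_algebra\<^esub> m = x ^ m" for m :: nat
    by (induction m) (simp_all add: ring_of_type_algebra_simps mult.commute)
  show ?thesis
    by (induction l) (simp_all add: ring_of_type_algebra_simps Poly_append pow poly_monom mult.commute)
qed

section \<open>Linear dependence over the polynomials in one element\<close>

locale finite_function_field = coeff_field F for F :: "'k::field set" +
  assumes finite_F: "finite F" and function_field_F: "function_field F"
begin

text \<open>The last clause of \<open>function_field\<close> makes every \<open>y\<close> outside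
  \<open>F\<close> transcendental. Transcendence is injectivity of evaluation, used here for the
  coefficient list of \<open>p\<close> and the empty list.\<close>

lemma transcendental_root:
  assumes "y \<notin> F" "p \<in> poly_over F" "poly p y = 0"
  shows "p = 0"
proof -
  let ?R = "ring_of_type_algebra :: 'k ring"
  interpret R: ring ?R by (rule ring_from_type_algebra)
  have "ring.transcendental ?R F y" using function_field_F assms(1) by (auto simp: function_field_def)
  then have inj: "inj_on (\<lambda>l. R.eval l y) (carrier (F [X]\<^bsub>?R\<^esub>))" by (simp add: R.transcendental_def)
  have "polynomial\<^bsub>?R\<^esub> F (rev (coeffs p))"
  proof (cases "p = 0")
    case False
    then have "set (rev (coeffs p)) \<subseteq> F" using assms(2) by (auto simp: coeffs_def poly_over_def)
    moreover have "hd (rev (coeffs p)) \<noteq> 0" using False by (simp add: hd_rev last_coeffs_eq_coeff_degree)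
    ultimately show ?thesis unfolding polynomial_def by (simp add: ring_of_type_algebra_simps)
  qed (simp add: polynomial_def)
  then have 1: "rev (coeffs p) \<in> carrier (F [X]\<^bsub>?R\<^esub>)" by (simp add: univ_poly_carrier)
  have 2: "[] \<in> carrier (F [X]\<^bsub>?R\<^esub>)" by (simp add: univ_poly_carrier[symmetric] polynomial_def)
  have "R.eval (rev (coeffs p)) y = R.eval [] y"
    using assms(3) by (simp add: eval_ring_of_type_algebra ring_of_type_algebra_simps)
  then show ?thesis using inj_onD[OF inj _ 1 2] by simp
qed

lemma card_F: "card F \<ge> 2"
proof -
  have "card {0, 1 :: 'k} \<le> card F" using finite_F zero_mem one_mem by (intro card_mono) auto
  then show ?thesis by simp
qed

lemma basis:
  "\<exists>x N e. \<forall>u. \<exists>q p. q \<in> poly_over F \<and> poly q x \<noteq> 0 \<and> (\<forall>i<N. p i \<in> poly_over F) \<and>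
    poly q x * u = (\<Sum>i<N::nat. poly (p i) x * e i)"
proof -
  interpret R: ring "ring_of_type_algebra :: 'k ring" by (rule ring_from_type_algebra)
  obtain x where "R.finite_dimension (generate_field ring_of_type_algebra (insert x F)) UNIV"
    using function_field_F unfolding function_field_def by blast
  then obtain N where "R.dimension N (generate_field ring_of_type_algebra (insert x F)) UNIV"
    unfolding R.finite_dimension_def by blast
  from dimension_fractions[OF this] show ?thesis by blast
qed

text \<open>
  Pigeonhole: the products of the \<open>u i\<close> with polynomials in \<open>y\<close> of degree less than \<open>\<beta>\<close> lie, up to a
  common denominator, among the combinations of the basis \<open>e\<close> with coefficients of degree less than
  \<open>\<beta> * c + d\<close>, and for large \<open>\<beta>\<close> there are fewer of those when \<open>M = N * c\<close>.
\<close>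

lemma dependent:
  "\<exists>M. \<forall>u. \<exists>p. (\<forall>i\<le>M. p i \<in> poly_over F) \<and> (\<exists>i\<le>M. p i \<noteq> 0) \<and> (\<Sum>i\<le>M::nat. poly (p i) y * u i) = 0"
proof -
  obtain x N e where fr: "\<forall>u. \<exists>q p. q \<in> poly_over F \<and> poly q x \<noteq> 0 \<and> (\<forall>i<N. p i \<in> poly_over F) \<and>
    poly q x * u = (\<Sum>i<N::nat. poly (p i) x * e i)" using basis by (elim exE) (rule that)
  \<comment> \<open>Finitely many elements get one denominator, the product \<open>Q\<close> of
    their own, and one degree bound \<open>d\<close>.\<close>
  have common: "\<exists>q d P. q \<in> polys d \<and> poly q x \<noteq> 0 \<and> (\<forall>j\<in>I. \<forall>i<N. P j i \<in> polys d) \<and>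
     (\<forall>j\<in>I. poly q x * u j = (\<Sum>i<N. poly (P j i) x * e i))" if fin: "finite I" for I :: "nat set" and u
  proof -
    obtain q P where qP: "\<And>j. q j \<in> poly_over F" "\<And>j. poly (q j) x \<noteq> 0"
      "\<And>j i. i < N \<Longrightarrow> P j i \<in> poly_over F" "\<And>j. poly (q j) x * u j = (\<Sum>i<N. poly (P j i) x * e i)"
    proof -
      have "\<forall>j. \<exists>qp. fst qp \<in> poly_over F \<and> poly (fst qp) x \<noteq> 0 \<and> (\<forall>i<N. snd qp i \<in> poly_over F) \<and>
          poly (fst qp) x * u j = (\<Sum>i<N. poly (snd qp i) x * e i)"
        using fr by simp
      then obtain h where "\<forall>j. fst (h j) \<in> poly_over F \<and> poly (fst (h j)) x \<noteq> 0 \<and>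
          (\<forall>i<N. snd (h j) i \<in> poly_over F) \<and>
          poly (fst (h j)) x * u j = (\<Sum>i<N. poly (snd (h j) i) x * e i)"
        by (rule choice[THEN exE])
      then show ?thesis using that[of "\<lambda>j. fst (h j)" "\<lambda>j. snd (h j)"] by simp
    qed
    define Q where "Q = (\<Prod>j\<in>I. q j)"
    define P' where "P' j i = (\<Prod>l\<in>I - {j}. q l) * P j i" for j i
    have QF: "Q \<in> poly_over F" unfolding Q_def using qP by (intro poly_over_prod)
    have Q0: "poly Q x \<noteq> 0" unfolding Q_def poly_prod using qP fin by simp
    have P'F: "P' j i \<in> poly_over F" if "i < N" for j i
      unfolding P'_def using qP that by (intro poly_over_mult poly_over_prod) auto
    have eq: "poly Q x * u j = (\<Sum>i<N. poly (P' j i) x * e i)" if "j \<in> I" for j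
    proof -
      have "poly Q x * u j = poly (\<Prod>l\<in>I - {j}. q l) x * (poly (q j) x * u j)"
        unfolding Q_def using fin that by (simp add: prod.remove mult_ac)
      also have "\<dots> = (\<Sum>i<N. poly (P' j i) x * e i)"
        unfolding qP(4) by (simp add: P'_def sum_distrib_left mult.assoc)
      finally show ?thesis .
    qed
    let ?S = "insert Q ((\<lambda>(j, i). P' j i) ` (I \<times> {..<N}))"
    have "\<exists>d. \<forall>p\<in>?S. p \<in> polys d"
      using fin QF P'F by (intro polys_common) auto
    then obtain d where d: "\<And>p. p \<in> ?S \<Longrightarrow> p \<in> polys d" by blast
    have "P' j i \<in> polys d" if "j \<in> I" "i < N" for j i
      using that by (intro d) auto
    then show ?thesis
      using d[of Q] Q0 eq by (intro exI[of _ Q] exI[of _ d] exI[of _ P']) simp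
  qed
  \<comment> \<open>\<open>P\<close> with denominator \<open>q\<close> is the matrix of
    multiplication by \<open>y\<close> on the generators \<open>e\<close>. Its degree bound
    \<open>c\<close> determines \<open>M\<close>, which is why \<open>M\<close> can be chosen before
    \<open>u\<close>.\<close>
  obtain q c P where q: "q \<in> polys c" "poly q x \<noteq> 0" "\<forall>j\<in>{..<N}. \<forall>i<N. P j i \<in> polys c"
    "\<forall>j\<in>{..<N}. poly q x * (y * e j) = (\<Sum>i<N. poly (P j i) x * e i)"
    using common[OF finite_lessThan, of N "\<lambda>j. y * e j"] by (elim exE conjE) (rule that)
  define L where "L d = (\<lambda>f. \<Sum>i<N. poly (f i) x * e i) ` ({..<N} \<rightarrow>\<^sub>E polys d)" for d
  have LI: "(\<Sum>i<N. poly (f i) x * e i) \<in> L d" if "\<And>i. i < N \<Longrightarrow> f i \<in> polys d" for f d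
  proof -
    have "(\<Sum>i<N. poly (f i) x * e i) = (\<Sum>i<N. poly (restrict f {..<N} i) x * e i)"
      by (intro sum.cong) auto
    then show ?thesis unfolding L_def using that by (intro image_eqI[of _ _ "restrict f {..<N}"]) auto
  qed
  have LE: "\<exists>f. (\<forall>i<N. f i \<in> polys d) \<and> z = (\<Sum>i<N. poly (f i) x * e i)" if "z \<in> L d" for z d
    using that unfolding L_def by (auto simp: PiE_iff)
  have finL: "finite (L d)" and cardL: "card (L d) \<le> card F ^ (d * N)" for d
  proof -
    have fin: "finite ({..<N} \<rightarrow>\<^sub>E polys d)" using card_polys[OF finite_F] by (intro finite_PiE) auto
    then show "finite (L d)" unfolding L_def by simp
    have "card (L d) \<le> card ({..<N} \<rightarrow>\<^sub>E polys d)" unfolding L_def using fin by (rule card_image_le)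
    also have "\<dots> = card F ^ (d * N)"
      by (simp add: card_PiE card_polys[OF finite_F] power_mult)
    finally show "card (L d) \<le> card F ^ (d * N)" .
  qed
  have Ladd: "z + z' \<in> L d" if z: "z \<in> L d" "z' \<in> L d" for z z' d
  proof -
    obtain f where "\<forall>i<N. f i \<in> polys d" "z = (\<Sum>i<N. poly (f i) x * e i)"
      using LE[OF z(1)] by blast
    moreover obtain f' where "\<forall>i<N. f' i \<in> polys d" "z' = (\<Sum>i<N. poly (f' i) x * e i)"
      using LE[OF z(2)] by blast
    ultimately show ?thesis using LI[of "\<lambda>i. f i + f' i" d]
      by (simp add: polys_add sum.distrib algebra_simps)
  qed
  have Lsmult: "k * z \<in> L d" if z: "z \<in> L d" "k \<in> F" for z k d
  proof -
    obtain f where "\<forall>i<N. f i \<in> polys d" "z = (\<Sum>i<N. poly (f i) x * e i)" using LE[OF z(1)] by blast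
    then show ?thesis using LI[of "\<lambda>i. smult k (f i)" d] z(2)
      by (simp add: polys_smult sum_distrib_left mult.assoc)
  qed
  have L0: "0 \<in> L d" for d using LI[of "\<lambda>i. 0" d] by (simp add: polys_0)
  have Lsum: "(\<And>i. i \<in> I \<Longrightarrow> h i \<in> L d) \<Longrightarrow> sum h I \<in> L d" for h :: "nat \<Rightarrow> 'k" and I d
    by (induction I rule: infinite_finite_induct) (auto intro: L0 Ladd)
  have Lq: "poly q x * z \<in> L (c + d)" if z: "z \<in> L d" for z d
  proof -
    obtain f where "\<forall>i<N. f i \<in> polys d" "z = (\<Sum>i<N. poly (f i) x * e i)" using LE[OF z] by blast
    then show ?thesis using LI[of "\<lambda>i. q * f i" "c + d"] q(1)
      by (simp add: polys_mult sum_distrib_left mult.assoc)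
  qed
  have Ly: "poly q x * (y * z) \<in> L (c + d)" if z: "z \<in> L d" for z d
  proof -
    obtain f where f: "\<forall>i<N. f i \<in> polys d" "z = (\<Sum>i<N. poly (f i) x * e i)" using LE[OF z] by blast
    have "poly q x * (y * z) = (\<Sum>j<N. poly (f j) x * (poly q x * (y * e j)))"
      unfolding f(2) by (simp add: sum_distrib_left mult_ac)
    also have "\<dots> = (\<Sum>j<N. \<Sum>i<N. poly (P j i * f j) x * e i)"
      using q(4) by (intro sum.cong) (simp_all add: sum_distrib_left mult_ac)
    also have "\<dots> \<in> L (c + d)"
      using q(3) f(1) by (intro Lsum LI) (auto intro: polys_mult)
    finally show ?thesis .
  qed
  \<comment> \<open>Each factor \<open>y\<close> costs one \<open>q\<close> and raises the degree
    bound by \<open>c\<close>. Spare factors of \<open>q\<close> are charged the same, so that all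
    \<open>b \<le> \<beta>\<close> share one target.\<close>
  have Lpow: "poly q x ^ \<beta> * (y ^ b * z) \<in> L (\<beta> * c + d)" if z: "z \<in> L d" and "b \<le> \<beta>" for z d b \<beta>
    using that(2)
  proof (induction \<beta> arbitrary: b)
    case 0
    then show ?case using z by simp
  next
    case (Suc \<beta>)
    show ?case
    proof (cases "b = Suc \<beta>")
      case True
      then show ?thesis using Ly[OF Suc.IH[of \<beta>]] by (simp add: mult_ac add_ac)
    next
      case False
      then show ?thesis using Lq[OF Suc.IH[of b]] Suc.prems by (simp add: mult_ac add_ac)
    qed
  qed
  define M where "M = N * c"
  have "\<exists>p. (\<forall>i\<le>M. p i \<in> poly_over F) \<and> (\<exists>i\<le>M. p i \<noteq> 0) \<and> (\<Sum>i\<le>M. poly (p i) y * u i) = 0" for u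
  proof -
    obtain r d R where r: "r \<in> polys d" "poly r x \<noteq> 0" "\<forall>j\<in>{..M}. \<forall>i<N. R j i \<in> polys d"
      "\<forall>j\<in>{..M}. poly r x * u j = (\<Sum>i<N. poly (R j i) x * e i)"
      using common[OF finite_atMost, of M u] by (elim exE conjE) (rule that)
    have ru: "poly r x * u j \<in> L d" if "j \<le> M" for j using r(3,4) that LI by simp
    \<comment> \<open>The inequality \<open>(\<beta> * c + d) * N < \<beta> * (N * c + 1)\<close>
      needed for the pigeonhole amounts to \<open>d * N < \<beta>\<close>.\<close>
    define \<beta> where "\<beta> = Suc (d * N)"
    define T where "T = poly q x ^ \<beta> * poly r x"
    have T: "T \<noteq> 0" using q r by (simp add: T_def)
    define V where "V f = T * (\<Sum>i\<le>M. poly (f i) y * u i)" for f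
    have VL: "V f \<in> L (\<beta> * c + d)" if f: "f \<in> {..M} \<rightarrow>\<^sub>E polys \<beta>" for f
    proof -
      have "poly (f i) y = (\<Sum>b<\<beta>. Polynomial.coeff (f i) b * y ^ b)" if "i \<le> M" for i
      proof -
        have fi: "f i \<in> polys \<beta>" using f that by auto
        have "Polynomial.coeff (f i) b = 0" if "b \<ge> \<beta>" for b using fi that by (simp add: polys_def)
        moreover have "Polynomial.coeff (f i) b = 0" if "b > Polynomial.degree (f i)" for b
          using that by (rule coeff_eq_0)
        ultimately show ?thesis unfolding poly_altdef
          by (intro sum.mono_neutral_cong) (auto simp: not_le not_less)
      qed
      then have "V f = (\<Sum>i\<le>M. \<Sum>b<\<beta>. Polynomial.coeff (f i) b * (poly q x ^ \<beta> * (y ^ b * (poly r x * u i))))"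
        unfolding V_def T_def by (simp add: sum_distrib_left sum_distrib_right mult_ac)
      also have "\<dots> \<in> L (\<beta> * c + d)"
      proof (rule Lsum, rule Lsum)
        fix i b assume ib: "i \<in> {..M}" "b \<in> {..<\<beta>}"
        then have "poly q x ^ \<beta> * (y ^ b * (poly r x * u i)) \<in> L (\<beta> * c + d)"
          by (intro Lpow ru) auto
        moreover have "Polynomial.coeff (f i) b \<in> F"
          using f ib by (auto simp: polys_def poly_over_def PiE_iff)
        ultimately show "Polynomial.coeff (f i) b * (poly q x ^ \<beta> * (y ^ b * (poly r x * u i))) \<in> L (\<beta> * c + d)"
          by (rule Lsmult)
      qed
      finally show ?thesis .
    qed
    have "card (L (\<beta> * c + d)) < card ({..M} \<rightarrow>\<^sub>E polys \<beta>)"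
    proof -
      have "(\<beta> * c + d) * N < \<beta> * Suc M" by (simp add: \<beta>_def M_def algebra_simps)
      then have "card F ^ ((\<beta> * c + d) * N) < card F ^ (\<beta> * Suc M)"
        using card_F by (intro power_strict_increasing) auto
      also have "\<dots> = card ({..M} \<rightarrow>\<^sub>E polys \<beta>)"
        by (simp add: card_PiE card_polys[OF finite_F] power_mult del: power_Suc mult_Suc_right)
      finally show ?thesis using cardL[of "\<beta> * c + d"] by simp
    qed
    then have "\<not> inj_on V ({..M} \<rightarrow>\<^sub>E polys \<beta>)"
    proof (intro pigeonhole)
      have "card (V ` ({..M} \<rightarrow>\<^sub>E polys \<beta>)) \<le> card (L (\<beta> * c + d))"
        using VL finL by (intro card_mono) auto
      with \<open>card (L (\<beta> * c + d)) < _\<close> show "card (V ` ({..M} \<rightarrow>\<^sub>E polys \<beta>)) < card ({..M} \<rightarrow>\<^sub>E polys \<beta>)"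
        by simp
    qed
    then obtain f g where fg: "f \<in> {..M} \<rightarrow>\<^sub>E polys \<beta>" "g \<in> {..M} \<rightarrow>\<^sub>E polys \<beta>" "V f = V g" "f \<noteq> g"
      unfolding inj_on_def by blast
    have "\<exists>i\<le>M. f i \<noteq> g i" using fg by (metis PiE_ext atMost_iff)
    moreover have "(\<Sum>i\<le>M. poly (f i - g i) y * u i) = 0"
      using fg(3) T by (simp add: V_def algebra_simps sum_subtractf)
    moreover have "f i - g i \<in> poly_over F" if "i \<le> M" for i
      using fg(1,2) that by (intro poly_over_diff) (auto simp: PiE_iff polys_def)
    ultimately show ?thesis by (intro exI[of _ "\<lambda>i. f i - g i"]) auto
  qed
  then show ?thesis by blast
qed

end

section \<open>Existence of places\<close>

locale valuation_subring = field_subring V for V :: "'k::field set" +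
  assumes total: "z \<in> V \<or> inverse z \<in> V"
begin

definition nonunits :: "'k set" where
  "nonunits = {x. x = 0 \<or> inverse x \<notin> V}"

lemma nonunits_subset: "nonunits \<subseteq> V"
  using total zero_mem by (auto simp: nonunits_def)

lemma one_notin_nonunits: "1 \<notin> nonunits"
  by (simp add: nonunits_def one_mem)

lemma zero_in_nonunits: "0 \<in> nonunits"
  by (simp add: nonunits_def)

lemma nonunits_mult:
  assumes "x \<in> V" "y \<in> nonunits"
  shows "x * y \<in> nonunits"
proof (cases "x * y = 0")
  case False
  then have xy: "x * inverse (x * y) = inverse y" "y \<noteq> 0" by (auto simp: field_simps)
  have "inverse y \<in> V" if "inverse (x * y) \<in> V"
    using mult_mem[OF assms(1) that] unfolding xy(1) .
  then show ?thesis using xy(2) assms(2) by (auto simp: nonunits_def)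
qed (auto simp: zero_in_nonunits)

lemma nonunits_add:
  assumes "x \<in> nonunits" "y \<in> nonunits"
  shows "x + y \<in> nonunits"
proof -
  have *: "x + y \<in> nonunits" if "y \<in> nonunits" "y \<noteq> 0" "x / y \<in> V" for x y
  proof -
    have "x + y = (x / y + 1) * y" using that by (simp add: field_simps)
    then show ?thesis using nonunits_mult that add_mem one_mem by metis
  qed
  show ?thesis
  proof (cases "x = 0 \<or> y = 0")
    case False
    then show ?thesis
      using *[of y x] *[of x y] total[of "x / y"] assms by (auto simp: add.commute)
  qed (use assms in auto)
qed

lemma nonunits_diff: "x \<in> nonunits \<Longrightarrow> y \<in> nonunits \<Longrightarrow> x - y \<in> nonunits"
  using nonunits_add[of x "- 1 * y"] nonunits_mult[of "- 1" y] minus_mem[OF one_mem] by simp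

end

lemma valuation_ringD:
  assumes "valuation_ring F V"
  shows "valuation_subring V" "F \<subseteq> V" "V \<noteq> UNIV"
  using assms unfolding valuation_ring_def valuation_subring_def valuation_subring_axioms_def field_subring_iff
  by auto

text \<open>This supplies the place of a valuation ring. An ideal that contains the nonunits
  properly contains a unit, hence everything.\<close>

lemma valuation_ring_at_nonunits:
  fixes V :: "'k::field set"
  assumes "valuation_ring F V"
  shows "valuation_ring_at F {x. x = 0 \<or> inverse x \<notin> V} V"
proof -
  let ?R = "ring_of_type_algebra :: 'k ring"
  let ?S = "?R\<lparr>carrier := V\<rparr>"
  interpret V: valuation_subring V using valuation_ringD(1)[OF assms] .
  let ?M = "V.nonunits"
  have sub: "subring V ?R" using assms by (simp add: valuation_ring_def)
  interpret R: ring ?R by (rule ring_from_type_algebra)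
  interpret S: ring ?S by (rule R.subring_is_ring[OF sub])
  have uminus: "\<ominus>\<^bsub>?S\<^esub> x = - x" if "x \<in> V" for x
    using that V.minus_mem by (intro S.minus_equality) (auto simp: ring_of_type_algebra_simps)
  have ideal: "ideal ?M ?S"
  proof (rule idealI)
    show "ring ?S" by (rule S.ring_axioms)
    show "subgroup ?M (add_monoid ?S)"
    proof (rule S.add.subgroupI)
      show "?M \<noteq> {}" using V.zero_in_nonunits by blast
      show "\<ominus>\<^bsub>?S\<^esub> x \<in> ?M" if "x \<in> ?M" for x
        using that uminus V.nonunits_mult[of "- 1" x] V.minus_mem[OF V.one_mem] V.nonunits_subset by auto
    qed (use V.nonunits_add V.nonunits_subset in \<open>auto simp: ring_of_type_algebra_simps\<close>)
  next
    fix x y assume "x \<in> ?M" "y \<in> carrier ?S"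
    then have "y * x \<in> ?M" using V.nonunits_mult by simp
    then show "y \<otimes>\<^bsub>?S\<^esub> x \<in> ?M" "x \<otimes>\<^bsub>?S\<^esub> y \<in> ?M"
      by (simp_all add: ring_of_type_algebra_simps mult.commute)
  qed
  have "maximalideal ?M ?S"
  proof (rule maximalidealI[OF ideal])
    have "1 \<in> carrier ?S - ?M" using V.one_mem V.one_notin_nonunits by simp
    then show "carrier ?S \<noteq> ?M" by blast
    fix I assume I: "ideal I ?S" "?M \<subseteq> I" "I \<subseteq> carrier ?S"
    interpret I: ideal I ?S by (rule I(1))
    have "I = V" if "x \<in> I" "x \<notin> ?M" for x
    proof
      have "x \<noteq> 0" "inverse x \<in> V" using that(2) by (auto simp: V.nonunits_def)
      then have one: "1 \<in> I"
        using I.I_l_closed[OF that(1), of "inverse x"] by (simp add: ring_of_type_algebra_simps)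
      show "V \<subseteq> I"
      proof
        fix y assume "y \<in> V"
        then show "y \<in> I" using I.I_l_closed[OF one, of y] by (simp add: ring_of_type_algebra_simps)
      qed
    qed (use I in auto)
    then show "I = ?M \<or> I = carrier ?S" using I(2) by auto
  qed
  then show ?thesis using assms by (simp add: valuation_ring_at_def V.nonunits_def)
qed

text \<open>
  Chevalley's argument: a subring that is maximal among those containing \<open>1 / z\<close> but not \<open>z\<close> is a
  valuation ring.
\<close>

locale maximal_avoiding = field_subring V for V :: "'k::field set" +
  fixes z :: 'k
  assumes inverse_z: "inverse z \<in> V" and z_notin: "z \<notin> V"
    and maximal: "\<And>W. field_subring W \<Longrightarrow> V \<subseteq> W \<Longrightarrow> z \<notin> W \<Longrightarrow> W = V"
begin

lemma z_nonzero: "z \<noteq> 0"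
  using z_notin zero_mem by auto

text \<open>Inverting \<open>1 - r / z\<close> does not bring in \<open>z\<close>: each power of it
  has the form \<open>1 - s / z\<close> with \<open>s\<close> in \<open>V\<close>, so
  \<open>z = p / (1 - s / z)\<close> would give \<open>z = p + s\<close>. By maximality the
  localisation is \<open>V\<close> itself.\<close>

lemma unit:
  assumes "r \<in> V"
  shows "1 - inverse z * r \<noteq> 0" "inverse (1 - inverse z * r) \<in> V"
proof -
  let ?d = "1 - inverse z * r"
  show d: "?d \<noteq> 0"
  proof
    assume "?d = 0"
    then have "r = z" using z_nonzero by (simp add: field_simps)
    then show False using assms z_notin by simp
  qed
  have dV: "?d \<in> V" using assms inverse_z by (intro diff_mem one_mem mult_mem)
  have pow: "\<exists>s\<in>V. ?d ^ k = 1 - inverse z * s" for k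
  proof (induction k)
    case 0
    show ?case using zero_mem by force
  next
    case (Suc k)
    then obtain s where s: "s \<in> V" "?d ^ k = 1 - inverse z * s" by blast
    have "?d ^ Suc k = 1 - inverse z * (s + r - inverse z * r * s)"
      unfolding power_Suc s(2) by (simp add: algebra_simps)
    moreover have "s + r - inverse z * r * s \<in> V"
      using s assms inverse_z by (intro diff_mem add_mem mult_mem)
    ultimately show ?case by blast
  qed
  define W where "W = {p / ?d ^ k | p k. p \<in> V}"
  have WI: "p / ?d ^ k \<in> W" if "p \<in> V" for p k using that by (auto simp: W_def)
  have "field_subring W"
  proof
    show "1 \<in> W" using WI[of 1 0] one_mem by simp
    fix x assume "x \<in> W"
    then obtain p k where x: "p \<in> V" "x = p / ?d ^ k" by (auto simp: W_def)
    show "- x \<in> W" using WI[of "- p" k] minus_mem x by simp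
    fix y assume "y \<in> W"
    then obtain q l where y: "q \<in> V" "y = q / ?d ^ l" by (auto simp: W_def)
    have "x + y = (p * ?d ^ l + q * ?d ^ k) / ?d ^ (k + l)"
      unfolding x y using d by (simp add: add_frac_eq power_add)
    then show "x + y \<in> W" using WI x y dV by (simp add: add_mem mult_mem power_mem)
    have "x * y = p * q / ?d ^ (k + l)" unfolding x y by (simp add: power_add)
    then show "x * y \<in> W" using WI[OF mult_mem[OF x(1) y(1)]] by simp
  qed
  moreover have "V \<subseteq> W" using WI[of _ 0] by auto
  moreover have "z \<notin> W"
  proof
    assume "z \<in> W"
    then obtain p k where p: "p \<in> V" "z = p / ?d ^ k" by (auto simp: W_def)
    obtain s where s: "s \<in> V" "?d ^ k = 1 - inverse z * s" using pow by blast
    have "p = z * ?d ^ k" using p(2) power_not_zero[OF d] by (metis nonzero_eq_divide_eq)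
    then have "z = p + s" unfolding s(2) using z_nonzero by (simp add: algebra_simps)
    then show False using add_mem[OF p(1) s(1)] z_notin by simp
  qed
  ultimately have "W = V" by (rule maximal)
  then show "inverse ?d \<in> V" using WI[OF one_mem, of 1] by (simp add: divide_inverse)
qed

text \<open>The values at \<open>u\<close> of polynomials over \<open>V\<close> form a ring properly
  larger than \<open>V\<close>, so maximality puts \<open>z\<close> into it.\<close>

lemma poly_value:
  assumes "u \<notin> V"
  shows "\<exists>p\<in>poly_over V. poly p u = z"
proof -
  define W where "W = (\<lambda>p. poly p u) ` poly_over V"
  have WI: "poly p u \<in> W" if "p \<in> poly_over V" for p using that by (simp add: W_def)
  have "field_subring W"
  proof
    show "1 \<in> W" using WI[OF poly_over_1] by simp
    fix x assume "x \<in> W"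
    then obtain p where x: "p \<in> poly_over V" "x = poly p u" by (auto simp: W_def)
    show "- x \<in> W" using WI[OF poly_over_minus[OF x(1)]] x by simp
    fix y assume "y \<in> W"
    then obtain q where y: "q \<in> poly_over V" "y = poly q u" by (auto simp: W_def)
    show "x + y \<in> W" using WI[OF poly_over_add[OF x(1) y(1)]] x y by simp
    show "x * y \<in> W" using WI[OF poly_over_mult[OF x(1) y(1)]] x y by simp
  qed
  moreover have "V \<subseteq> W"
  proof
    fix x assume "x \<in> V"
    then show "x \<in> W" using WI[of "[:x:]"] by (simp add: poly_over_pCons poly_over_0)
  qed
  moreover have "u \<in> W" using WI[of "[:0, 1:]"] by (simp add: poly_over_pCons poly_over_0 zero_mem one_mem)
  ultimately have "z \<in> W" using maximal[of W] assms by blast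
  then show ?thesis by (auto simp: W_def)
qed

text \<open>
  If neither \<open>u\<close> nor \<open>inverse u\<close> is in \<open>V\<close>, then \<open>z\<close> is a polynomial in each of them; the one of
  smaller degree serves to lower the degree of the other.
\<close>

lemma lower_degree:
  assumes u: "u \<noteq> 0" and p: "p \<in> poly_over V" "poly p u = z"
    and q: "q \<in> poly_over V" "poly q (inverse u) = z"
    and deg: "Polynomial.degree q \<le> Polynomial.degree p"
  shows "\<exists>p'\<in>poly_over V. poly p' u = z \<and> Polynomial.degree p' < Polynomial.degree p"
proof -
  let ?m = "Polynomial.degree p" and ?l = "Polynomial.degree q"
  let ?w = "inverse z"
  let ?b = "Polynomial.coeff q" and ?a = "lead_coeff p"
  have coeffs: "?b j \<in> V" "?a \<in> V" for j using p q by (simp_all add: poly_over_def)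
  have m: "?m > 0"
  proof (rule ccontr)
    assume "\<not> ?m > 0"
    then have "poly p u = Polynomial.coeff p 0" by (simp add: poly_altdef)
    then show False using p z_notin by (simp add: poly_over_def)
  qed
  define t where "t = inverse (1 - ?w * ?b 0)"
  have t: "t \<in> V" "t * (1 - ?w * ?b 0) = 1" using unit[OF coeffs(1)[of 0]] by (simp_all add: t_def)
  have "z = ?b 0 + (\<Sum>j=1..?l. ?b j * inverse u ^ j)"
  proof -
    have "z = (\<Sum>j\<le>?l. ?b j * inverse u ^ j)" using q(2) by (simp add: poly_altdef)
    also have "{..?l} = insert 0 {1..?l}" by auto
    finally show ?thesis by simp
  qed
  then have "?w * z = ?w * ?b 0 + ?w * (\<Sum>j=1..?l. ?b j * inverse u ^ j)"
    by (simp add: distrib_left)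
  then have "1 - ?w * ?b 0 = ?w * (\<Sum>j=1..?l. ?b j * inverse u ^ j)"
    using z_nonzero by (simp add: diff_eq_eq add.commute)
  then have one: "t * (?w * (\<Sum>j=1..?l. ?b j * inverse u ^ j)) = 1" using t(2) by simp
  \<comment> \<open>Multiplying the expansion of one in powers of \<open>inverse u\<close> by the
    leading term of \<open>p\<close> gives a polynomial in \<open>u\<close> with the value of that
    term and smaller degree. By \<open>deg\<close> the subtraction \<open>?m - j\<close> is never
    truncated.\<close>
  define h where "h = (\<Sum>j=1..?l. Polynomial.monom (?a * (t * (?w * ?b j))) (?m - j))"
  have hV: "h \<in> poly_over V"
    unfolding h_def using coeffs t inverse_z by (intro poly_over_sum poly_over_monom mult_mem)
  have "poly h u = (\<Sum>j=1..?l. ?a * u ^ ?m * (t * (?w * (?b j * inverse u ^ j))))"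
    unfolding h_def poly_sum
  proof (rule sum.cong)
    fix j assume "j \<in> {1..?l}"
    then have "u ^ (?m - j) = u ^ ?m * inverse u ^ j"
      using deg u by (simp add: power_diff power_inverse divide_inverse)
    then show "poly (Polynomial.monom (?a * (t * (?w * ?b j))) (?m - j)) u =
        ?a * u ^ ?m * (t * (?w * (?b j * inverse u ^ j)))"
      by (simp add: poly_monom mult_ac)
  qed simp
  also have "\<dots> = ?a * u ^ ?m * (t * (?w * (\<Sum>j=1..?l. ?b j * inverse u ^ j)))"
    by (simp add: sum_distrib_left)
  finally have h: "poly h u = ?a * u ^ ?m" unfolding one by simp
  define p' where "p' = p - Polynomial.monom ?a ?m + h"
  have "p' \<in> poly_over V"
    unfolding p'_def using p hV coeffs by (intro poly_over_add poly_over_diff poly_over_monom)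
  moreover have "poly p' u = z" unfolding p'_def using p h by (simp add: poly_monom)
  moreover have "Polynomial.degree p' < ?m"
  proof -
    have "Polynomial.coeff p' i = 0" if "i \<ge> ?m" for i
    proof -
      have "Polynomial.coeff h i = 0" unfolding h_def coeff_sum using that m by (intro sum.neutral) auto
      moreover have "Polynomial.coeff p i = Polynomial.coeff (Polynomial.monom ?a ?m) i"
        using that by (cases "i = ?m") (auto simp: coeff_eq_0)
      ultimately show ?thesis by (simp add: p'_def)
    qed
    then have "Polynomial.degree p' \<le> ?m - 1" by (intro degree_le) auto
    then show ?thesis using m by simp
  qed
  ultimately show ?thesis by blast
qed

lemma total: "u \<in> V \<or> inverse u \<in> V"
proof (rule ccontr)
  assume "\<not> ?thesis"
  then have u: "u \<notin> V" "inverse u \<notin> V" by auto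
  then have u0: "u \<noteq> 0" "inverse u \<noteq> 0" using zero_mem by auto
  define P where "P x p \<longleftrightarrow> p \<in> poly_over V \<and> poly p x = z" for x p
  obtain p where p: "P u p" "\<And>p'. P u p' \<Longrightarrow> Polynomial.degree p \<le> Polynomial.degree p'"
    using poly_value[OF u(1)] ex_has_least_nat[of "P u" _ Polynomial.degree] unfolding P_def by blast
  obtain q where q: "P (inverse u) q" "\<And>q'. P (inverse u) q' \<Longrightarrow> Polynomial.degree q \<le> Polynomial.degree q'"
    using poly_value[OF u(2)] ex_has_least_nat[of "P (inverse u)" _ Polynomial.degree] unfolding P_def by blast
  show False
  proof (cases "Polynomial.degree q \<le> Polynomial.degree p")
    case True
    then show False using lower_degree[OF u0(1), of p q] p q unfolding P_def by (metis leD)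
  next
    case False
    then show False using lower_degree[OF u0(2), of q p] p q unfolding P_def
      by (metis inverse_inverse_eq leD nat_le_linear)
  qed
qed

end

context finite_function_field
begin

text \<open>Zorn's lemma is started at \<open>F[1 / z]\<close>. This ring avoids \<open>z\<close>,
  because \<open>z = p(1 / z)\<close> would make the transcendental element \<open>1 / z\<close> a
  root of \<open>X p - 1\<close>.\<close>

lemma exists_pole:
  assumes z: "z \<notin> F"
  shows "\<exists>P V. valuation_ring_at F P V \<and> z \<notin> V"
proof -
  let ?w = "inverse z"
  have wF: "?w \<notin> F" using z inverse_mem[of ?w] by auto
  have z0: "z \<noteq> 0" using z zero_mem by auto
  define \<S> where "\<S> = {S. field_subring S \<and> F \<subseteq> S \<and> ?w \<in> S \<and> z \<notin> S}"
  have base: "(\<lambda>p. poly p ?w) ` poly_over F \<in> \<S>"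
  proof -
    let ?B = "(\<lambda>p. poly p ?w) ` poly_over F"
    have BI: "poly p ?w \<in> ?B" if "p \<in> poly_over F" for p using that by simp
    have "field_subring ?B"
    proof
      show "1 \<in> ?B" using BI[OF poly_over_1] by simp
      fix x assume "x \<in> ?B"
      then obtain p where x: "p \<in> poly_over F" "x = poly p ?w" by auto
      show "- x \<in> ?B" using BI[OF poly_over_minus[OF x(1)]] x by simp
      fix y assume "y \<in> ?B"
      then obtain q where y: "q \<in> poly_over F" "y = poly q ?w" by auto
      show "x + y \<in> ?B" using BI[OF poly_over_add[OF x(1) y(1)]] x y by simp
      show "x * y \<in> ?B" using BI[OF poly_over_mult[OF x(1) y(1)]] x y by simp
    qed
    moreover have "F \<subseteq> ?B"
    proof
      fix x assume "x \<in> F"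
      then show "x \<in> ?B" using BI[of "[:x:]"] by (simp add: poly_over_pCons poly_over_0)
    qed
    moreover have "?w \<in> ?B" using BI[of "[:0, 1:]"] by (simp add: poly_over_pCons poly_over_0 zero_mem one_mem)
    moreover have "z \<notin> ?B"
    proof
      assume "z \<in> ?B"
      then obtain p where p: "p \<in> poly_over F" "z = poly p ?w" by auto
      have "poly (pCons 0 p - 1) ?w = 0" using p(2)[symmetric] z0 by simp
      moreover have "pCons 0 p - 1 \<in> poly_over F"
        using p(1) by (intro poly_over_diff poly_over_1) (simp add: poly_over_pCons zero_mem)
      ultimately have "pCons 0 p - 1 = 0" using transcendental_root[OF wF] by blast
      then have "Polynomial.coeff (pCons 0 p) 0 = Polynomial.coeff 1 0" by simp
      then show False by simp
    qed
    ultimately show ?thesis by (simp add: \<S>_def)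
  qed
  have "\<Union>C \<in> \<S>" if C: "C \<noteq> {}" "subset.chain \<S> C" for C
  proof -
    have CS: "\<And>S. S \<in> C \<Longrightarrow> S \<in> \<S>" and lin: "\<And>S T. S \<in> C \<Longrightarrow> T \<in> C \<Longrightarrow> S \<subseteq> T \<or> T \<subseteq> S"
      using C(2) by (auto simp: subset_chain_def)
    have ring: "field_subring S" if "S \<in> C" for S using CS[OF that] by (simp add: \<S>_def)
    obtain S0 where S0: "S0 \<in> C" using C(1) by auto
    have "field_subring (\<Union>C)"
    proof
      show "1 \<in> \<Union>C" using S0 field_subring.one_mem[OF ring] by blast
      fix x assume x: "x \<in> \<Union>C"
      then show "- x \<in> \<Union>C" using field_subring.minus_mem[OF ring] by blast
      fix y assume "y \<in> \<Union>C"
      then obtain S where S: "S \<in> C" "x \<in> S" "y \<in> S" using x lin by blast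
      then show "x + y \<in> \<Union>C" "x * y \<in> \<Union>C"
        using field_subring.add_mem[OF ring] field_subring.mult_mem[OF ring] by blast+
    qed
    moreover have "F \<subseteq> \<Union>C" "?w \<in> \<Union>C" "z \<notin> \<Union>C" using S0 CS by (auto simp: \<S>_def)
    ultimately show ?thesis by (simp add: \<S>_def)
  qed
  then obtain V where V: "V \<in> \<S>" "\<And>W. W \<in> \<S> \<Longrightarrow> V \<subseteq> W \<Longrightarrow> W = V"
    using subset_Zorn_nonempty[of \<S>] base by blast
  have ma: "maximal_avoiding V z"
    using V unfolding maximal_avoiding_def maximal_avoiding_axioms_def \<S>_def by blast
  have "valuation_ring F V"
    unfolding valuation_ring_def
  proof (intro conjI allI)
    show "subring V ring_of_type_algebra" using V(1) by (simp add: \<S>_def field_subring_iff)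
    show "F \<subset> V" using V(1) wF by (auto simp: \<S>_def)
    show "V \<subset> UNIV" using V(1) by (auto simp: \<S>_def)
    show "u \<in> V \<or> inverse u \<in> V" for u by (rule maximal_avoiding.total[OF ma])
  qed
  then show ?thesis using valuation_ring_at_nonunits V(1) by (auto simp: \<S>_def)
qed

end

section \<open>The valuation of a place\<close>

locale constant_valuation_ring = finite_function_field F + V: valuation_subring V
  for F V :: "'k::field set" +
  assumes constants: "F \<subseteq> V" and proper: "V \<noteq> UNIV"
begin

lemma poly_over_mem: "p \<in> poly_over F \<Longrightarrow> x \<in> V \<Longrightarrow> poly p x \<in> V"
  using poly_mem[OF V.field_subring_axioms constants] .

text \<open>A relation over \<open>F[\<omega>]\<close> is divided by the largest power of
  \<open>\<omega>\<close> common to its coefficients; the constant terms that remain form a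
  nontrivial relation over \<open>F\<close> modulo \<open>\<omega>\<close>.\<close>

lemma residue_dependent:
  assumes \<omega>: "\<omega> \<in> V.nonunits" "\<omega> \<noteq> 0"
  shows "\<exists>M. \<forall>u. (\<forall>i\<le>M. u i \<in> V) \<longrightarrow>
    (\<exists>k. (\<forall>i\<le>M. k i \<in> F) \<and> (\<exists>i\<le>M::nat. k i \<noteq> 0) \<and> (\<exists>s\<in>V. (\<Sum>i\<le>M. k i * u i) = \<omega> * s))"
proof -
  have \<omega>V: "\<omega> \<in> V" using \<omega> V.nonunits_subset by blast
  obtain M where M: "\<forall>u. \<exists>p. (\<forall>i\<le>M. p i \<in> poly_over F) \<and> (\<exists>i\<le>M. p i \<noteq> 0) \<and>
      (\<Sum>i\<le>M::nat. poly (p i) \<omega> * u i) = 0"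
    using dependent by blast
  have "\<exists>k. (\<forall>i\<le>M. k i \<in> F) \<and> (\<exists>i\<le>M. k i \<noteq> 0) \<and> (\<exists>s\<in>V. (\<Sum>i\<le>M. k i * u i) = \<omega> * s)"
    if u: "\<forall>i\<le>M. u i \<in> V" for u
  proof -
    obtain p where p: "\<forall>i\<le>M. p i \<in> poly_over F" "\<exists>i\<le>M. p i \<noteq> 0" "(\<Sum>i\<le>M. poly (p i) \<omega> * u i) = 0"
      using M by blast
    define t where "t = (LEAST t. \<exists>i\<le>M. Polynomial.coeff (p i) t \<noteq> 0)"
    have ex: "\<exists>t. \<exists>i\<le>M. Polynomial.coeff (p i) t \<noteq> 0" using p(2) by (metis leading_coeff_neq_0)
    have t: "\<exists>i\<le>M. Polynomial.coeff (p i) t \<noteq> 0" unfolding t_def using ex by (rule LeastI_ex)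
    have low: "Polynomial.coeff (p i) j = 0" if "i \<le> M" "j < t" for i j
      using not_less_Least[of j "\<lambda>t. \<exists>i\<le>M. Polynomial.coeff (p i) t \<noteq> 0"] that by (auto simp: t_def)
    have "\<exists>r. r \<in> poly_over F \<and> p i = Polynomial.monom 1 t * r \<and> Polynomial.coeff r 0 = Polynomial.coeff (p i) t"
      if "i \<le> M" for i
      using poly_over_shift[of "p i" t] p(1) low[OF that] that by metis
    then obtain r where r: "\<And>i. i \<le> M \<Longrightarrow> r i \<in> poly_over F"
      "\<And>i. i \<le> M \<Longrightarrow> p i = Polynomial.monom 1 t * r i"
      "\<And>i. i \<le> M \<Longrightarrow> Polynomial.coeff (r i) 0 = Polynomial.coeff (p i) t"
      by metis
    have "(\<Sum>i\<le>M. poly (p i) \<omega> * u i) = \<omega> ^ t * (\<Sum>i\<le>M. poly (r i) \<omega> * u i)"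
      by (simp add: r(2) sum_distrib_left poly_monom mult.assoc)
    then have zero: "(\<Sum>i\<le>M. poly (r i) \<omega> * u i) = 0" using p(3) \<omega> by simp
    have "\<exists>s\<in>V. poly (r i) \<omega> = Polynomial.coeff (r i) 0 + \<omega> * s" if "i \<le> M" for i
    proof -
      obtain c q where q: "r i = pCons c q" by (cases "r i")
      then have "q \<in> poly_over F" using r(1)[OF that] by (simp add: poly_over_pCons)
      then show ?thesis using poly_over_mem[OF _ \<omega>V] by (auto simp: q)
    qed
    then obtain s where s: "\<And>i. i \<le> M \<Longrightarrow> s i \<in> V"
      "\<And>i. i \<le> M \<Longrightarrow> poly (r i) \<omega> = Polynomial.coeff (r i) 0 + \<omega> * s i"
      by metis
    have "(\<Sum>i\<le>M. Polynomial.coeff (r i) 0 * u i) = (\<Sum>i\<le>M. poly (r i) \<omega> * u i) + \<omega> * (\<Sum>i\<le>M. - s i * u i)"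
      by (simp add: s(2) sum_distrib_left algebra_simps flip: sum.distrib)
    moreover have "(\<Sum>i\<le>M. - s i * u i) \<in> V"
      using s(1) u by (intro V.sum_mem V.mult_mem V.minus_mem) auto
    ultimately have "\<exists>s\<in>V. (\<Sum>i\<le>M. Polynomial.coeff (r i) 0 * u i) = \<omega> * s" using zero by auto
    moreover have "\<forall>i\<le>M. Polynomial.coeff (r i) 0 \<in> F" using r(1) by (simp add: poly_over_def)
    ultimately show ?thesis using t r(3) by (intro exI[of _ "\<lambda>i. Polynomial.coeff (r i) 0"]) auto
  qed
  then show ?thesis by blast
qed

text \<open>A maximal family that is independent modulo \<open>\<omega>\<close> spans
  \<open>V\<close> modulo \<open>\<omega>\<close>, and \<open>F\<close> is finite.\<close>

lemma residue_finite:
  assumes \<omega>: "\<omega> \<in> V.nonunits" "\<omega> \<noteq> 0"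
  shows "\<exists>B. finite B \<and> (\<forall>x\<in>V. \<exists>b\<in>B. \<exists>s\<in>V. x - b = \<omega> * s)"
proof -
  define indep where "indep r u \<longleftrightarrow> (\<forall>i<r. u i \<in> V) \<and>
    (\<forall>k. (\<forall>i<r. k i \<in> F) \<and> (\<exists>s\<in>V. (\<Sum>i<r. k i * u i) = \<omega> * s) \<longrightarrow> (\<forall>i<r. k i = 0))"
    for r :: nat and u :: "nat \<Rightarrow> 'k"
  obtain M where M: "\<forall>u. (\<forall>i\<le>M. u i \<in> V) \<longrightarrow>
    (\<exists>k. (\<forall>i\<le>M. k i \<in> F) \<and> (\<exists>i\<le>M::nat. k i \<noteq> 0) \<and> (\<exists>s\<in>V. (\<Sum>i\<le>M. k i * u i) = \<omega> * s))"
    using residue_dependent[OF \<omega>] by blast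
  have "\<not> indep (Suc M) u" for u
  proof
    assume "indep (Suc M) u"
    then have *: "\<forall>i\<le>M. u i \<in> V" "\<And>k. (\<forall>i\<le>M. k i \<in> F) \<Longrightarrow>
        (\<exists>s\<in>V. (\<Sum>i\<le>M. k i * u i) = \<omega> * s) \<Longrightarrow> (\<forall>i\<le>M. k i = 0)"
      unfolding indep_def less_Suc_eq_le lessThan_Suc_atMost by blast+
    then show False using M by blast
  qed
  moreover have "indep 0 u" for u by (simp add: indep_def)
  ultimately obtain r u where u: "indep r u" and max: "\<And>u. \<not> indep (Suc r) u"
    using ex_least_nat_less[of "\<lambda>r. \<forall>u. \<not> indep r u" "Suc M"] by blast
  define B where "B = (\<lambda>k. \<Sum>i<r. k i * u i) ` ({..<r} \<rightarrow>\<^sub>E F)"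
  have "\<exists>b\<in>B. \<exists>s\<in>V. x - b = \<omega> * s" if x: "x \<in> V" for x
  proof -
    have "\<forall>i<Suc r. (u(r := x)) i \<in> V" using u x by (auto simp: indep_def less_Suc_eq)
    then obtain k s where k: "\<forall>i<Suc r. k i \<in> F" "s \<in> V" "(\<Sum>i<Suc r. k i * (u(r := x)) i) = \<omega> * s"
      "\<exists>i<Suc r. k i \<noteq> 0"
      using max[of "u(r := x)"] unfolding indep_def by blast
    have sum: "(\<Sum>i<r. k i * u i) + k r * x = \<omega> * s" using k(3) by simp
    have kr: "k r \<noteq> 0"
    proof
      assume "k r = 0"
      then have "(\<Sum>i<r. k i * u i) = \<omega> * s" using sum by simp
      moreover have "\<forall>i<r. k i \<in> F" using k(1) by simp
      ultimately have "\<forall>i<r. k i = 0" using u k(2) unfolding indep_def by blast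
      then show False using k(4) \<open>k r = 0\<close> by (auto simp: less_Suc_eq)
    qed
    define h where "h = restrict (\<lambda>i. - (k i * inverse (k r))) {..<r}"
    have h: "h \<in> {..<r} \<rightarrow>\<^sub>E F"
      unfolding h_def using k(1) by (auto intro!: minus_mem mult_mem inverse_mem)
    have "(\<Sum>i<r. h i * u i) = - (\<Sum>i<r. k i * u i) * inverse (k r)"
      unfolding sum_distrib_right sum_negf[symmetric] by (intro sum.cong) (simp_all add: h_def)
    also have "\<dots> = x - \<omega> * (s * inverse (k r))"
      using sum kr by (simp add: field_simps)
    finally have "x - (\<Sum>i<r. h i * u i) = \<omega> * (s * inverse (k r))" by simp
    moreover have "s * inverse (k r) \<in> V" using k(1,2) constants inverse_mem by (intro V.mult_mem) auto
    ultimately show ?thesis using h unfolding B_def by blast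
  qed
  moreover have "finite B" unfolding B_def using finite_F by (intro finite_imageI finite_PiE) auto
  ultimately show ?thesis by blast
qed

text \<open>As \<open>V\<close> is finite modulo \<open>\<omega>\<close>, two of the
  \<open>f i\<close> agree there. Dividing \<open>f k - f l = \<omega> w\<close> by
  \<open>f l\<close> then makes one a nonunit if \<open>f k / f l\<close> is a nonunit. This yields
  both the uniformizer and the archimedean property.\<close>

lemma no_infinite_divisors:
  fixes f :: "nat \<Rightarrow> 'k"
  assumes \<omega>: "\<omega> \<noteq> 0"
    and div: "\<And>i. f i \<in> V" "\<And>i. f i \<noteq> 0" "\<And>i. \<omega> / f i \<in> V.nonunits"
    and chain: "\<And>i j. i < j \<Longrightarrow> f i / f j \<in> V.nonunits \<or> f j / f i \<in> V.nonunits"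
  shows False
proof -
  have "\<omega> = f 0 * (\<omega> / f 0)" using div(2) by simp
  then have "\<omega> \<in> V.nonunits" using V.nonunits_mult[OF div(1,3)] by metis
  then obtain B where B: "finite B" "\<forall>x\<in>V. \<exists>b\<in>B. \<exists>s\<in>V. x - b = \<omega> * s"
    using residue_finite \<omega> by blast
  then have "\<forall>i. \<exists>b. b \<in> B \<and> (\<exists>s\<in>V. f i - b = \<omega> * s)" using div(1) by blast
  then obtain b where "\<forall>i. b i \<in> B \<and> (\<exists>s\<in>V. f i - b i = \<omega> * s)" by (rule choice[THEN exE])
  then have b: "\<And>i. b i \<in> B" "\<And>i. \<exists>s\<in>V. f i - b i = \<omega> * s" by auto
  have "\<not> inj b"
    using b(1) finite_subset[OF _ B(1), of "range b"] by (auto dest: finite_imageD)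
  then obtain i j where ij: "i < j" "b i = b j" unfolding inj_def by (metis nat_neq_iff)
  obtain s t where st: "s \<in> V" "t \<in> V" "f i - b i = \<omega> * s" "f j - b j = \<omega> * t"
    using b(2)[of i] b(2)[of j] by blast
  have eq: "f i - f j = \<omega> * (s - t)" using st(3,4) ij(2) by (simp add: algebra_simps)
  have absurd: False if "f k / f l \<in> V.nonunits" "f k - f l = \<omega> * w" "w \<in> V" for k l w
  proof -
    have "1 = f k / f l - w * (\<omega> / f l)"
      using that(2) div(2)[of l] by (simp add: field_simps)
    moreover have "f k / f l - w * (\<omega> / f l) \<in> V.nonunits"
      using that div(3) by (intro V.nonunits_diff V.nonunits_mult)
    ultimately show False using V.one_notin_nonunits by simp
  qed
  have "f j - f i = \<omega> * (t - s)" using eq by (simp add: algebra_simps)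
  then have "f j / f i \<notin> V.nonunits" using absurd V.diff_mem[OF st(2,1)] by blast
  moreover have "f i / f j \<notin> V.nonunits" using absurd eq V.diff_mem[OF st(1,2)] by blast
  ultimately show False using chain[OF ij(1)] by blast
qed

text \<open>If the maximal ideal is not principal, every nonzero nonunit \<open>\<pi>\<close> has a
  nonunit divisor \<open>x\<close> with \<open>\<pi> / x\<close> again a nonunit. Iteration gives an
  infinite chain of divisors of \<open>inverse z\<close>.\<close>

lemma uniformizer: "\<exists>\<pi>\<in>V.nonunits. \<pi> \<noteq> 0 \<and> (\<forall>x\<in>V.nonunits. x / \<pi> \<in> V)"
proof (rule ccontr)
  assume "\<not> ?thesis"
  then have no: "\<forall>\<pi>\<in>V.nonunits. \<not> (\<pi> \<noteq> 0 \<and> (\<forall>x\<in>V.nonunits. x / \<pi> \<in> V))" by (simp only: bex_simps simp_thms)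
  obtain z where z: "z \<notin> V" using proper by blast
  then have \<omega>: "inverse z \<in> V.nonunits" "inverse z \<noteq> 0"
    using V.zero_mem by (auto simp: V.nonunits_def)
  have step: "\<exists>x. (x \<in> V.nonunits \<and> x \<noteq> 0) \<and> \<pi> / x \<in> V.nonunits" if "\<pi> \<in> V.nonunits \<and> \<pi> \<noteq> 0" for \<pi>
  proof -
    have "\<not> (\<forall>x\<in>V.nonunits. x / \<pi> \<in> V)" using bspec[OF no that[THEN conjunct1]] that by simp
    then obtain x where x: "x \<in> V.nonunits" "x / \<pi> \<notin> V" by auto
    have "x \<noteq> 0"
    proof
      assume "x = 0"
      then show False using x(2) V.zero_mem by simp
    qed
    moreover have "\<pi> / x \<in> V.nonunits" using x(2) by (simp add: V.nonunits_def)
    ultimately show ?thesis using x(1) by blast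
  qed
  obtain g where g: "g 0 = inverse z" "\<And>n. g n \<in> V.nonunits \<and> g n \<noteq> 0" "\<And>n. g n / g (Suc n) \<in> V.nonunits"
  proof -
    have "\<exists>g. g 0 = inverse z \<and> (\<forall>n. (g n \<in> V.nonunits \<and> g n \<noteq> 0) \<and> g n / g (Suc n) \<in> V.nonunits)"
    proof -
      have "\<exists>g. \<forall>n. ((g n \<in> V.nonunits \<and> g n \<noteq> 0) \<and> (n = 0 \<longrightarrow> g n = inverse z)) \<and> g n / g (Suc n) \<in> V.nonunits"
        using step \<omega> by (intro dependent_nat_choice) auto
      then show ?thesis by blast
    qed
    then show ?thesis using that by blast
  qed
  have lt: "g i / g j \<in> V.nonunits" if "i < j" for i j
    using that
  proof (induction j)
    case (Suc j)
    show ?case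
    proof (cases "i = j")
      case False
      then have "g i / g j \<in> V" using Suc V.nonunits_subset by auto
      from V.nonunits_mult[OF this g(3)[of j]] show ?thesis using g(2)[of j] by simp
    qed (use g(3) in simp)
  qed simp
  \<comment> \<open>The chain is used from index one on, because \<open>inverse z / g 0\<close> is
    one and so not a nonunit.\<close>
  show False
  proof (rule no_infinite_divisors[of "inverse z" "\<lambda>i. g (Suc i)"])
    show "inverse z / g (Suc i) \<in> V.nonunits" for i using lt[of 0 "Suc i"] g(1) by simp
    show "g (Suc i) / g (Suc j) \<in> V.nonunits \<or> g (Suc j) / g (Suc i) \<in> V.nonunits" if "i < j" for i j
      using lt[of "Suc i" "Suc j"] that by simp
    show "g (Suc i) \<in> V" "g (Suc i) \<noteq> 0" for i using g(2) V.nonunits_subset by blast+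
  qed (rule \<omega>(2))
qed

theorem exists_valuation: "\<exists>v. int_valuation v \<and> (\<forall>x. x \<noteq> 0 \<longrightarrow> (x \<in> V \<longleftrightarrow> 0 \<le> v x))"
proof -
  obtain \<pi> where \<pi>: "\<pi> \<in> V.nonunits" "\<pi> \<noteq> 0" "\<And>x. x \<in> V.nonunits \<Longrightarrow> x / \<pi> \<in> V"
    using uniformizer by blast
  have \<pi>V: "\<pi> \<in> V" using \<pi>(1) V.nonunits_subset by blast
  define unit where "unit x \<longleftrightarrow> x \<noteq> 0 \<and> x \<in> V \<and> inverse x \<in> V" for x
  have unit_mult: "unit (x * y)" if "unit x" "unit y" for x y
    using that V.mult_mem by (simp add: unit_def)
  have unit_inverse: "unit (inverse x)" if "unit x" for x using that by (simp add: unit_def)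
  have pow: "\<pi> ^ Suc k \<in> V.nonunits" for k
    using V.nonunits_mult[OF V.power_mem[OF \<pi>V] \<pi>(1), of k] by (simp add: mult.commute)
  have powi_V: "\<pi> powi k \<in> V \<longleftrightarrow> 0 \<le> k" for k
  proof (cases "0 \<le> k")
    case True
    then show ?thesis using V.power_mem[OF \<pi>V] by (simp add: power_int_def)
  next
    case False
    then obtain m where "nat (- k) = Suc m" by (metis Suc_pred not_le zero_less_nat_eq neg_0_less_iff_less)
    then show ?thesis using False pow[of m] \<pi>(2) by (auto simp: power_int_def V.nonunits_def power_inverse)
  qed
  \<comment> \<open>If all powers of \<open>\<pi>\<close> divided \<open>z\<close>, they would form
    an infinite chain of divisors of \<open>z\<close>.\<close>
  have archimedean: "\<exists>i. z / \<pi> ^ i \<notin> V" if z: "z \<noteq> 0" for z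
  proof (rule ccontr)
    assume "\<not> ?thesis"
    then have all: "z / \<pi> ^ i \<in> V" for i by blast
    show False
    proof (rule no_infinite_divisors[of z "\<lambda>i. \<pi> ^ i"])
      show "z / \<pi> ^ i \<in> V.nonunits" for i
        using V.nonunits_mult[OF all[of "Suc i"] \<pi>(1)] \<pi>(2) by simp
      fix i j :: nat assume "i < j"
      then obtain k where "j = i + Suc k" by (metis less_iff_Suc_add add_Suc_right)
      then have "\<pi> ^ j / \<pi> ^ i = \<pi> ^ Suc k" using \<pi>(2) by (simp add: power_add)
      then show "\<pi> ^ i / \<pi> ^ j \<in> V.nonunits \<or> \<pi> ^ j / \<pi> ^ i \<in> V.nonunits" using pow by metis
    qed (use z \<pi> V.power_mem[OF \<pi>V] in auto)
  qed
  have decomp_V: "\<exists>k. unit (z / \<pi> powi k)" if z: "z \<noteq> 0" "z \<in> V" for z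
  proof -
    obtain k where k: "z / \<pi> ^ k \<in> V" "z / \<pi> ^ Suc k \<notin> V"
      using ex_least_nat_less[of "\<lambda>i. z / \<pi> ^ i \<notin> V"] archimedean[OF z(1)] z(2) by auto
    have "z / \<pi> ^ k \<notin> V.nonunits" using k(2) \<pi>(3)[of "z / \<pi> ^ k"] by (auto simp: mult.commute)
    then have "unit (z / \<pi> ^ k)" using k(1) by (auto simp: unit_def V.nonunits_def)
    then show ?thesis by (intro exI[of _ "int k"]) simp
  qed
  have decomp: "\<exists>k. unit (z / \<pi> powi k)" if z: "z \<noteq> 0" for z
  proof (cases "z \<in> V")
    case False
    then have "inverse z \<in> V" using V.total[of z] by blast
    then obtain k where "unit (inverse z / \<pi> powi k)" using decomp_V[of "inverse z"] z by auto
    from unit_inverse[OF this] have "unit (z / \<pi> powi (- k))"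
      using z by (simp add: power_int_minus divide_inverse)
    then show ?thesis by blast
  qed (use decomp_V z in blast)
  have unique: "k = l" if "unit (z / \<pi> powi k)" "unit (z / \<pi> powi l)" for z k l
  proof -
    have z: "z \<noteq> 0" using that by (auto simp: unit_def)
    have "unit ((z / \<pi> powi k) * inverse (z / \<pi> powi l))" by (intro unit_mult unit_inverse that)
    also have "(z / \<pi> powi k) * inverse (z / \<pi> powi l) = \<pi> powi (l - k)"
      using z \<pi>(2) by (simp add: power_int_diff field_simps)
    finally have "\<pi> powi (l - k) \<in> V" "\<pi> powi (k - l) \<in> V"
      unfolding unit_def by (simp_all flip: power_int_minus)
    then show ?thesis by (simp add: powi_V)
  qed
  define v where "v z = (THE k. unit (z / \<pi> powi k))" for z
  have v_eqI: "v z = k" if "unit (z / \<pi> powi k)" for z k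
    unfolding v_def using that unique by (intro the_equality) blast+
  have v_unit: "unit (z / \<pi> powi v z)" if "z \<noteq> 0" for z using decomp[OF that] v_eqI by metis
  have v_V: "x \<in> V \<longleftrightarrow> 0 \<le> v x" if x: "x \<noteq> 0" for x
  proof
    assume "x \<in> V"
    then have "inverse (x / \<pi> powi v x) * x \<in> V" using v_unit[OF x] by (intro V.mult_mem) (simp_all add: unit_def)
    then show "0 \<le> v x" using x by (simp add: powi_V)
  next
    assume "0 \<le> v x"
    then have "(x / \<pi> powi v x) * \<pi> powi v x \<in> V"
      using v_unit[OF x] by (intro V.mult_mem) (simp_all add: unit_def powi_V)
    then show "x \<in> V" using \<pi>(2) by simp
  qed
  have v_mult: "v (x * y) = v x + v y" if "x \<noteq> 0" "y \<noteq> 0" for x y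
  proof (rule v_eqI)
    have eq: "x * y / \<pi> powi (v x + v y) = (x / \<pi> powi v x) * (y / \<pi> powi v y)"
      using \<pi>(2) by (simp add: power_int_add)
    show "unit (x * y / \<pi> powi (v x + v y))" unfolding eq by (intro unit_mult v_unit that)
  qed
  have v_powi: "v (\<pi> powi k) = k" for k
    using \<pi>(2) V.one_mem by (intro v_eqI) (simp add: unit_def)
  have v_add: "v x \<le> v (x + y)" if "x \<noteq> 0" "y \<noteq> 0" "x + y \<noteq> 0" "v x \<le> v y" for x y
  proof -
    define p where "p = \<pi> powi (- v x)"
    have p: "p \<noteq> 0" "v p = - v x" using \<pi>(2) by (simp_all add: p_def v_powi)
    have "x * p \<in> V" "y * p \<in> V" using that p by (simp_all add: v_V v_mult)
    then have "(x + y) * p \<in> V" by (simp add: distrib_right V.add_mem)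
    then show ?thesis using that p by (simp add: v_V v_mult)
  qed
  have "int_valuation v"
  proof
    show "v (x * y) = v x + v y" if "x \<noteq> 0" "y \<noteq> 0" for x y using v_mult that .
    show "min (v x) (v y) \<le> v (x + y)" if "x \<noteq> 0" "y \<noteq> 0" "x + y \<noteq> 0" for x y
      using v_add[of x y] v_add[of y x] that by (cases "v x \<le> v y") (auto simp: add.commute)
    show "\<exists>t. t \<noteq> 0 \<and> v t = 1" using v_powi[of 1] \<pi>(2) by (intro exI[of _ \<pi>]) simp
  qed
  then show ?thesis using v_V by blast
qed

end

section \<open>The ring of functions integral away from infinity\<close>

context valuation_subring
begin

text \<open>Division by \<open>a ^ (k - 1)\<close> expresses \<open>a\<close> as a polynomial in
  \<open>inverse a\<close>, which lies in \<open>V\<close> if \<open>a\<close> does not.\<close>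

lemma integral_mem:
  assumes k: "0 < k" and c: "\<And>i. i < k \<Longrightarrow> c i \<in> V" and a: "a ^ k = (\<Sum>i<k. c i * a ^ i)"
  shows "a \<in> V"
proof (rule ccontr)
  assume n: "a \<notin> V"
  then have i: "inverse a \<in> V" and a0: "a \<noteq> 0" using total zero_mem by auto
  have "a = a ^ k * inverse a ^ (k - 1)"
    using k a0 by (cases k) (simp_all add: power_inverse)
  also have "\<dots> = (\<Sum>i<k. c i * inverse a ^ (k - 1 - i))"
    unfolding a sum_distrib_right
  proof (rule sum.cong)
    fix i assume "i \<in> {..<k}"
    then have k1: "k - 1 = i + (k - 1 - i)" by auto
    have e: "inverse a ^ (k - 1) = inverse a ^ i * inverse a ^ (k - 1 - i)"
      by (subst k1) (rule power_add)
    have o: "a ^ i * inverse a ^ i = 1" using a0 by (simp add: power_inverse)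
    have "c i * a ^ i * inverse a ^ (k - 1) = c i * (a ^ i * inverse a ^ i) * inverse a ^ (k - 1 - i)"
      unfolding e by (simp only: mult.assoc)
    then show "c i * a ^ i * inverse a ^ (k - 1) = c i * inverse a ^ (k - 1 - i)"
      unfolding o by simp
  qed simp
  also have "\<dots> \<in> V" using c i by (intro sum_mem mult_mem power_mem) auto
  finally show False using n by simp
qed

text \<open>If \<open>inverse x\<close> is in \<open>V\<close>, then so is
  \<open>y = (x * y) * inverse x\<close>, and hence \<open>x\<close> as a difference.\<close>

lemma sum_prod_mem:
  assumes "x + y \<in> V" "x * y \<in> V"
  shows "x \<in> V"
proof (rule ccontr)
  assume n: "x \<notin> V"
  then have i: "inverse x \<in> V" and "x \<noteq> 0" using total zero_mem by auto
  then have "x * y * inverse x = y" by simp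
  then have "y \<in> V" using mult_mem[OF assms(2) i] by (simp only:)
  from diff_mem[OF assms(1) this] show False using n by simp
qed

end

section \<open>Arithmetic of the ring \<open>A\<close>\<close>

locale function_ring = finite_function_field F + int_valuation v
  for F :: "'k::field set" and v :: "'k \<Rightarrow> int" +
  fixes Pinf V
  assumes V_place: "valuation_ring_at F Pinf V"
    and v_V: "x \<noteq> 0 \<Longrightarrow> x \<in> V \<longleftrightarrow> 0 \<le> v x"
begin

abbreviation "A \<equiv> integral_away F Pinf"

lemma A_iff: "z \<in> A \<longleftrightarrow> (\<forall>P W. valuation_ring_at F P W \<and> P \<noteq> Pinf \<longrightarrow> z \<in> W)"
  unfolding integral_away_def place_def integral_at_def
  using valuation_ring_of_place_unique by blast

interpretation A: field_subring A
  using subring_integral_away by (simp add: field_subring_iff)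

lemma place_valuation_subring:
  assumes "valuation_ring_at F P W"
  shows "valuation_subring W" "F \<subseteq> W"
  using assms valuation_ringD[of F W] by (auto simp: valuation_ring_at_def)

lemma F_subset_A: "F \<subseteq> A"
proof
  fix x assume "x \<in> F"
  then show "x \<in> A" unfolding A_iff using place_valuation_subring(2) by blast
qed

text \<open>A nonconstant element has a pole by \<open>exists_pole\<close>, but for an element of
  \<open>A\<close> it can only be at \<open>Pinf\<close>, where membership in \<open>V\<close>
  excludes it.\<close>

lemma A_Int_V: "z \<in> A \<Longrightarrow> z \<in> V \<Longrightarrow> z \<in> F"
  using exists_pole[of z] V_place valuation_ring_of_place_unique A_iff by blast

lemma v_F: "x \<in> F \<Longrightarrow> x \<noteq> 0 \<Longrightarrow> v x = 0"
  using v_V[of x] v_V[of "inverse x"] v_inverse[of x] inverse_mem[of x] place_valuation_subring(2)[OF V_place]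
  by force

lemma v_A:
  assumes "x \<in> A" "x \<noteq> 0"
  shows "v x \<le> 0"
  using A_Int_V[of x] v_V[of x] v_F[of x] assms by force

lemma v_A_neg:
  assumes "y \<in> A" "y \<notin> F"
  shows "y \<noteq> 0" "v y < 0"
proof -
  show "y \<noteq> 0" using assms zero_mem by auto
  then show "v y < 0" using A_Int_V[of y] v_V[of y] assms by force
qed

text \<open>Intended for the diagonal of a triangular conjugate, whose trace and determinant lie in
  \<open>A\<close>.\<close>

lemma A_sum_prod:
  assumes "x + y \<in> A" "x * y \<in> A"
  shows "x \<in> A"
  unfolding A_iff
  using assms place_valuation_subring(1) valuation_subring.sum_prod_mem unfolding A_iff by blast

lemma poly_A: "p \<in> poly_over F \<Longrightarrow> y \<in> A \<Longrightarrow> poly p y \<in> A"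
  by (rule poly_mem[OF A.field_subring_axioms F_subset_A])

text \<open>The powers of \<open>z\<close> satisfy a relation over \<open>F[y]\<close>. Multiplied
  by the leading coefficient of that relation, \<open>z\<close> becomes integral over
  \<open>F[y]\<close>, hence integral at every place other than \<open>Pinf\<close>.\<close>

lemma A_clear_denominator:
  assumes y: "y \<in> A" "y \<notin> F"
  shows "\<exists>c\<in>poly_over F. c \<noteq> 0 \<and> poly c y * z \<in> A"
proof -
  obtain M p where p: "\<forall>i\<le>M. p i \<in> poly_over F" "\<exists>i\<le>M. p i \<noteq> 0" "(\<Sum>i\<le>M::nat. poly (p i) y * z ^ i) = 0"
    using dependent[of y] by meson
  define m where "m = (GREATEST i. i \<le> M \<and> p i \<noteq> 0)"
  have m: "m \<le> M" "p m \<noteq> 0"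
    using GreatestI_ex_nat[of "\<lambda>i. i \<le> M \<and> p i \<noteq> 0" M] p(2) unfolding m_def by blast+
  have top: "p i = 0" if "i \<le> M" "m < i" for i
    using Greatest_le_nat[of "\<lambda>i. i \<le> M \<and> p i \<noteq> 0" i M] that unfolding m_def by force
  define c where "c i = poly (p i) y" for i
  have cA: "c i \<in> A" if "i \<le> M" for i using poly_A p(1) y(1) that by (simp add: c_def)
  have "(\<Sum>i\<le>M. c i * z ^ i) = (\<Sum>i\<le>m. c i * z ^ i)"
    using m(1) top by (intro sum.mono_neutral_right) (auto simp: c_def not_le)
  also have "{..m} = insert m {..<m}" by auto
  finally have "c m * z ^ m + (\<Sum>i<m. c i * z ^ i) = 0" using p(3) by (simp add: c_def)
  then have rel: "c m * z ^ m = - (\<Sum>i<m. c i * z ^ i)" by (simp add: eq_neg_iff_add_eq_0)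
  have m0: "0 < m"
  proof (rule ccontr)
    assume "\<not> 0 < m"
    then have "poly (p m) y = 0" using rel by (simp add: c_def)
    then show False using transcendental_root[OF y(2)] p(1) m by blast
  qed
  define a where "a = c m * z"
  have am: "a ^ m = (\<Sum>i<m. - (c i * c m ^ (m - 1 - i)) * a ^ i)"
  proof -
    have "a ^ m = c m ^ (m - 1) * (c m * z ^ m)"
      using m0 by (cases m) (simp_all add: a_def power_mult_distrib mult_ac)
    also have "\<dots> = (\<Sum>i<m. - (c m ^ (m - 1) * (c i * z ^ i)))"
      unfolding rel by (simp add: sum_distrib_left sum_negf)
    also have "\<dots> = (\<Sum>i<m. - (c i * c m ^ (m - 1 - i)) * a ^ i)"
    proof (rule sum.cong)
      fix i assume "i \<in> {..<m}"
      then have m1: "m - 1 = (m - 1 - i) + i" by auto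
      have "c m ^ (m - 1) = c m ^ (m - 1 - i) * c m ^ i" by (subst m1) (rule power_add)
      then show "- (c m ^ (m - 1) * (c i * z ^ i)) = - (c i * c m ^ (m - 1 - i)) * a ^ i"
        by (simp add: a_def power_mult_distrib mult_ac)
    qed simp
    finally show ?thesis .
  qed
  have "a \<in> A"
    unfolding A_iff
  proof (intro allI impI)
    fix P W assume PW: "valuation_ring_at F P W \<and> P \<noteq> Pinf"
    interpret W: valuation_subring W using PW place_valuation_subring(1) by blast
    have cW: "c i \<in> W" if "i \<le> m" for i using cA[of i] m(1) that PW unfolding A_iff by auto
    show "a \<in> W"
    proof (rule W.integral_mem[OF m0 _ am])
      show "- (c i * c m ^ (m - 1 - i)) \<in> W" if "i < m" for i
        using that by (intro W.minus_mem W.mult_mem W.power_mem cW) auto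
    qed
  qed
  then show ?thesis using p(1) m by (intro bexI[of _ "p m"]) (simp_all add: a_def c_def)
qed

text \<open>Since \<open>y\<close> has negative valuation, the leading term dominates all
  others.\<close>

lemma v_poly:
  assumes y: "y \<in> A" "y \<notin> F" and p: "p \<in> poly_over F" "p \<noteq> 0"
  shows "poly p y \<noteq> 0 \<and> v (poly p y) = int (Polynomial.degree p) * v y"
  using p
proof (induction p)
  case (pCons a p)
  note vy = v_A_neg[OF y]
  have a: "a \<in> F" "p \<in> poly_over F" using pCons.prems by (simp_all add: poly_over_pCons)
  show ?case
  proof (cases "p = 0")
    case True
    then show ?thesis using pCons.prems a v_F by simp
  next
    case False
    then have IH: "poly p y \<noteq> 0" "v (poly p y) = int (Polynomial.degree p) * v y"
      using pCons.IH a by auto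
    have vyp: "v (y * poly p y) = int (Polynomial.degree (pCons a p)) * v y" "y * poly p y \<noteq> 0"
      using IH vy False by (simp_all add: v_mult algebra_simps)
    have "v (y * poly p y) < 0" unfolding vyp using vy False by (simp add: mult_pos_neg)
    then have "vge a (v (y * poly p y) + 1)" using v_F[OF a(1)] by (cases "a = 0") (auto simp: vge_def)
    then show ?thesis using v_add_dominant[OF vyp(2)] vyp(1) by (simp add: add.commute)
  qed
qed simp

text \<open>A maximal family \<open>u\<close> in \<open>A\<close> independent over
  \<open>F[y]\<close> expresses \<open>z\<close> with coefficients in \<open>F(y)\<close>, once a
  multiple of \<open>z\<close> has been moved into \<open>A\<close>. Division with remainder splits
  each coefficient into a polynomial part, which contributes to \<open>a\<close>, and a proper
  fraction, which has nonnegative valuation. So the error has at least the valuation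
  \<open>n\<close>, a lower bound for the \<open>v (u i)\<close>.\<close>

lemma approximation:
  assumes y: "y \<in> A" "y \<notin> F"
  shows "\<exists>n. \<forall>z. \<exists>a\<in>A. vge (z - a) n"
proof -
  define indep where "indep r u \<longleftrightarrow> (\<forall>i<r. u i \<in> A) \<and>
    (\<forall>p. (\<forall>i<r. p i \<in> poly_over F) \<and> (\<Sum>i<r. poly (p i) y * u i) = 0 \<longrightarrow> (\<forall>i<r. p i = 0))"
    for r :: nat and u :: "nat \<Rightarrow> 'k"
  obtain M where M: "\<forall>u. \<exists>p. (\<forall>i\<le>M. p i \<in> poly_over F) \<and> (\<exists>i\<le>M. p i \<noteq> 0) \<and>
      (\<Sum>i\<le>M::nat. poly (p i) y * u i) = 0"
    using dependent by blast
  have "\<not> indep (Suc M) u" for u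
  proof
    assume "indep (Suc M) u"
    then have "\<And>p. (\<forall>i\<le>M. p i \<in> poly_over F) \<Longrightarrow> (\<Sum>i\<le>M. poly (p i) y * u i) = 0 \<Longrightarrow> (\<forall>i\<le>M. p i = 0)"
      unfolding indep_def less_Suc_eq_le lessThan_Suc_atMost by blast
    then show False using M by blast
  qed
  moreover have "indep 0 u" for u by (simp add: indep_def)
  ultimately obtain r u where u: "indep r u" and max: "\<And>u. \<not> indep (Suc r) u"
    using ex_least_nat_less[of "\<lambda>r. \<forall>u. \<not> indep r u" "Suc M"] by blast
  have uA: "u i \<in> A" if "i < r" for i using u that by (simp add: indep_def)
  define n where "n = - (\<Sum>i<r. \<bar>v (u i)\<bar>)"
  have un: "vge (u i) n" if "i < r" for i
  proof -
    have "\<bar>v (u i)\<bar> \<le> (\<Sum>i<r. \<bar>v (u i)\<bar>)" using that by (intro member_le_sum) auto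
    then have "n \<le> v (u i)" unfolding n_def by linarith
    then show ?thesis by (simp add: vge_def)
  qed
  have "\<exists>a\<in>A. vge (z - a) n" for z
  proof -
    obtain c where c: "c \<in> poly_over F" "c \<noteq> 0" "poly c y * z \<in> A"
      using A_clear_denominator[OF y] by blast
    let ?u = "u(r := poly c y * z)"
    have "\<forall>i<Suc r. ?u i \<in> A" using uA c by (auto simp: less_Suc_eq)
    then obtain p where p: "\<forall>i<Suc r. p i \<in> poly_over F" "(\<Sum>i<Suc r. poly (p i) y * ?u i) = 0"
      "\<exists>i<Suc r. p i \<noteq> 0"
      using max[of ?u] unfolding indep_def by blast
    have sum: "(\<Sum>i<r. poly (p i) y * u i) + poly (p r) y * (poly c y * z) = 0" using p(2) by simp
    have pr: "p r \<noteq> 0"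
    proof
      assume "p r = 0"
      then have "(\<Sum>i<r. poly (p i) y * u i) = 0" using sum by simp
      moreover have "\<forall>i<r. p i \<in> poly_over F" using p(1) by simp
      ultimately have "\<forall>i<r. p i = 0" using u unfolding indep_def by blast
      then show False using p(3) \<open>p r = 0\<close> by (auto simp: less_Suc_eq)
    qed
    define Q where "Q = p r * c"
    have Q: "Q \<in> poly_over F" "Q \<noteq> 0" using p(1) c pr by (simp_all add: Q_def poly_over_mult)
    note vQ = v_poly[OF y Q]
    have "\<forall>i\<in>{..<r}. \<exists>st. fst st \<in> poly_over F \<and> snd st \<in> poly_over F \<and> p i = Q * fst st + snd st \<and>
        (snd st = 0 \<or> Polynomial.degree (snd st) < Polynomial.degree Q)"
    proof
      fix i assume "i \<in> {..<r}"
      then have "p i \<in> poly_over F" using p(1) by simp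
      from poly_over_divide[OF this Q] show "\<exists>st. fst st \<in> poly_over F \<and> snd st \<in> poly_over F \<and>
        p i = Q * fst st + snd st \<and> (snd st = 0 \<or> Polynomial.degree (snd st) < Polynomial.degree Q)"
        by auto
    qed
    then obtain st where st: "\<forall>i\<in>{..<r}. fst (st i) \<in> poly_over F \<and> snd (st i) \<in> poly_over F \<and>
        p i = Q * fst (st i) + snd (st i) \<and> (snd (st i) = 0 \<or> Polynomial.degree (snd (st i)) < Polynomial.degree Q)"
      by (rule bchoice[THEN exE])
    define s where "s i = fst (st i)" for i
    define t where "t i = snd (st i)" for i
    have s: "s i \<in> poly_over F" "t i \<in> poly_over F" "p i = Q * s i + t i"
      "t i = 0 \<or> Polynomial.degree (t i) < Polynomial.degree Q" if "i < r" for i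
      using st that by (simp_all add: s_def t_def)
    define a where "a = - (\<Sum>i<r. poly (s i) y * u i)"
    have aA: "a \<in> A"
      unfolding a_def using s(1) uA y(1) poly_A by (intro A.minus_mem A.sum_mem A.mult_mem) auto
    have "poly Q y * z = - (\<Sum>i<r. poly (p i) y * u i)"
      using sum by (simp add: Q_def mult_ac eq_neg_iff_add_eq_0 add.commute)
    also have "\<dots> = - (\<Sum>i<r. poly Q y * (poly (s i) y * u i) + poly (t i) y * u i)"
      using s(3) by (simp add: algebra_simps)
    also have "\<dots> = poly Q y * a - (\<Sum>i<r. poly (t i) y * u i)"
      by (simp add: a_def sum.distrib sum_distrib_left)
    finally have "poly Q y * (z - a) = - (\<Sum>i<r. poly (t i) y * u i)" by (simp add: algebra_simps)
    then have "z - a = - (\<Sum>i<r. poly (t i) y * u i) / poly Q y"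
      using vQ by (metis nonzero_mult_div_cancel_left)
    also have "\<dots> = - (\<Sum>i<r. (poly (t i) y / poly Q y) * u i)"
      by (simp add: sum_divide_distrib)
    finally have za: "z - a = - (\<Sum>i<r. (poly (t i) y / poly Q y) * u i)" .
    have "vge (poly (t i) y / poly Q y) 0" if i: "i < r" for i
    proof (cases "t i = 0")
      case False
      note vt = v_poly[OF y s(2)[OF i] False]
      have "v (poly (t i) y / poly Q y) = (int (Polynomial.degree (t i)) - int (Polynomial.degree Q)) * v y"
        using vt vQ by (simp add: v_divide algebra_simps)
      also have "\<dots> \<ge> 0"
        using s(4)[OF i] False v_A_neg[OF y] by (intro mult_nonpos_nonpos) auto
      finally show ?thesis by (simp add: vge_def)
    qed simp
    then have "vge ((poly (t i) y / poly Q y) * u i) n" if "i < r" for i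
      using vge_mult[of _ 0 "u i" n] un that by (simp only: add_0)
    then have "vge (\<Sum>i<r. (poly (t i) y / poly Q y) * u i) n"
      by (intro vge_sum) (simp only: lessThan_iff)
    then show ?thesis using aA za by (intro bexI[of _ a]) simp_all
  qed
  then show ?thesis by blast
qed

text \<open>The induction starts with the ball of index 1, which meets \<open>A\<close> only in
  zero. When the index drops by one, division by \<open>w\<close> sorts the elements into the
  finitely many classes of \<open>V\<close> modulo the uniformizer \<open>t\<close>, and differences
  within a class fall into the previous ball.\<close>

lemma finite_A_vge: "finite {x \<in> A. vge x n}"
proof -
  interpret constant_valuation_ring F V
  proof -
    have V: "valuation_ring F V" using V_place by (simp add: valuation_ring_at_def)
    interpret V: valuation_subring V by (rule valuation_ringD[OF V])
    show "constant_valuation_ring F V"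
      using valuation_ringD[OF V] by unfold_locales auto
  qed
  have mem_V: "x \<in> V \<longleftrightarrow> vge x 0" for x using v_V[of x] V.zero_mem by (auto simp: vge_def)
  obtain t where t: "t \<noteq> 0" "v t = 1" by (rule v_surj)
  have "t \<in> V.nonunits" using t by (auto simp: V.nonunits_def v_V v_inverse)
  then obtain B where B: "finite B" "\<forall>x\<in>V. \<exists>b\<in>B. \<exists>s\<in>V. x - b = t * s"
    using residue_finite t(1) by blast
  have "finite {x \<in> A. vge x (1 - int k)}" for k
  proof (induction k)
    case 0
    have "x = 0" if "x \<in> A" "vge x 1" for x using v_A[OF that(1)] that(2) by (cases "x = 0") (auto simp: vge_def)
    then have "{x \<in> A. vge x (1 - int 0)} \<subseteq> {0}" by (simp add: subset_iff)
    then show ?case by (rule finite_subset) simp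
  next
    case (Suc k)
    let ?S = "{x \<in> A. vge x (1 - int (Suc k))}" and ?T = "{x \<in> A. vge x (1 - int k)}"
    obtain w where w: "w \<noteq> 0" "v w = 1 - int (Suc k)" by (rule v_surj)
    have "\<exists>b\<in>B. \<exists>s\<in>V. x / w - b = t * s" if "x \<in> ?S" for x
    proof -
      have "x / w \<in> V" using that w by (cases "x = 0") (auto simp: mem_V vge_def v_divide)
      then show ?thesis using B(2) by blast
    qed
    then have S: "?S \<subseteq> (\<Union>b\<in>B. {x \<in> ?S. \<exists>s\<in>V. x / w - b = t * s})" by blast
    have "finite {x \<in> ?S. \<exists>s\<in>V. x / w - b = t * s}" (is "finite ?X") for b
    proof (cases "?X = {}")
      case True
      then show ?thesis by (simp only: finite.emptyI)
    next
      case False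
      then obtain x0 s0 where x0: "x0 \<in> ?S" "s0 \<in> V" "x0 / w - b = t * s0" by blast
      have "?X \<subseteq> (\<lambda>x. x + x0) ` ?T"
      proof
        fix x assume "x \<in> ?X"
        then obtain s where x: "x \<in> ?S" "s \<in> V" "x / w - b = t * s" by blast
        have eq: "x - x0 = w * (t * (s - s0))"
        proof -
          have "t * (s - s0) = x / w - x0 / w" using x(3) x0(3) by (simp add: algebra_simps)
          then show ?thesis using w by (simp add: field_simps)
        qed
        have "vge (s - s0) 0" using x(2) x0(2) V.diff_mem mem_V by blast
        then have "vge (w * (t * (s - s0))) (v w + (v t + 0))"
          by (intro vge_mult) (simp_all add: vge_def)
        then have "vge (x - x0) (1 - int k)" unfolding eq using w t by simp
        moreover have "x - x0 \<in> A" using x(1) x0(1) by (intro A.diff_mem) simp_all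
        ultimately have "x - x0 \<in> ?T" by simp
        then show "x \<in> (\<lambda>x. x + x0) ` ?T" by (intro image_eqI[of _ _ "x - x0"]) auto
      qed
      then show ?thesis using Suc.IH finite_subset by blast
    qed
    then show ?case using S B(1) by (meson finite_UN_I finite_subset)
  qed
  from this[of "nat (1 - n)"] show ?thesis
    by (rule finite_subset[rotated]) (auto intro: vge_mono)
qed

end

section \<open>The group \<open>GL2\<close>\<close>

lemma GL2_simps:
  "x \<otimes>\<^bsub>GL2 S\<^esub> y = x ** y" "\<one>\<^bsub>GL2 S\<^esub> = mat 1"
  by (simp_all add: GL2_def units_of_def mat2_monoid_def)

lemma carrier_GL2:
  "carrier (GL2 S) = {M. (\<forall>i j. M $ i $ j \<in> S) \<and> (\<exists>N. (\<forall>i j. N $ i $ j \<in> S) \<and> N ** M = mat 1 \<and> M ** N = mat 1)}"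
  by (auto simp: GL2_def units_of_def Units_def mat2_monoid_def)

lemma finite_matrices:
  assumes "finite S"
  shows "finite {M :: 'k::zero^2^2. \<forall>i j. M $ i $ j \<in> S}"
proof (rule finite_subset)
  let ?f = "\<lambda>(x, y, z, w). vector [vector [x, y], vector [z, w]] :: 'k^2^2"
  show "{M :: 'k^2^2. \<forall>i j. M $ i $ j \<in> S} \<subseteq> ?f ` (S \<times> S \<times> S \<times> S)"
  proof
    fix M :: "'k^2^2" assume M: "M \<in> {M. \<forall>i j. M $ i $ j \<in> S}"
    have "M = ?f (M $ 1 $ 1, M $ 1 $ 2, M $ 2 $ 1, M $ 2 $ 2)"
      by (simp add: vec_eq_iff forall_2 vector_2)
    then show "M \<in> ?f ` (S \<times> S \<times> S \<times> S)" by (rule image_eqI) (use M in auto)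
  qed
  show "finite (?f ` (S \<times> S \<times> S \<times> S))" using assms by simp
qed

lemma entries_matrix_mult:
  fixes M N :: "'k::semiring_1^2^2"
  shows "(M ** N) $ i $ j = M $ i $ 1 * N $ 1 $ j + M $ i $ 2 * N $ 2 $ j"
  by (simp add: matrix_matrix_mult_def sum_2)

text \<open>No letter lies in \<open>P - J\<close>, so an alternating word is a single right letter
  outside \<open>P\<close>.\<close>

lemma (in group) trivial_amalgam:
  assumes "subgroup P G"
  shows "is_amalgamated_product G P (carrier G) P"
proof -
  interpret subgroup_pair G P "carrier G"
    using assms by (intro subgroup_pair.intro subgroup_pair_axioms.intro group_axioms subgroup_self)
  have PJ: "P \<inter> carrier G = P" using subgroup.subset[OF assms] by blast
  have "is_amalgamated_product G P (carrier G) (P \<inter> carrier G)"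
  proof (rule is_amalgamated_productI)
    show "carrier G \<subseteq> generate G (P \<union> carrier G)" by (auto intro: generate.incl)
    show "word_value G id id w \<noteq> \<one>" if "alternating P (carrier G) (P \<inter> carrier G) s w" for s w
      using that
    proof (cases rule: alternating.cases)
      case (single_right x)
      then show ?thesis using subgroup.one_closed[OF assms] by (auto simp: word_value_def)
    next
      case (Cons_right x u)
      from Cons_right(4) have False unfolding PJ by (cases rule: alternating.cases) auto
      then show ?thesis ..
    qed (auto simp: PJ)
  qed
  then show ?thesis unfolding PJ .
qed

section \<open>The group over \<open>A\<close> in the coordinates of a cusp\<close>

context function_ring
begin

interpretation A: field_subring A
  using subring_integral_away by (simp add: field_subring_iff)

abbreviation "G \<equiv> GL2 A"

text \<open>The determinants of \<open>g\<close> and of its inverse lie in \<open>A\<close>, so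
  neither valuation is positive, and the two add up to zero.\<close>

lemma det_GL2:
  assumes "g \<in> carrier G"
  shows "det g \<noteq> 0" "v (det g) = 0" "det g \<in> A"
proof -
  obtain h where gh: "\<forall>i j. g $ i $ j \<in> A" "\<forall>i j. h $ i $ j \<in> A" "h ** g = mat 1"
    using assms by (auto simp: carrier_GL2)
  have dA: "det g \<in> A" "det h \<in> A"
    using gh by (auto simp: det_2 intro!: A.diff_mem A.mult_mem)
  have one: "det h * det g = 1" using gh(3) by (metis det_I det_mul)
  then have nz: "det g \<noteq> 0" "det h \<noteq> 0" by auto
  have "v (det h) + v (det g) = 0" using v_mult[of "det h" "det g"] nz one v_one by simp
  then show "det g \<noteq> 0" "v (det g) = 0" "det g \<in> A"
    using nz dA v_A[OF dA(1)] v_A[OF dA(2)] by auto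
qed

definition translation :: "'k \<Rightarrow> 'k^2^2" where
  "translation u = vector [vector [1, u], vector [0, 1]]"

lemma translation_entries:
  "translation u $ 1 $ 1 = 1" "translation u $ 1 $ 2 = u" "translation u $ 2 $ 1 = 0" "translation u $ 2 $ 2 = 1"
  by (simp_all add: translation_def vector_2)

lemma translation_inverse: "translation u ** translation (- u) = mat 1" "translation (- u) ** translation u = mat 1"
  by (simp_all add: vec_eq_iff forall_2 entries_matrix_mult translation_entries mat_def)

text \<open>
  Here \<open>\<sigma>\<close> maps the point at infinity to \<open>s\<close>, \<open>\<tau>\<close> is its inverse, and \<open>f\<close> is a denominator of \<open>s\<close>.
\<close>

lemma amalgam_at_cusp:
  fixes \<sigma> \<tau> :: "'k^2^2"
  assumes y: "y \<in> A" "y \<notin> F" and f: "f \<in> A" "f \<noteq> 0"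
    and inverse: "\<sigma> ** \<tau> = mat 1" "\<tau> ** \<sigma> = mat 1"
    and lower: "\<And>g. \<forall>i j. g $ i $ j \<in> A \<Longrightarrow> f\<^sup>2 * (\<tau> ** g ** \<sigma>) $ 2 $ 1 \<in> A"
    and upper: "\<And>g. \<forall>i j. g $ i $ j \<in> A \<Longrightarrow> (\<tau> ** g ** \<sigma>) $ 1 $ 2 \<in> A"
    and transl: "\<And>x i j. x \<in> A \<Longrightarrow> (\<sigma> ** translation (f\<^sup>2 * x) ** \<tau>) $ i $ j \<in> A"
    and stab: "\<And>g. g \<in> carrier G \<Longrightarrow> moebius g s = s \<longleftrightarrow> (\<tau> ** g ** \<sigma>) $ 2 $ 1 = 0"
  shows "\<exists>H J. subgroup H G \<and> subgroup J G \<and> finite J \<and> J \<subseteq> stabilizer G moebius s \<inter> H \<and>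
           is_amalgamated_product G (stabilizer G moebius s) H J"
proof -
  define \<rho> where "\<rho> g = \<tau> ** g ** \<sigma>" for g
  have \<rho>_inv: "\<sigma> ** \<rho> g ** \<tau> = g" for g
  proof -
    have "\<sigma> ** \<rho> g ** \<tau> = (\<sigma> ** \<tau>) ** g ** (\<sigma> ** \<tau>)" by (simp only: \<rho>_def matrix_mul_assoc)
    then show ?thesis by (simp add: inverse)
  qed
  have \<rho>_inv': "\<rho> (\<sigma> ** h ** \<tau>) = h" for h
  proof -
    have "\<rho> (\<sigma> ** h ** \<tau>) = (\<tau> ** \<sigma>) ** h ** (\<tau> ** \<sigma>)" by (simp only: \<rho>_def matrix_mul_assoc)
    then show ?thesis by (simp add: inverse)
  qed
  have \<rho>_mult: "\<rho> (g ** h) = \<rho> g ** \<rho> h" for g h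
  proof -
    have "\<rho> g ** \<rho> h = \<tau> ** g ** (\<sigma> ** \<tau>) ** h ** \<sigma>" by (simp only: \<rho>_def matrix_mul_assoc)
    then show ?thesis by (simp add: inverse \<rho>_def matrix_mul_assoc)
  qed
  have \<rho>_one: "\<rho> (mat 1) = mat 1" by (simp add: \<rho>_def inverse)
  have dst: "det \<tau> * det \<sigma> = 1" using inverse(2) by (metis det_I det_mul)
  have det_\<rho>: "det (\<rho> g) = det g" for g
  proof -
    have "det (\<rho> g) = (det \<tau> * det \<sigma>) * det g" by (simp only: \<rho>_def det_mul mult_ac)
    then show ?thesis by (simp add: dst)
  qed
  \<comment> \<open>When \<open>\<rho> g\<close> is triangular, trace and determinant are the sum
    and the product of its diagonal entries, which brings these entries into \<open>A\<close> by
    \<open>A_sum_prod\<close>.\<close>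
  have trace_\<rho>: "\<rho> g $ 1 $ 1 + \<rho> g $ 2 $ 2 = g $ 1 $ 1 + g $ 2 $ 2" for g
  proof -
    have "trace (\<rho> g) = trace (\<sigma> ** (\<tau> ** g))" unfolding \<rho>_def by (rule trace_mul_sym)
    also have "\<dots> = trace g" by (simp add: matrix_mul_assoc inverse)
    finally show ?thesis by (simp add: trace_def sum_2)
  qed
  have G: "\<forall>i j. g $ i $ j \<in> A" if "g \<in> carrier G" for g using that by (simp add: carrier_GL2)
  interpret group G by (rule group_GL2[OF subring_integral_away])
  obtain n0 where n0: "\<And>z. \<exists>a\<in>A. vge (z - a) n0" using approximation[OF y] by blast
  \<comment> \<open>The first bound serves \<open>lower\<close>: a nonzero \<open>c\<close> with
    \<open>f\<^sup>2 * c \<in> A\<close> has \<open>v c \<le> - 2 * v f\<close>. The second is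
    \<open>n0\<close> scaled by \<open>f\<^sup>2\<close>, since \<open>transl\<close> provides
    translations by multiples of \<open>f\<^sup>2\<close>. Both requirements persist when
    \<open>n\<close> decreases.\<close>
  define n where "n = min (2 * v f) (n0 + 2 * v f)"
  have diag: "\<rho> g $ 1 $ 1 \<in> A" "\<rho> g $ 2 $ 2 \<in> A" "v (\<rho> g $ 1 $ 1) = 0" "v (\<rho> g $ 2 $ 2) = 0"
    "\<rho> g $ 1 $ 1 \<noteq> 0" "\<rho> g $ 2 $ 2 \<noteq> 0"
    if g: "g \<in> carrier G" and c: "\<rho> g $ 2 $ 1 = 0" for g
  proof -
    have s: "\<rho> g $ 1 $ 1 + \<rho> g $ 2 $ 2 \<in> A" unfolding trace_\<rho> using G[OF g] by (intro A.add_mem) auto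
    have p: "\<rho> g $ 1 $ 1 * \<rho> g $ 2 $ 2 = det g" using det_\<rho>[of g] c by (simp add: det_2)
    then have pA: "\<rho> g $ 1 $ 1 * \<rho> g $ 2 $ 2 \<in> A" using det_GL2[OF g] by simp
    show a: "\<rho> g $ 1 $ 1 \<in> A" using A_sum_prod[OF s pA] .
    show d: "\<rho> g $ 2 $ 2 \<in> A"
      using A_sum_prod[of "\<rho> g $ 2 $ 2" "\<rho> g $ 1 $ 1"] s pA by (simp only: add.commute mult.commute)
    show nz: "\<rho> g $ 1 $ 1 \<noteq> 0" "\<rho> g $ 2 $ 2 \<noteq> 0" using p det_GL2(1)[OF g] by auto
    have "v (\<rho> g $ 1 $ 1) + v (\<rho> g $ 2 $ 2) = 0"
      using v_mult[OF nz] p det_GL2(2)[OF g] by simp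
    then show "v (\<rho> g $ 1 $ 1) = 0" "v (\<rho> g $ 2 $ 2) = 0"
      using v_A[OF a nz(1)] v_A[OF d nz(2)] by auto
  qed
  interpret C: cusp_action v G \<rho> n
  proof
    show "\<rho> (g \<otimes>\<^bsub>G\<^esub> h) = \<rho> g ** \<rho> h" for g h by (simp add: GL2_simps \<rho>_mult)
    show "\<rho> \<one>\<^bsub>G\<^esub> = mat 1" by (simp add: GL2_simps \<rho>_one)
    show "det (\<rho> g) \<noteq> 0" "v (det (\<rho> g)) = 0" if "g \<in> carrier G" for g
      using det_GL2[OF that] by (simp_all add: det_\<rho>)
    show "v (\<rho> g $ 2 $ 1) \<le> - n" if g: "g \<in> carrier G" and c: "\<rho> g $ 2 $ 1 \<noteq> 0" for g
    proof -
      have "f\<^sup>2 * \<rho> g $ 2 $ 1 \<in> A" using lower[OF G[OF g]] by (simp add: \<rho>_def)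
      then have "v (f\<^sup>2 * \<rho> g $ 2 $ 1) \<le> 0" using f c by (intro v_A) auto
      then show ?thesis using f c by (simp add: v_mult v_power n_def)
    qed
    show "v (\<rho> g $ 1 $ 1) = 0 \<and> v (\<rho> g $ 2 $ 2) = 0" if "g \<in> carrier G" "\<rho> g $ 2 $ 1 = 0" for g
      using diag that by blast
    show "\<exists>g\<in>carrier G. \<rho> g $ 1 $ 1 = 1 \<and> \<rho> g $ 2 $ 1 = 0 \<and> \<rho> g $ 2 $ 2 = 1 \<and> vge (z - \<rho> g $ 1 $ 2) n" for z
    proof -
      obtain x where x: "x \<in> A" "vge (z / f\<^sup>2 - x) n0" using n0 by blast
      let ?T = "\<lambda>x. \<sigma> ** translation (f\<^sup>2 * x) ** \<tau>"
      have "?T x ** ?T (- x) = \<sigma> ** translation (f\<^sup>2 * x) ** (\<tau> ** \<sigma>) ** translation (- (f\<^sup>2 * x)) ** \<tau>" for x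
        by (simp add: matrix_mul_assoc)
      then have inv: "?T x ** ?T (- x) = mat 1" for x
        by (simp add: inverse translation_inverse matrix_mul_assoc[symmetric])
      have "?T x \<in> carrier G"
        unfolding carrier_GL2 using transl[OF x(1)] transl[OF A.minus_mem[OF x(1)]] inv[of x] inv[of "- x"]
        by (auto intro!: exI[of _ "?T (- x)"])
      moreover have "vge (z - f\<^sup>2 * x) n"
      proof -
        have "vge (f\<^sup>2 * (z / f\<^sup>2 - x)) (2 * v f + n0)"
          using x(2) f by (intro vge_mult) (simp_all add: vge_def v_power)
        then show ?thesis using f by (simp add: n_def right_diff_distrib vge_mono)
      qed
      ultimately show ?thesis
        by (intro bexI[of _ "?T x"]) (simp_all add: \<rho>_inv' translation_entries)
    qed
  qed
  have stab_eq: "C.stab = stabilizer G moebius s"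
    unfolding C.stab_def stabilizer_def using stab by (auto simp: \<rho>_def)
  have "finite (C.stab \<inter> C.compl_grp)"
  proof (rule finite_subset[OF C.amalgamated_subset])
    \<comment> \<open>The diagonal entries lie in \<open>A\<close> and have valuation zero, so they
      are constants; the upper right entry lies in \<open>A\<close> and in a ball.\<close>
    define S where "S = F \<union> {x \<in> A. vge x n}"
    have "{g \<in> carrier G. \<rho> g $ 2 $ 1 = 0 \<and> vge (\<rho> g $ 1 $ 2 / \<rho> g $ 2 $ 2) n}
        \<subseteq> (\<lambda>h. \<sigma> ** h ** \<tau>) ` {h. \<forall>i j. h $ i $ j \<in> S}"
    proof
      fix g assume "g \<in> {g \<in> carrier G. \<rho> g $ 2 $ 1 = 0 \<and> vge (\<rho> g $ 1 $ 2 / \<rho> g $ 2 $ 2) n}"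
      then have g: "g \<in> carrier G" "\<rho> g $ 2 $ 1 = 0" "vge (\<rho> g $ 1 $ 2 / \<rho> g $ 2 $ 2) n" by auto
      note d = diag[OF g(1,2)]
      have "\<rho> g $ 1 $ 1 \<in> F" "\<rho> g $ 2 $ 2 \<in> F" using d A_Int_V v_V by auto
      moreover have "vge (\<rho> g $ 1 $ 2) n"
        using g(3) d by (cases "\<rho> g $ 1 $ 2 = 0") (auto simp: vge_def v_divide)
      then have "\<rho> g $ 1 $ 2 \<in> S" using upper[OF G[OF g(1)]] by (simp add: S_def \<rho>_def)
      ultimately have "\<forall>i j. \<rho> g $ i $ j \<in> S" using g(2) zero_mem by (auto simp: forall_2 S_def)
      then show "g \<in> (\<lambda>h. \<sigma> ** h ** \<tau>) ` {h. \<forall>i j. h $ i $ j \<in> S}"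
        using \<rho>_inv[of g] by (intro image_eqI[of _ _ "\<rho> g"]) auto
    qed
    moreover have "finite S" using finite_F finite_A_vge by (simp add: S_def)
    ultimately show "finite {g \<in> carrier G. \<rho> g $ 2 $ 1 = 0 \<and> vge (\<rho> g $ 1 $ 2 / \<rho> g $ 2 $ 2) n}"
      using finite_matrices[of S] finite_subset by blast
  qed
  then show ?thesis
    using C.stab_amalgam C.subgroup_compl_grp subgroups_Inter_pair[OF C.subgroup_stab C.subgroup_compl_grp]
    unfolding stab_eq by (intro exI[of _ C.compl_grp] exI[of _ "C.stab \<inter> C.compl_grp"]) (simp add: stab_eq)
qed

lemma amalgam:
  assumes y: "y \<in> A" "y \<notin> F"
  shows "\<exists>H J. subgroup H G \<and> subgroup J G \<and> finite J \<and> J \<subseteq> stabilizer G moebius s \<inter> H \<and>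
           is_amalgamated_product G (stabilizer G moebius s) H J"
proof (cases s)
  case None
  show ?thesis
  proof (rule amalgam_at_cusp[OF y, of 1 "mat 1" "mat 1"])
    show "(mat 1 ** translation (1\<^sup>2 * x) ** mat 1) $ i $ j \<in> A" if "x \<in> A" for x i j
      using that A.zero_mem A.one_mem exhaust_2[of i] exhaust_2[of j] by (auto simp: translation_entries)
  qed (use A.one_mem None in \<open>auto simp: moebius_def\<close>)
next
  case (Some z)
  obtain c where c: "c \<in> poly_over F" "c \<noteq> 0" "poly c y * z \<in> A" using A_clear_denominator[OF y] by blast
  define f where "f = poly c y"
  have f: "f \<in> A" "f \<noteq> 0" "f * z \<in> A"
    using c poly_A[OF c(1) y(1)] v_poly[OF y c(1,2)] by (simp_all add: f_def)
  define e where "e = f * z"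
  have e: "e \<in> A" using f by (simp add: e_def)
  \<comment> \<open>A matrix of determinant one that sends infinity to \<open>z\<close>;
    \<open>\<tau>\<close> is its inverse.\<close>
  define \<sigma> :: "'k^2^2" where "\<sigma> = vector [vector [z, - 1], vector [1, 0]]"
  define \<tau> :: "'k^2^2" where "\<tau> = vector [vector [0, 1], vector [- 1, z]]"
  have \<sigma>: "\<sigma> $ 1 $ 1 = z" "\<sigma> $ 1 $ 2 = - 1" "\<sigma> $ 2 $ 1 = 1" "\<sigma> $ 2 $ 2 = 0"
    and \<tau>: "\<tau> $ 1 $ 1 = 0" "\<tau> $ 1 $ 2 = 1" "\<tau> $ 2 $ 1 = - 1" "\<tau> $ 2 $ 2 = z"
    by (simp_all add: \<sigma>_def \<tau>_def vector_2)
  note simps = entries_matrix_mult \<sigma> \<tau> translation_entries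
  show ?thesis
  proof (rule amalgam_at_cusp[OF y f(1,2), of \<sigma> \<tau>])
    show "\<sigma> ** \<tau> = mat 1" "\<tau> ** \<sigma> = mat 1"
      by (simp_all add: vec_eq_iff forall_2 simps mat_def)
    fix g :: "'k^2^2"
    assume g: "\<forall>i j. g $ i $ j \<in> A"
    \<comment> \<open>The entry is quadratic in \<open>z\<close>, so two factors \<open>f\<close>
      clear it. They also make the conjugated translations integral below.\<close>
    have "f\<^sup>2 * (\<tau> ** g ** \<sigma>) $ 2 $ 1 =
        g$2$1 * e * e + (g$2$2 - g$1$1) * f * e - g$1$2 * f * f"
      by (simp add: simps power2_eq_square algebra_simps e_def)
    also have "\<dots> \<in> A" using g f e by (intro A.diff_mem A.add_mem A.mult_mem) auto
    finally show "f\<^sup>2 * (\<tau> ** g ** \<sigma>) $ 2 $ 1 \<in> A" .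
    show "(\<tau> ** g ** \<sigma>) $ 1 $ 2 \<in> A" using g A.minus_mem by (simp add: simps)
  next
    fix x i j assume x: "x \<in> A"
    have "(\<sigma> ** translation (f\<^sup>2 * x) ** \<tau>) $ 1 $ 1 = 1 - f * e * x"
      "(\<sigma> ** translation (f\<^sup>2 * x) ** \<tau>) $ 1 $ 2 = e * e * x"
      "(\<sigma> ** translation (f\<^sup>2 * x) ** \<tau>) $ 2 $ 1 = - (f * f * x)"
      "(\<sigma> ** translation (f\<^sup>2 * x) ** \<tau>) $ 2 $ 2 = 1 + f * e * x"
      by (simp_all add: simps power2_eq_square algebra_simps e_def)
    then have "\<forall>i j. (\<sigma> ** translation (f\<^sup>2 * x) ** \<tau>) $ i $ j \<in> A"
      unfolding forall_2 using f e x A.one_mem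
      by (simp add: A.diff_mem A.add_mem A.mult_mem A.minus_mem)
    then show "(\<sigma> ** translation (f\<^sup>2 * x) ** \<tau>) $ i $ j \<in> A" by blast
  next
    fix g assume "g \<in> carrier G"
    then have "det g \<noteq> 0" by (rule det_GL2)
    define p q where "p = g$1$1 * z + g$1$2" and "q = g$2$1 * z + g$2$2"
    have "\<not> (q = 0 \<and> p = 0)"
    proof
      assume "q = 0 \<and> p = 0"
      then have "g$2$2 = - (g$2$1 * z)" "g$1$2 = - (g$1$1 * z)"
        by (auto simp: p_def q_def add_eq_0_iff)
      then show False using \<open>det g \<noteq> 0\<close> by (simp add: det_2)
    qed
    moreover have "(\<tau> ** g ** \<sigma>) $ 2 $ 1 = z * q - p"
      by (simp add: simps p_def q_def algebra_simps)
    ultimately show "moebius g s = s \<longleftrightarrow> (\<tau> ** g ** \<sigma>) $ 2 $ 1 = 0"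
      unfolding Some moebius_def p_def[symmetric] q_def[symmetric] option.case
      by (auto simp: divide_eq_eq)
  qed
qed

end

theorem theorem3p5:
  fixes F Pinf :: "'k::field set" and s :: "'k option"
  assumes "finite F"
    and "function_field F"
    and "place F Pinf"
  defines "G \<equiv> GL2 (integral_away F Pinf)"
  shows "\<exists>H J. subgroup H G \<and> subgroup J G \<and> finite J \<and> J \<subseteq> stabilizer G moebius s \<inter> H \<and>
           is_amalgamated_product G (stabilizer G moebius s) H J"
proof (cases "integral_away F Pinf \<subseteq> F")
  case True
  interpret G: group G unfolding G_def by (rule group_GL2[OF subring_integral_away])
  interpret group_action G UNIV moebius
    unfolding G_def by (rule group_action_moebius[OF subring_integral_away])
  have stab: "subgroup (stabilizer G moebius s) G" by (rule stabilizer_subgroup) simp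
  have "finite {M :: 'k^2^2. \<forall>i j. M $ i $ j \<in> integral_away F Pinf}"
    using True assms(1) finite_subset by (intro finite_matrices) blast
  then have "finite (carrier G)"
    by (rule finite_subset[rotated]) (auto simp: G_def carrier_GL2)
  then have "finite (stabilizer G moebius s)"
    using subgroup.subset[OF stab] finite_subset by blast
  then show ?thesis
    using stab G.trivial_amalgam[OF stab] G.subgroup_self subgroup.subset[OF stab] by blast
next
  case False
  then obtain y where y: "y \<in> integral_away F Pinf" "y \<notin> F" by blast
  have "coeff_field F" using assms(2) unfolding function_field_def by (blast intro: coeff_field_subfield)
  then have ff: "finite_function_field F"
    using assms(1,2) by (simp add: finite_function_field_def finite_function_field_axioms_def)
  obtain V where V: "valuation_ring_at F Pinf V" using assms(3) by (auto simp: place_def)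
  then have vr: "valuation_ring F V" by (simp add: valuation_ring_at_def)
  have "constant_valuation_ring F V"
    using ff valuation_ringD[OF vr] by (simp add: constant_valuation_ring_def constant_valuation_ring_axioms_def)
  then obtain v where "int_valuation v" "\<forall>x. x \<noteq> 0 \<longrightarrow> (x \<in> V \<longleftrightarrow> 0 \<le> v x)"
    using constant_valuation_ring.exists_valuation by blast
  then have "function_ring F v Pinf V"
    using ff V by (simp add: function_ring_def function_ring_axioms_def)
  from function_ring.amalgam[OF this y] show ?thesis unfolding G_def .
qed

end
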